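(* Let $d\ge3$, let $h$ and $\lambda>0$ be as in the context, let $\mathbf y$ be a cavitating solution, and suppose that $L:=\lim_{v\to\infty}\frac{h(v)}{v}$ is finite. Let $t>0$ and let $B=B_{\bar R}(0)\subset\mathbb{R}^d$, for some $\bar R>0$, contain a neighborhood of the whole wave fan $\{|\mathbf x|\le\sigma t\}$ at time $t$. Then $$E[\mathbf y,B](t)=E[\lambda\mathbf x,B](t)+\frac{t^d\sigma^d\omega_d}{d}\,J+\frac{t^d\omega_d}{d}\,r(0)^dL,$$ where $$\begin{aligned}J:={}&\tfrac12w_R(t\sigma-,t)^2+h\big(w_R(t\sigma-,t)\lambda^{d-1}\big)-\tfrac12\lambda^2-h(\lambda^d)\\&+\tfrac12\Big[w_R(t\sigma-,t)+h'\big(w_R(t\sigma-,t)\lambda^{d-1}\big)\lambda^{d-1}+\lambda+h'(\lambda^d)\lambda^{d-1}\Big]\big(\lambda-w_R(t\sigma-,t)\big)\end{aligned}$$ is the energy dissipation of the outgoing shock.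
   Context: Material. Let $d\ge3$ and let $h:(0,\infty)\to[0,\infty)$ be three times differentiable with $h''>0$, $h'''<0$, $\lim_{v\to0}h(v)=\lim_{v\to\infty}h(v)=\infty$. $H>0$ denotes the unique number with $h'(H)=0$. For $\mathbf F\in\mathbb{R}^{d\times d}$ with $\det\mathbf F>0$, $W(\mathbf F)=\frac12\sum_{i=1}^d\lambda_i^2+h\big(\prod_{i=1}^d\lambda_i\big)$, where $\lambda_1,\dots,\lambda_d$ are the eigenvalues of $\sqrt{\mathbf F\mathbf F^T}$. Cavitating solution (of K.A. Pericak-Spector and S. Spector) for the stretch $\lambda>0$: $\mathbf y(\mathbf x,t)=w(|\mathbf x|,t)\frac{\mathbf x}{|\mathbf x|}$, $w(R,t)=t\,r(R/t)$ for $t>0$, where for some $\sigma>0$ (the shock speed) the function $r:[0,\infty)\to(0,\infty)$ is continuous, $r(0)>0$, $r(s)=\lambda s$ for $s\ge\sigma$, $r$ is $C^2$ on $(0,\sigma)$ and $C^1$ up to $\sigma$ from the left. With $v(s)=r'(s)(r(s)/s)^{d-1}$, $P_1=r'+(r/s)^{d-1}h'(v)$, $P_2=\frac rs+r'(r/s)^{d-2}h'(v)$: (i) $s^2r''=\frac{d}{ds}P_1+\frac{d-1}{s}(P_1-P_2)$ on $(0,\sigma)$; (ii) $\sigma^2(\lambda-r'(\sigma-))=\lambda+\lambda^{d-1}h'(\lambda^d)-P_1(\sigma-)$; (iii) the Cauchy stress vanishes at the cavity surface, i.e. $v(s)\to H$ as $s\to0^+$. Known properties of this solution, which may be used: $H\le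 v\le\lambda^d$; $r'\ge0$ is strictly increasing on $(0,\sigma]$ and $r'(\sigma-)<\lambda$; $v$ is strictly increasing on $(0,\sigma)$; $r(s)>\lambda s>s\,r'(s)$ for $0<s<\sigma$. Here $w_R(t\sigma-,t)=r'(\sigma-)$ is the left limit at the shock. $\mathbf y$ is extended by $\lambda\mathbf x$ for $t\le0$. Averaging and energy. Let $\phi\in C_c^\infty(\mathbb{R})$ with $\phi\ge0$, $\phi(-x)=\phi(x)$, $\int\phi=1$, $\operatorname{supp}\phi\subset[-1,1]$, $\phi(0)>0$; $\phi_n(R)=n\phi(nR)$. Set $w^n(R,t)=\int_0^\infty[\phi_n(R-\tilde R)-\phi_n(R+\tilde R)]w(\tilde R,t)\,d\tilde R$, $\mathbf y^n(\mathbf x,t)=w^n(|\mathbf x|,t)\frac{\mathbf x}{|\mathbf x|}$, and $$E[\mathbf y,B](t):=\lim_{n\to\infty}\int_B\tfrac12|\mathbf y^n_t(\mathbf x,t)|^2+W(\nabla\mathbf y^n(\mathbf x,t))\,d\mathbf x .$$ For the homogeneous deformation $\lambda\mathbf x$ one has $E[\lambda\mathbf x,B](t)=|B|\,W(\lambda I)=|B|\big(\tfrac d2\lambda^2+h(\lambda^d)\big)$. $\omega_d$ is the surface area of the unit sphere in $\mathbb{R}^d$. *)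

theory Defs
  imports "HOL-Analysis.Analysis" "HOL-Computational_Algebra.Polynomial"
begin

section \<open>Stored energy\<close>

text \<open>
  Functions on the half line \<open>(0,\<infinity>)\<close> are total functions on the reals; only their values at
  positive arguments are constrained.
\<close>

definition volumetric_energy :: "(real \<Rightarrow> real) \<Rightarrow> bool" where
  "volumetric_energy h \<longleftrightarrow>
     (\<forall>v>0. 0 \<le> h v \<and>
        h differentiable (at v) \<and> deriv h differentiable (at v) \<and>
        deriv (deriv h) differentiable (at v) \<and>
        deriv (deriv h) v > 0 \<and> deriv (deriv (deriv h)) v < 0) \<and>
     filterlim h at_top (at_right 0) \<and> filterlim h at_top at_top"

definition positive_semidefinite :: "real^'n^'n \<Rightarrow> bool" where
  "positive_semidefinite A \<longleftrightarrow> transpose A = A \<and> (\<forall>x. 0 \<le> x \<bullet> (A *v x))"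

text \<open>The unique positive semidefinite square root of a positive semidefinite matrix.\<close>

definition matrix_sqrt :: "real^'n^'n \<Rightarrow> real^'n^'n" where
  "matrix_sqrt A = (THE S. positive_semidefinite S \<and> S ** S = A)"

definition charpoly :: "real^'n^'n \<Rightarrow> real poly" where
  "charpoly A = det (\<chi> i j. (if i = j then [:0, 1:] else 0) - [:A $ i $ j:])"

text \<open>Real eigenvalues, with algebraic multiplicity.\<close>

definition eigenvalues :: "real^'n^'n \<Rightarrow> real multiset" where
  "eigenvalues A = proots (charpoly A)"

definition stored_energy :: "(real \<Rightarrow> real) \<Rightarrow> real^'n^'n \<Rightarrow> real" where
  "stored_energy h F =
     (let \<Lambda> = eigenvalues (matrix_sqrt (F ** transpose F))
      in 1/2 * (\<Sum>l\<in>#\<Lambda>. l\<^sup>2) + h (\<Prod>l\<in>#\<Lambda>. l))"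

section \<open>Radial deformations and the averaged energy\<close>

text \<open>The value at the origin, a null set, is \<open>0\<close> because division by zero gives zero.\<close>

definition radial_deformation ::
    "(real \<Rightarrow> real \<Rightarrow> real) \<Rightarrow> real^'n \<Rightarrow> real \<Rightarrow> real^'n" where
  "radial_deformation w x t = w (norm x) t *\<^sub>R (x /\<^sub>R norm x)"

text \<open>
  For a radial deformation the profile is uniquely determined at positive radii; its values at
  other radii do not influence the averaged profile below.
\<close>

definition radial_profile ::
    "(real^'n \<Rightarrow> real \<Rightarrow> real^'n) \<Rightarrow> real \<Rightarrow> real \<Rightarrow> real" where
  "radial_profile y = (SOME w. y = radial_deformation w)"

definition mollifier :: "(real \<Rightarrow> real) \<Rightarrow> bool" where
  "mollifier \<phi> \<longleftrightarrow>
     (\<forall>k x. (deriv ^^ k) \<phi> differentiable (at x)) \<and>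
     (\<forall>x. 0 \<le> \<phi> x) \<and> (\<forall>x. \<phi> (- x) = \<phi> x) \<and> (\<phi> has_integral 1) UNIV \<and>
     closure {x. \<phi> x \<noteq> 0} \<subseteq> {-1..1} \<and> \<phi> 0 > 0"

definition scaled_mollifier :: "(real \<Rightarrow> real) \<Rightarrow> nat \<Rightarrow> real \<Rightarrow> real" where
  "scaled_mollifier \<phi> n R = real n * \<phi> (real n * R)"

definition averaged_profile ::
    "(real \<Rightarrow> real) \<Rightarrow> nat \<Rightarrow> (real \<Rightarrow> real \<Rightarrow> real) \<Rightarrow> real \<Rightarrow> real \<Rightarrow> real" where
  "averaged_profile \<phi> n w R t =
     integral {0..} (\<lambda>S. (scaled_mollifier \<phi> n (R - S) - scaled_mollifier \<phi> n (R + S)) * w S t)"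

definition averaged_deformation ::
    "(real \<Rightarrow> real) \<Rightarrow> nat \<Rightarrow> (real^'n \<Rightarrow> real \<Rightarrow> real^'n) \<Rightarrow> real^'n \<Rightarrow> real \<Rightarrow> real^'n" where
  "averaged_deformation \<phi> n y =
     radial_deformation (averaged_profile \<phi> n (radial_profile y))"

definition energy_density ::
    "(real \<Rightarrow> real) \<Rightarrow> (real^'n \<Rightarrow> real \<Rightarrow> real^'n) \<Rightarrow> real \<Rightarrow> real^'n \<Rightarrow> real" where
  "energy_density h y t x =
     1/2 * (norm (vector_derivative (\<lambda>\<tau>. y x \<tau>) (at t)))\<^sup>2
       + stored_energy h (jacobian (\<lambda>z. y z t) (at x))"

definition averaged_energy ::
    "(real \<Rightarrow> real) \<Rightarrow> (real \<Rightarrow> real) \<Rightarrow> nat \<Rightarrow>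
     (real^'n \<Rightarrow> real \<Rightarrow> real^'n) \<Rightarrow> (real^'n) set \<Rightarrow> real \<Rightarrow> real" where
  "averaged_energy \<phi> h n y B t = integral B (energy_density h (averaged_deformation \<phi> n y) t)"

definition energy ::
    "(real \<Rightarrow> real) \<Rightarrow> (real \<Rightarrow> real) \<Rightarrow>
     (real^'n \<Rightarrow> real \<Rightarrow> real^'n) \<Rightarrow> (real^'n) set \<Rightarrow> real \<Rightarrow> real" where
  "energy \<phi> h y B t = lim (\<lambda>n. averaged_energy \<phi> h n y B t)"

text \<open>The integrals (for large \<open>n\<close>) and the limit in the definition of the energy exist.\<close>

definition energy_exists ::
    "(real \<Rightarrow> real) \<Rightarrow> (real \<Rightarrow> real) \<Rightarrow>
     (real^'n \<Rightarrow> real \<Rightarrow> real^'n) \<Rightarrow> (real^'n) set \<Rightarrow> real \<Rightarrow> bool" where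
  "energy_exists \<phi> h y B t \<longleftrightarrow>
     (\<forall>\<^sub>F n in sequentially.
        energy_density h (averaged_deformation \<phi> n y) t absolutely_integrable_on B) \<and>
     convergent (\<lambda>n. averaged_energy \<phi> h n y B t)"

definition homogeneous_deformation :: "real \<Rightarrow> real^'n \<Rightarrow> real \<Rightarrow> real^'n" where
  "homogeneous_deformation lam x t = lam *\<^sub>R x"

section \<open>Cavitating solutions\<close>

definition specific_volume :: "nat \<Rightarrow> (real \<Rightarrow> real) \<Rightarrow> real \<Rightarrow> real" where
  "specific_volume d r s = deriv r s * (r s / s) ^ (d - 1)"

definition stress1 :: "nat \<Rightarrow> (real \<Rightarrow> real) \<Rightarrow> (real \<Rightarrow> real) \<Rightarrow> real \<Rightarrow> real" where
  "stress1 d h r s = deriv r s + (r s / s) ^ (d - 1) * deriv h (specific_volume d r s)"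

definition stress2 :: "nat \<Rightarrow> (real \<Rightarrow> real) \<Rightarrow> (real \<Rightarrow> real) \<Rightarrow> real \<Rightarrow> real" where
  "stress2 d h r s = r s / s + deriv r s * (r s / s) ^ (d - 2) * deriv h (specific_volume d r s)"

text \<open>
  The last three conditions are the equation of motion, the Rankine-Hugoniot condition at the
  shock, and the vanishing of the Cauchy stress at the cavity surface; \<open>p\<close> and \<open>q\<close> are the left
  limits of \<open>r'\<close> and of the first stress at the shock.
\<close>

definition cavitating_solution ::
    "nat \<Rightarrow> (real \<Rightarrow> real) \<Rightarrow> real \<Rightarrow> real \<Rightarrow> real \<Rightarrow> (real \<Rightarrow> real) \<Rightarrow> bool" where
  "cavitating_solution d h H lam \<sigma> r \<longleftrightarrow>
     0 < \<sigma> \<and>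
     continuous_on {0..} r \<and> (\<forall>s\<ge>0. 0 < r s) \<and> (\<forall>s\<ge>\<sigma>. r s = lam * s) \<and>
     (\<forall>s\<in>{0<..<\<sigma>}. r differentiable (at s) \<and> deriv r differentiable (at s)) \<and>
     continuous_on {0<..<\<sigma>} (deriv (deriv r)) \<and>
     (\<forall>s\<in>{0<..<\<sigma>}. stress1 d h r differentiable (at s) \<and>
        s\<^sup>2 * deriv (deriv r) s =
          deriv (stress1 d h r) s + (real d - 1) / s * (stress1 d h r s - stress2 d h r s)) \<and>
     (\<exists>p q. (deriv r \<longlongrightarrow> p) (at_left \<sigma>) \<and> (stress1 d h r \<longlongrightarrow> q) (at_left \<sigma>) \<and>
        \<sigma>\<^sup>2 * (lam - p) = lam + lam ^ (d - 1) * deriv h (lam ^ d) - q) \<and>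
     (specific_volume d r \<longlongrightarrow> H) (at_right 0)"

text \<open>
  Established properties of the Pericak-Spector--Spector solution, taken as known.
\<close>

definition cavitating_solution_properties ::
    "nat \<Rightarrow> real \<Rightarrow> real \<Rightarrow> real \<Rightarrow> (real \<Rightarrow> real) \<Rightarrow> bool" where
  "cavitating_solution_properties d H lam \<sigma> r \<longleftrightarrow>
     (\<forall>s\<in>{0<..<\<sigma>}. H \<le> specific_volume d r s \<and> specific_volume d r s \<le> lam ^ d) \<and>
     (\<forall>s\<in>{0<..<\<sigma>}. 0 \<le> deriv r s \<and> deriv r s < Lim (at_left \<sigma>) (deriv r)) \<and>
     strict_mono_on {0<..<\<sigma>} (deriv r) \<and>
     Lim (at_left \<sigma>) (deriv r) < lam \<and>
     strict_mono_on {0<..<\<sigma>} (specific_volume d r) \<and>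
     (\<forall>s\<in>{0<..<\<sigma>}. r s > lam * s \<and> lam * s > s * deriv r s)"

definition cavitating_profile ::
    "real \<Rightarrow> (real \<Rightarrow> real) \<Rightarrow> real \<Rightarrow> real \<Rightarrow> real" where
  "cavitating_profile lam r R t = (if t > 0 then t * r (R / t) else lam * R)"

definition cavitating_deformation ::
    "real \<Rightarrow> (real \<Rightarrow> real) \<Rightarrow> real^'n \<Rightarrow> real \<Rightarrow> real^'n" where
  "cavitating_deformation lam r = radial_deformation (cavitating_profile lam r)"

text \<open>The left limit of \<open>w\<^sub>R(\<cdot>,t)\<close> at the shock \<open>R = t\<sigma>\<close>.\<close>

definition shock_slope :: "(real \<Rightarrow> real \<Rightarrow> real) \<Rightarrow> real \<Rightarrow> real \<Rightarrow> real" where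
  "shock_slope w \<sigma> t = Lim (at_left (t * \<sigma>)) (\<lambda>R. deriv (\<lambda>S. w S t) R)"

text \<open>Energy dissipation of the outgoing shock, for the left slope \<open>p\<close> at the shock.\<close>

definition shock_dissipation :: "nat \<Rightarrow> (real \<Rightarrow> real) \<Rightarrow> real \<Rightarrow> real \<Rightarrow> real" where
  "shock_dissipation d h lam p =
     1/2 * p\<^sup>2 + h (p * lam ^ (d - 1)) - 1/2 * lam\<^sup>2 - h (lam ^ d)
     + 1/2 * (p + deriv h (p * lam ^ (d - 1)) * lam ^ (d - 1)
              + lam + deriv h (lam ^ d) * lam ^ (d - 1)) * (lam - p)"

text \<open>
  Surface area of a compact smooth hypersurface, as its Minkowski content of codimension one.
\<close>

definition surface_area :: "(real^'n) set \<Rightarrow> real" where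
  "surface_area S = Lim (at_right 0) (\<lambda>e. measure lebesgue {x. infdist x S \<le> e} / (2 * e))"

end

theory Submission
  imports Defs
begin

text \<open>
  In polar coordinates the averaged energy is an integral of \<open>R\<^sup>d\<^sup>-\<^sup>1\<close> times a radial density in \<open>w\<^sup>n\<close>,
  \<open>w\<^sup>n\<^sub>R\<close> and \<open>w\<^sup>n\<^sub>t\<close>, which are convolutions with \<open>\<phi>\<^sub>n\<close>, except that the jump \<open>2 t r(0)\<close> of the odd
  extension of \<open>w\<close> at the origin adds \<open>2 t r(0) \<phi>\<^sub>n\<close> to \<open>w\<^sup>n\<^sub>R\<close>. Write \<open>h(v) = L v + k(v)\<close> with \<open>k(v) / v \<longlongrightarrow> 0\<close>.
  The term \<open>L v\<close> is an exact derivative and contributes \<open>L w\<^sup>n(Rb,t)\<^sup>d / d\<close> because \<open>w\<^sup>n(0,t) = 0\<close>; compared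
  with the pointwise limit, where \<open>w(0,t) = t r(0)\<close>, this leaves the surface term \<open>t\<^sup>d r(0)\<^sup>d L / d\<close>. Since
  \<open>v\<^sup>n\<close> is bounded below by a positive constant and above by a multiple of \<open>n\<^sup>d\<close>, the remaining terms over
  \<open>R \<le> 1/n\<close> vanish in the limit, and dominated convergence applies for \<open>R > 1/n\<close>. In the limit energy the
  self-similar energy balance makes \<open>d s\<^sup>d\<^sup>-\<^sup>1 e(s)\<close> an exact derivative; the vanishing Cauchy stress kills the
  boundary term at \<open>s = 0\<close>, and the jump condition turns the one at \<open>s = \<sigma>\<close> into the shock dissipation.
\<close>

text \<open>The interval R \<le> 1/n is critical: R^(d-1) is at most n^(1-d) there, v^n may be of
  order n^d and the length is 1/n, so an energy linear in v contributes at order one while a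
  sublinear one contributes nothing in the limit. Hence the split of h at its asymptotic slope L.
  The remainder k still blows up as v tends to 0, so a positive lower bound on v^n, uniform in n, is
  indispensable. It has two sources: up to a radius \<eta>/n the jump at the origin together with
  \<phi>(0) > 0, and farther out the bound H \<le> v, read as a lower bound on the slope by a
  multiple of s^(d-1). The averaging estimates use only such two-sided power bounds, collected in
  the locale \<open>profile\<close> with m = d - 1; the shock enters it as one exceptional radius
  \<open>a\<close>. The derivative of w^n in time is taken after the substitution S = t s, which
  moves all dependence on t into the smooth kernel, so that the corner of r at the shock does no
  harm.\<close>

section \<open>Stored energy of a radial gradient\<close>

text \<open>The matrix b I + (a - b) u u^T. For a unit vector u it stretches by a along u and by b
  across it; the gradient of a radial map has this form with a = w_R, b = w/R and u = x/|x|.\<close>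

definition radial_gradient :: "real \<Rightarrow> real \<Rightarrow> real^'n \<Rightarrow> real^'n^'n" where
  "radial_gradient a b u = (\<chi> i j. (if i = j then b else 0) + (a - b) * u $ i * u $ j)"

lemma radial_gradient_mult_vec:
  "radial_gradient a b u *v x = b *\<^sub>R x + ((a - b) * (u \<bullet> x)) *\<^sub>R u"
proof -
  have "(\<Sum>j\<in>UNIV. ((if i = j then b else 0) + (a - b) * u $ i * u $ j) * x $ j)
      = b * x $ i + (a - b) * (\<Sum>j\<in>UNIV. u $ j * x $ j) * u $ i" for i
  proof -
    have "(\<Sum>j\<in>UNIV. ((if i = j then b else 0) + (a - b) * u $ i * u $ j) * x $ j)
       = (\<Sum>j\<in>UNIV. (if i = j then b * x $ j else 0) + (a - b) * u $ i * (u $ j * x $ j))"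
      by (intro sum.cong) (auto simp: algebra_simps)
    also have "\<dots> = b * x $ i + (a - b) * u $ i * (\<Sum>j\<in>UNIV. u $ j * x $ j)"
      unfolding sum.distrib sum_distrib_left by simp
    finally show ?thesis by simp
  qed
  then show ?thesis
    by (simp add: vec_eq_iff radial_gradient_def matrix_vector_mult_def inner_vec_def)
qed

lemma transpose_radial_gradient [simp]: "transpose (radial_gradient a b u) = radial_gradient a b u"
  by (auto simp: transpose_def radial_gradient_def vec_eq_iff)

lemma radial_gradient_square:
  assumes "norm u = 1"
  shows "radial_gradient a b u ** radial_gradient a b u = radial_gradient (a\<^sup>2) (b\<^sup>2) u"
proof -
  have "u \<bullet> u = 1" using assms by (simp add: norm_eq_1)
  then have "(radial_gradient a b u ** radial_gradient a b u) *v x = radial_gradient (a\<^sup>2) (b\<^sup>2) u *v x" for x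
    unfolding matrix_vector_mul_assoc[symmetric] radial_gradient_mult_vec
    by (simp add: inner_add_right inner_diff_right algebra_simps power2_eq_square)
  then show ?thesis by (metis matrix_eq)
qed

lemma radial_gradient_quadratic_form:
  assumes "norm u = 1" "0 < a" "0 < b"
  shows "0 \<le> x \<bullet> (radial_gradient a b u *v x)"
    and "x \<bullet> (radial_gradient a b u *v x) = 0 \<Longrightarrow> x = 0"
proof -
  have "(u \<bullet> x)\<^sup>2 \<le> x \<bullet> x"
    using Cauchy_Schwarz_ineq[of u x] assms(1) by (simp add: norm_eq_1)
  moreover have e: "x \<bullet> (radial_gradient a b u *v x) = b * (x \<bullet> x - (u \<bullet> x)\<^sup>2) + a * (u \<bullet> x)\<^sup>2"
    unfolding radial_gradient_mult_vec
    by (simp add: inner_add_right algebra_simps power2_eq_square inner_commute)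
  ultimately show "0 \<le> x \<bullet> (radial_gradient a b u *v x)" using assms by simp
  assume "x \<bullet> (radial_gradient a b u *v x) = 0"
  with e \<open>(u \<bullet> x)\<^sup>2 \<le> x \<bullet> x\<close> assms(2,3) have "(u \<bullet> x)\<^sup>2 = 0" "x \<bullet> x - (u \<bullet> x)\<^sup>2 = 0"
    by (smt (verit) mult_nonneg_nonneg mult_pos_pos zero_le_power2)+
  then show "x = 0" by simp
qed

text \<open>
  Uniqueness of the square root: \<open>F = (F\<^sup>2 + a b I) / (a + b)\<close> commutes with every square root \<open>S\<close>
  of \<open>F\<^sup>2\<close>, so \<open>(F + S) (F - S) = 0\<close>, where \<open>F + S\<close> is positive definite.
\<close>

lemma matrix_sqrt_radial_gradient:
  fixes u :: "real^'n"
  assumes u: "norm u = 1" and ab: "0 < a" "0 < b"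
  defines "F \<equiv> radial_gradient a b u"
  shows "matrix_sqrt (F ** transpose F) = F"
proof -
  have tF: "transpose F = F" by (simp add: F_def)
  have psd: "positive_semidefinite F"
    unfolding positive_semidefinite_def
    using radial_gradient_quadratic_form(1)[OF u ab] by (simp add: F_def)
  have "S = F" if S: "positive_semidefinite S" "S ** S = F ** F" for S
  proof -
    \<comment> \<open>Both eigenvalues are roots of X^2 - (a + b) X + a b, so F satisfies this
      equation, here solved for F.\<close>
    have FF: "F *v x = (1 / (a + b)) *\<^sub>R (F *v (F *v x) + (a * b) *\<^sub>R x)" for x
    proof -
      have "(a + b) *\<^sub>R (F *v x) = F *v (F *v x) + (a * b) *\<^sub>R x"
        unfolding matrix_vector_mul_assoc F_def radial_gradient_square[OF u] radial_gradient_mult_vec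
        using u by (simp add: vec_eq_iff norm_eq_1) (simp add: algebra_simps power2_eq_square)
      then show ?thesis using ab by (metis (no_types, lifting) add_pos_pos divideR_right less_irrefl
            inverse_eq_divide)
    qed
    have SS: "S *v (S *v x) = F *v (F *v x)" for x
      using S(2) by (simp add: matrix_vector_mul_assoc)
    have comm: "S *v (F *v x) = F *v (S *v x)" for x
      by (subst (1 2) FF)
        (simp add: SS[symmetric] matrix_vector_right_distrib matrix_vector_mult_scaleR)
    have "S *v x = F *v x" for x
    proof -
      define y where "y = F *v x - S *v x"
      have "F *v y + S *v y = 0"
        unfolding y_def matrix_vector_mult_diff_distrib comm SS by simp
      then have "y \<bullet> (F *v y) + y \<bullet> (S *v y) = 0" by (metis inner_add_right inner_zero_right)
      moreover have "0 \<le> y \<bullet> (S *v y)" "0 \<le> y \<bullet> (F *v y)"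
        using S(1) psd by (auto simp: positive_semidefinite_def)
      ultimately have "y \<bullet> (F *v y) = 0" by linarith
      then have "y = 0" using radial_gradient_quadratic_form(2)[OF u ab] F_def by blast
      then show ?thesis by (simp add: y_def)
    qed
    then show ?thesis by (simp add: matrix_eq)
  qed
  then show ?thesis
    unfolding matrix_sqrt_def tF using psd by (intro the_equality) auto
qed

text \<open>No signs of a and b are assumed, because the characteristic polynomial at x leads to the
  parameters x - a and x - b.\<close>

lemma det_radial_gradient:
  fixes u :: "real^'n"
  assumes u: "norm u = 1"
  shows "det (radial_gradient a b u) = a * b ^ (CARD('n) - 1)"
proof -
  obtain k :: 'n where True by blast
  \<comment> \<open>An orthogonal A with u as its column k conjugates the radial gradient to the
    diagonal matrix \<open>D\<close> below.\<close>
  obtain A where A: "orthogonal_matrix A" and Ak: "A *v axis k (1::real) = u"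
    using orthogonal_matrix_exists_basis[OF u, of k] by blast
  define D :: "real^'n^'n" where "D = (\<chi> i j. if i = j then (if i = k then a else b) else 0)"
  have uk: "u $ i = A $ i $ k" for i
    unfolding Ak[symmetric] by (simp add: matrix_vector_mult_basis column_def)
  have AA: "A ** transpose A = mat 1" using A by (simp add: orthogonal_matrix_def)
  have AA': "(\<Sum>l\<in>UNIV. A $ i $ l * A $ j $ l) = (if i = j then 1 else 0)" for i j
    using arg_cong[OF AA, of "\<lambda>M. M $ i $ j"] by (simp add: matrix_matrix_mult_def transpose_def mat_def)
  have AD: "(A ** D) $ i $ l = A $ i $ l * (if l = k then a else b)" for i l
  proof -
    have "(A ** D) $ i $ l = (\<Sum>m\<in>UNIV. if m = l then A $ i $ l * (if l = k then a else b) else 0)"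
      unfolding matrix_matrix_mult_def by (simp only: vec_lambda_beta D_def) (intro sum.cong, auto)
    then show ?thesis by simp
  qed
  have "radial_gradient a b u = A ** D ** transpose A"
  proof -
    have "radial_gradient a b u $ i $ j = (A ** D ** transpose A) $ i $ j" for i j
    proof -
      have "(A ** D ** transpose A) $ i $ j = (\<Sum>l\<in>UNIV. A $ i $ l * (if l = k then a else b) * A $ j $ l)"
        unfolding matrix_matrix_mult_def[of "A ** D"] AD by (simp add: transpose_def)
      also have "\<dots> = (\<Sum>l\<in>UNIV. b * (A $ i $ l * A $ j $ l) + (if l = k then (a - b) * A $ i $ l * A $ j $ l else 0))"
        by (intro sum.cong) (auto simp: algebra_simps)
      also have "\<dots> = b * (if i = j then 1 else 0) + (a - b) * A $ i $ k * A $ j $ k"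
        unfolding sum.distrib sum_distrib_left[symmetric] AA' by simp
      finally show ?thesis by (simp add: radial_gradient_def uk)
    qed
    then show ?thesis by (simp add: vec_eq_iff)
  qed
  then have "det (radial_gradient a b u) = det A * det (transpose A) * det D" by (simp add: det_mul)
  also have "det A * det (transpose A) = 1" using AA by (metis det_I det_mul)
  also have "det D = (\<Prod>i\<in>UNIV. if i = k then a else b)"
    by (subst det_diagonal) (auto simp: D_def)
  also have "\<dots> = a * b ^ (CARD('n) - 1)"
    by (subst prod.remove[of _ k]) (auto simp: card_Diff_singleton)
  finally show ?thesis by simp
qed

lemma poly_det: "poly (det A) x = det (\<chi> i j. poly (A $ i $ j) (x::real))"
  by (simp add: det_def poly_sum poly_prod of_int_poly poly_mult)

lemma repeat_mset_single: "repeat_mset n {#x#} = replicate_mset n x"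
  by (induction n) auto

lemma eigenvalues_radial_gradient:
  fixes u :: "real^'n"
  assumes u: "norm u = 1"
  shows "eigenvalues (radial_gradient a b u) = add_mset a (replicate_mset (CARD('n) - 1) b)"
proof -
  have "charpoly (radial_gradient a b u) = [:-a, 1:] * [:-b, 1:] ^ (CARD('n) - 1)"
  proof (rule poly_ext)
    fix x
    \<comment> \<open>x I - F is again a radial gradient with the same u. Real polynomials that
      agree at every real x are equal, so its determinant gives the characteristic
      polynomial.\<close>
    have "(\<chi> i j. poly (((\<chi> i j. (if i = j then [:0, 1:] else 0) - [:radial_gradient a b u $ i $ j:]) :: real poly^'n^'n) $ i $ j) x)
        = radial_gradient (x - a) (x - b) u"
      by (auto simp: radial_gradient_def vec_eq_iff algebra_simps)
    then have "poly (charpoly (radial_gradient a b u)) x = (x - a) * (x - b) ^ (CARD('n) - 1)"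
      unfolding charpoly_def poly_det by (simp only: det_radial_gradient[OF u])
    then show "poly (charpoly (radial_gradient a b u)) x = poly ([:-a, 1:] * [:-b, 1:] ^ (CARD('n) - 1)) x"
      by (simp only: poly_mult poly_power) simp
  qed
  then show ?thesis
    unfolding eigenvalues_def
    by (simp add: proots_mult proots_power repeat_mset_single del: mult_pCons_left)
qed

lemma stored_energy_radial_gradient:
  fixes u :: "real^'n"
  assumes "norm u = 1" "0 < a" "0 < b"
  shows "stored_energy h (radial_gradient a b u)
    = 1/2 * (a\<^sup>2 + (real CARD('n) - 1) * b\<^sup>2) + h (a * b ^ (CARD('n) - 1))"
  unfolding stored_energy_def Let_def matrix_sqrt_radial_gradient[OF assms]
    eigenvalues_radial_gradient[OF assms(1)]
  by (simp add: of_nat_diff)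

section \<open>Integration in polar coordinates\<close>

lemma measure_norm_atMost:
  fixes a :: real
  shows "emeasure (distr lborel borel (norm :: real^'n \<Rightarrow> real)) {..a}
    = ennreal (if a < 0 then 0 else unit_ball_vol (real CARD('n)) * a ^ CARD('n))"
proof -
  have "emeasure (distr lborel borel (norm :: real^'n \<Rightarrow> real)) {..a} = emeasure lborel (cball (0::real^'n) a)"
    by (subst emeasure_distr) (auto intro!: arg_cong[of _ _ "emeasure lborel"])
  also have "\<dots> = ennreal (if a < 0 then 0 else unit_ball_vol (real CARD('n)) * a ^ CARD('n))"
  proof (cases "a < 0")
    case False
    then show ?thesis
      by (simp add: emeasure_cball)
  qed simp
  finally show ?thesis .
qed

text \<open>Polar coordinates for radial integrands without a measure on the sphere: the law of the
  norm is determined by its values V a^d on half lines, that is by the volumes of balls, and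
  differentiating them gives the density.\<close>

lemma distr_norm_lborel:
  "distr lborel borel (norm :: real^'n \<Rightarrow> real) =
    density lborel (\<lambda>R. ennreal (indicator {0..} R *
      (real CARD('n) * unit_ball_vol (real CARD('n)) * R ^ (CARD('n) - 1))))"
  (is "?M = ?N")
proof (rule measure_eqI_generator_eq[where \<Omega> = UNIV and E = "range atMost" and A = "\<lambda>i. {..real i}"])
  let ?V = "unit_ball_vol (real CARD('n))"
  show "Int_stable (range atMost :: real set set)"
    by (auto simp: Int_stable_def intro!: image_eqI[of _ _ "min _ _"])
  show "sets ?M = sigma_sets UNIV (range atMost)" "sets ?N = sigma_sets UNIV (range atMost)"
    by (simp_all add: borel_eq_atMost)
  show "(\<Union>i. {..real i}) = UNIV" by (auto intro: real_arch_simple)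
  show "emeasure ?M {..real i} \<noteq> \<infinity>" for i by (simp add: measure_norm_atMost)
  fix X assume "X \<in> range (atMost :: real \<Rightarrow> _)"
  then obtain a where X: "X = {..a}" by auto
  have "emeasure ?N {..a} = (\<integral>\<^sup>+R. ennreal (indicator {0..} R *
      (real CARD('n) * ?V * R ^ (CARD('n) - 1))) * indicator {..a} R \<partial>lborel)"
    by (subst emeasure_density) auto
  also have "\<dots> = (\<integral>\<^sup>+R. ennreal (real CARD('n) * ?V * R ^ (CARD('n) - 1)) * indicator {0..a} R \<partial>lborel)"
    by (intro nn_integral_cong) (auto simp: indicator_def)
  also have "\<dots> = ennreal (if a < 0 then 0 else ?V * a ^ CARD('n))"
  proof (cases "a < 0")
    case False
    have "(\<integral>\<^sup>+R. ennreal (real CARD('n) * ?V * R ^ (CARD('n) - 1)) * indicator {0..a} R \<partial>lborel)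
        = ennreal (?V * a ^ CARD('n) - ?V * 0 ^ CARD('n))"
    proof (rule nn_integral_FTC_Icc)
      fix x assume "x \<in> {0..a}"
      show "((\<lambda>R. ?V * R ^ CARD('n)) has_real_derivative real CARD('n) * ?V * x ^ (CARD('n) - 1)) (at x)"
        by (auto intro!: derivative_eq_intros)
    qed (use False in auto)
    with False show ?thesis by simp
  qed simp
  finally show "emeasure ?M X = emeasure ?N X" by (simp add: X measure_norm_atMost)
qed auto

context
  fixes f :: "real \<Rightarrow> real" and b :: real
  assumes f: "set_borel_measurable borel {0<..<b} f"
begin

lemma radial_integrable:
  assumes "set_integrable lborel {0<..<b} (\<lambda>R. R ^ (CARD('n) - 1) * f R)"
  shows "set_integrable lborel (ball 0 b - {0}) (\<lambda>x :: real^'n. f (norm x))"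
proof -
  have [measurable]: "(\<lambda>x. indicator {0<..<b} x * f x) \<in> borel_measurable borel"
    using f by (simp add: set_borel_measurable_def)
  have "integrable (distr lborel borel (norm :: real^'n \<Rightarrow> real)) (\<lambda>R. indicator {0<..<b} R * f R)"
    unfolding distr_norm_lborel
  proof (subst integrable_real_density)
    have "integrable lborel (\<lambda>R. real CARD('n) * unit_ball_vol (real CARD('n)) *
        (indicator {0<..<b} R * (R ^ (CARD('n) - 1) * f R)))"
      using assms by (intro integrable_mult_right) (simp add: set_integrable_def)
    then show "integrable lborel (\<lambda>R. indicator {0..} R * (real CARD('n) * unit_ball_vol (real CARD('n)) *
        R ^ (CARD('n) - 1)) * (indicator {0<..<b} R * f R))"
      by (rule Bochner_Integration.integrable_cong[OF refl, THEN iffD1, rotated]) (auto simp: indicator_def)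
    show "AE R in lborel. 0 \<le> indicator {0..} R * (real CARD('n) * unit_ball_vol (real CARD('n)) * R ^ (CARD('n) - 1))"
      by (simp add: indicator_def)
  qed measurable
  then have "integrable lborel (\<lambda>x :: real^'n. indicator {0<..<b} (norm x) * f (norm x))"
    by (subst (asm) integrable_distr_eq) measurable
  then show ?thesis
    unfolding set_integrable_def
    by (rule Bochner_Integration.integrable_cong[OF refl, THEN iffD1, rotated])
       (auto simp: indicator_def)
qed

lemma radial_integral:
  "(LINT x:ball 0 b - {0}|lborel. f (norm (x :: real^'n)))
   = real CARD('n) * unit_ball_vol (real CARD('n)) * (LINT R:{0<..<b}|lborel. R ^ (CARD('n) - 1) * f R)"
proof -
  have [measurable]: "(\<lambda>x. indicator {0<..<b} x * f x) \<in> borel_measurable borel"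
    using f by (simp add: set_borel_measurable_def)
  have "(LINT x:ball 0 b - {0}|lborel. f (norm (x :: real^'n)))
     = (LINT x|lborel. indicator {0<..<b} (norm x) * f (norm (x :: real^'n)))"
    unfolding set_lebesgue_integral_def
    by (intro Bochner_Integration.integral_cong) (auto simp: indicator_def)
  also have "\<dots> = (LINT R|distr lborel borel (norm :: real^'n \<Rightarrow> real). indicator {0<..<b} R * f R)"
    by (subst integral_distr) measurable
  also have "\<dots> = (LINT R|lborel. (indicator {0..} R * (real CARD('n) * unit_ball_vol (real CARD('n)) *
        R ^ (CARD('n) - 1))) * (indicator {0<..<b} R * f R))"
    unfolding distr_norm_lborel
  proof (rule integral_real_density)
    show "AE R in lborel. 0 \<le> indicator {0..} R * (real CARD('n) * unit_ball_vol (real CARD('n)) * R ^ (CARD('n) - 1))"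
      by (simp add: indicator_def)
  qed measurable
  also have "\<dots> = (LINT R|lborel. real CARD('n) * unit_ball_vol (real CARD('n)) *
      (indicator {0<..<b} R * (R ^ (CARD('n) - 1) * f R)))"
    by (rule Bochner_Integration.integral_cong) (auto simp: indicator_def)
  finally show ?thesis by (simp add: set_lebesgue_integral_def)
qed

end

text \<open>For e < 1 the closed e-neighborhood of the sphere is the shell between the radii 1 - e
  and 1 + e, so the quotient is the symmetric difference quotient of V \<rho>^d at \<rho> =
  1.\<close>

lemma surface_area_unit_sphere:
  "surface_area (sphere (0::real^'n) 1) = real CARD('n) * unit_ball_vol (real CARD('n))"
proof -
  let ?V = "unit_ball_vol (real CARD('n))" and ?d = "CARD('n)"
  have inf: "infdist x (sphere 0 1) = \<bar>norm x - 1\<bar>" for x :: "real^'n"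
  proof (rule antisym)
    obtain u :: "real^'n" where u: "norm u = 1" "x = norm x *\<^sub>R u"
    proof (cases "x = 0")
      case True
      then show ?thesis using that[of "axis undefined 1"] by (simp add: norm_axis_1)
    next
      case False
      then show ?thesis using that[of "x /\<^sub>R norm x"] by simp
    qed
    have "infdist x (sphere 0 1) \<le> dist x u" by (rule infdist_le) (simp add: u)
    also have "dist x u = norm ((norm x - 1) *\<^sub>R u)"
      by (subst u(2)) (simp add: dist_norm algebra_simps)
    finally show "infdist x (sphere 0 1) \<le> \<bar>norm x - 1\<bar>" using u by simp
    show "\<bar>norm x - 1\<bar> \<le> infdist x (sphere 0 1)"
      unfolding infdist_def using u(1)
      by (auto intro!: cINF_greatest simp: dist_norm norm_triangle_ineq3 exI[of _ u])
        (metis norm_triangle_ineq3)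
  qed
  have "measure lebesgue {x. infdist x (sphere (0::real^'n) 1) \<le> e} = ?V * ((1 + e) ^ ?d - (1 - e) ^ ?d)"
    if e: "0 < e" "e < 1" for e
  proof -
    have "{x. infdist x (sphere (0::real^'n) 1) \<le> e} = cball 0 (1 + e) - ball 0 (1 - e)"
      by (auto simp: inf)
    moreover have "measure lebesgue (cball (0::real^'n) (1 + e) - ball 0 (1 - e))
        = measure lebesgue (cball (0::real^'n) (1 + e)) - measure lebesgue (ball (0::real^'n) (1 - e))"
      by (rule measurable_measure_Diff) (use e in auto)
    ultimately show ?thesis
      using e content_ball[of "1 - e" "0::real^'n"] content_ball[of "1 + e" "0::real^'n"]
      by (simp add: content_cball_conv_ball algebra_simps)
  qed
  then have ev: "\<forall>\<^sub>F e in at_right 0. ?V * (1/2 * (((1 + e) ^ ?d - (1 - e) ^ ?d) / e)) =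
      measure lebesgue {x. infdist x (sphere (0::real^'n) 1) \<le> e} / (2 * e)"
    unfolding eventually_at_right_field by (intro exI[of _ 1]) auto
  have "((\<lambda>e::real. (1 + e) ^ ?d - (1 - e) ^ ?d) has_real_derivative 2 * real ?d) (at 0)"
    by (auto intro!: derivative_eq_intros)
  then have "((\<lambda>e::real. ((1 + e) ^ ?d - (1 - e) ^ ?d) / e) \<longlongrightarrow> 2 * real ?d) (at 0)"
    by (simp add: DERIV_def)
  then have "((\<lambda>e::real. ((1 + e) ^ ?d - (1 - e) ^ ?d) / e) \<longlongrightarrow> 2 * real ?d) (at_right 0)"
    by (rule filterlim_mono) (auto simp: at_le)
  then have "((\<lambda>e::real. ?V * (1/2 * (((1 + e) ^ ?d - (1 - e) ^ ?d) / e))) \<longlongrightarrow> ?V * (1/2 * (2 * real ?d))) (at_right 0)"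
    by (intro tendsto_intros)
  then have "((\<lambda>e. measure lebesgue {x. infdist x (sphere (0::real^'n) 1) \<le> e} / (2 * e)) \<longlongrightarrow> real ?d * ?V) (at_right 0)"
    using Lim_transform_eventually[OF _ ev] by (simp add: mult.commute)
  then show ?thesis unfolding surface_area_def by (intro tendsto_Lim) auto
qed

section \<open>Smoothing of an odd extension\<close>

text \<open>Folding the line onto the half line: integration against this kernel is convolution of
  \<psi> with the odd extension of a function, and \<open>even_kernel\<close> does the same for the
  even extension. Differentiation in S exchanges the two types.\<close>

definition odd_kernel :: "(real \<Rightarrow> real) \<Rightarrow> real \<Rightarrow> real \<Rightarrow> real" where
  "odd_kernel \<psi> R S = \<psi> (R - S) - \<psi> (R + S)"

definition even_kernel :: "(real \<Rightarrow> real) \<Rightarrow> real \<Rightarrow> real \<Rightarrow> real" where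
  "even_kernel \<psi> R S = \<psi> (R - S) + \<psi> (R + S)"

text \<open>The finite set X admits the shock, where f is only continuous. The boundary term at 0 is
  kept, since for the cavity it is the jump contribution.\<close>

lemma integration_by_parts_zero_right:
  fixes f g :: "real \<Rightarrow> real"
  assumes "finite X" "0 \<le> M" "continuous_on {0..M} f" "g M = 0"
    and f': "\<And>S. S \<in> {0<..<M} - X \<Longrightarrow> (f has_real_derivative f' S) (at S)"
    and g': "\<And>S. (g has_real_derivative g' S) (at S)" "continuous_on {0..M} g'"
  shows "((\<lambda>S. g S * f' S) has_integral (- g 0 * f 0 - integral {0..M} (\<lambda>S. g' S * f S))) {0..M}"
proof -
  let ?y = "- g 0 * f 0 - integral {0..M} (\<lambda>S. g' S * f S)"
  have "((\<lambda>S. f' S * g S) has_integral ?y) {0..M}"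
  proof (rule integration_by_parts_interior_strong[OF bounded_bilinear_mult, where f = f and g = g and f' = f' and g' = g' and s = X])
    show "continuous_on {0..M} g"
      using g'(1) by (rule DERIV_continuous_on[OF DERIV_subset]) auto
    have "(\<lambda>S. f S * g' S) integrable_on {0..M}"
      using assms by (intro integrable_continuous_real continuous_on_mult) auto
    then show "((\<lambda>S. f S * g' S) has_integral f M * g M - f 0 * g 0 - ?y) {0..M}"
      using \<open>g M = 0\<close> integrable_integral[of "\<lambda>S. f S * g' S"] by (simp add: mult.commute)
  qed (use assms in \<open>auto simp: has_real_derivative_iff_has_vector_derivative\<close>)
  then show ?thesis by (simp add: mult.commute)
qed

lemma DERIV_argument_shift:
  fixes f f' :: "real \<Rightarrow> real"
  assumes "\<And>x. (f has_real_derivative f' x) (at x)"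
  shows "((\<lambda>S. f (R + S)) has_real_derivative f' (R + S)) (at S)"
    and "((\<lambda>R. f (R + S)) has_real_derivative f' (R + S)) (at R)"
    and "((\<lambda>S. f (R - S)) has_real_derivative - f' (R - S)) (at S)"
    and "((\<lambda>R. f (R - S)) has_real_derivative f' (R - S)) (at R)"
proof -
  have *: "(g has_real_derivative m) (at x) \<Longrightarrow> ((\<lambda>x. f (g x)) has_real_derivative f' (g x) * m) (at x)" for g m x
    by (rule DERIV_chain2[OF assms])
  have "((\<lambda>S. R + S) has_real_derivative 1) (at S)" "((\<lambda>R. R + S) has_real_derivative 1) (at R)"
    "((\<lambda>S. R - S) has_real_derivative - 1) (at S)" "((\<lambda>R. R - S) has_real_derivative 1) (at R)"
    by (auto intro!: derivative_eq_intros)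
  from this[THEN *] show "((\<lambda>S. f (R + S)) has_real_derivative f' (R + S)) (at S)"
    "((\<lambda>R. f (R + S)) has_real_derivative f' (R + S)) (at R)"
    "((\<lambda>S. f (R - S)) has_real_derivative - f' (R - S)) (at S)"
    "((\<lambda>R. f (R - S)) has_real_derivative f' (R - S)) (at R)"
    by simp_all
qed

section \<open>Mass and averaging properties of an even kernel supported in
  [-\<delta>, \<delta>]\<close>

locale smoothing_kernel =
  fixes \<psi> \<psi>' :: "real \<Rightarrow> real" and \<delta> :: real
  assumes deriv: "\<And>x. (\<psi> has_real_derivative \<psi>' x) (at x)"
    and continuous_deriv: "continuous_on UNIV \<psi>'"
    and even: "\<And>x. \<psi> (- x) = \<psi> x"
    and nonneg: "\<And>x. 0 \<le> \<psi> x"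
    and support: "\<And>x. \<delta> < \<bar>x\<bar> \<Longrightarrow> \<psi> x = 0"
    and \<delta>_pos: "0 < \<delta>"
    and integral_one: "(\<psi> has_integral 1) UNIV"
begin

lemma continuous: "continuous_on A \<psi>"
  using deriv by (auto intro: DERIV_continuous_on DERIV_subset)

text \<open>A primitive rising from 0 to 1 reduces all masses of the folded kernels to endpoint
  evaluations. Evenness makes \<Psi>(x) + \<Psi>(-x) constant, hence equal to 1, which gives the
  value at 0.\<close>

lemma antiderivative:
  obtains \<Psi> where "\<And>x. (\<Psi> has_real_derivative \<psi> x) (at x)"
    and "\<And>x. x < - \<delta> \<Longrightarrow> \<Psi> x = 0" and "\<And>x. \<delta> < x \<Longrightarrow> \<Psi> x = 1" and "\<Psi> 0 = 1/2"
proof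
  \<comment> \<open>Starting one unit to the left of the support makes every x \<ge> - \<delta> an
    interior point, so the derivative there is two-sided.\<close>
  define \<Psi> where "\<Psi> = (\<lambda>x. integral {- \<delta> - 1..x} \<psi>)"
  show left: "\<Psi> x = 0" if "x < - \<delta>" for x
    using that support unfolding \<Psi>_def by (intro integral_unique has_integral_is_0) auto
  show right: "\<Psi> x = 1" if "\<delta> < x" for x
  proof -
    have "(\<lambda>y. if y \<in> {- \<delta> - 1..x} then \<psi> y else 0) = \<psi>"
      using that support \<delta>_pos by (auto simp: fun_eq_iff)
    then have "(\<psi> has_integral 1) {- \<delta> - 1..x}"
      using integral_one has_integral_restrict_UNIV[of "{- \<delta> - 1..x}" \<psi> 1] by simp
    then show ?thesis unfolding \<Psi>_def by (rule integral_unique)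
  qed
  show d: "(\<Psi> has_real_derivative \<psi> x) (at x)" for x
  proof (cases "x < - \<delta>")
    case True
    have "((\<lambda>_. 0) has_real_derivative \<psi> x) (at x)" using support[of x] True \<delta>_pos by simp
    then show ?thesis
      by (rule has_field_derivative_transform_within_open[of _ _ _ "{..< - \<delta>}"]) (use left True in auto)
  next
    case False
    have "(\<Psi> has_real_derivative \<psi> x) (at x within {- \<delta> - 1..x + 1})"
      unfolding \<Psi>_def by (rule integral_has_real_derivative) (use False in \<open>auto intro: continuous\<close>)
    then show ?thesis using False by (simp add: at_within_Icc_at)
  qed
  have "((\<lambda>x. \<Psi> x + \<Psi> (- x)) has_real_derivative 0) (at x)" for x
    by (rule DERIV_cong, rule DERIV_add[OF d DERIV_argument_shift(3)[OF d, of 0, simplified]]) (simp add: even)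
  then have "\<Psi> 0 + \<Psi> (- 0) = \<Psi> (\<delta> + 1) + \<Psi> (- (\<delta> + 1))"
    using DERIV_isconst_all[of "\<lambda>x. \<Psi> x + \<Psi> (- x)"] by blast
  then show "\<Psi> 0 = 1/2" using left[of "- (\<delta> + 1)"] right[of "\<delta> + 1"] \<delta>_pos by simp
qed

text \<open>The mass of \<psi>(R - S) that falls on S < 0 returns through the reflected term, and R
  + \<delta> < M prevents a loss at the other end.\<close>

lemma even_kernel_integral:
  assumes "0 \<le> R" "R + \<delta> < M"
  shows "(even_kernel \<psi> R has_integral 1) {0..M}"
proof -
  obtain \<Psi> where \<Psi>: "\<And>x. (\<Psi> has_real_derivative \<psi> x) (at x)"
    "\<And>x. x < - \<delta> \<Longrightarrow> \<Psi> x = 0" "\<And>x. \<delta> < x \<Longrightarrow> \<Psi> x = 1" "\<Psi> 0 = 1/2"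
    using antiderivative by blast
  have "(even_kernel \<psi> R has_integral ((\<Psi> (R + M) - \<Psi> (R - M)) - (\<Psi> (R + 0) - \<Psi> (R - 0)))) {0..M}"
  proof (rule fundamental_theorem_of_calculus)
    show "((\<lambda>S. \<Psi> (R + S) - \<Psi> (R - S)) has_vector_derivative even_kernel \<psi> R x) (at x within {0..M})" for x
      unfolding even_kernel_def has_real_derivative_iff_has_vector_derivative[symmetric]
      by (rule has_field_derivative_at_within, rule DERIV_cong,
          (rule DERIV_diff DERIV_argument_shift[OF \<Psi>(1)])+) simp
  qed (use assms \<delta>_pos in auto)
  then show ?thesis using \<Psi>(2)[of "R - M"] \<Psi>(3)[of "R + M"] assms \<delta>_pos by simp
qed

lemma kernel_integral:
  assumes "R + \<delta> < M"
  shows "((\<lambda>S. \<psi> (R - S)) has_integral 1/2) {R..M}"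
    and "\<delta> < R \<Longrightarrow> ((\<lambda>S. \<psi> (R - S)) has_integral 1) {0..M}"
proof -
  obtain \<Psi> where \<Psi>: "\<And>x. (\<Psi> has_real_derivative \<psi> x) (at x)"
    "\<And>x. x < - \<delta> \<Longrightarrow> \<Psi> x = 0" "\<And>x. \<delta> < x \<Longrightarrow> \<Psi> x = 1" "\<Psi> 0 = 1/2"
    using antiderivative by blast
  have *: "((\<lambda>S. \<psi> (R - S)) has_integral (- \<Psi> (R - M) - (- \<Psi> (R - c)))) {c..M}" if "c \<le> M" for c
  proof (rule fundamental_theorem_of_calculus[OF that])
    show "((\<lambda>S. - \<Psi> (R - S)) has_vector_derivative \<psi> (R - x)) (at x within {c..M})" for x
      unfolding has_real_derivative_iff_has_vector_derivative[symmetric]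
      by (rule has_field_derivative_at_within, rule DERIV_cong,
          (rule DERIV_minus DERIV_argument_shift[OF \<Psi>(1)])+) simp
  qed
  from *[of R] show "((\<lambda>S. \<psi> (R - S)) has_integral 1/2) {R..M}"
    using \<Psi>(2)[of "R - M"] \<Psi>(4) assms \<delta>_pos by simp
  from *[of 0] show "((\<lambda>S. \<psi> (R - S)) has_integral 1) {0..M}" if "\<delta> < R"
    using \<Psi>(2)[of "R - M"] \<Psi>(3)[of R] assms \<delta>_pos that by simp
qed

lemma kernel_vanishes_right: "\<delta> < R + S \<Longrightarrow> \<psi> (R + S) = 0"
  using support[of "R + S"] by simp

lemma odd_kernel_away:
  assumes "\<delta> < R" "0 \<le> S"
  shows "odd_kernel \<psi> R S = \<psi> (R - S)" "even_kernel \<psi> R S = \<psi> (R - S)"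
  using kernel_vanishes_right[of R S] assms by (simp_all add: odd_kernel_def even_kernel_def)

lemma kernel_at_ends:
  assumes "0 \<le> R" "R + \<delta> < M"
  shows "odd_kernel \<psi> R 0 = 0" "even_kernel \<psi> R 0 = 2 * \<psi> R"
    "odd_kernel \<psi> R M = 0" "even_kernel \<psi> R M = 0"
  using support[of "R - M"] support[of "R + M"] assms \<delta>_pos
  by (simp_all add: odd_kernel_def even_kernel_def)

lemma abs_odd_kernel_le: "\<bar>odd_kernel \<psi> R S\<bar> \<le> even_kernel \<psi> R S"
  using nonneg[of "R - S"] nonneg[of "R + S"] by (simp add: odd_kernel_def even_kernel_def)

lemma even_kernel_nonneg: "0 \<le> even_kernel \<psi> R S"
  using nonneg by (simp add: even_kernel_def)

lemma kernel_derivs: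
  "((\<lambda>R. odd_kernel \<psi> R S) has_real_derivative odd_kernel \<psi>' R S) (at R)"
  "((\<lambda>S. odd_kernel \<psi> R S) has_real_derivative - even_kernel \<psi>' R S) (at S)"
  "((\<lambda>S. even_kernel \<psi> R S) has_real_derivative - odd_kernel \<psi>' R S) (at S)"
  unfolding odd_kernel_def even_kernel_def
  by (rule DERIV_cong, (rule DERIV_diff DERIV_add DERIV_argument_shift[OF deriv])+, simp)+

lemma kernel_continuous [continuous_intros]:
  assumes "continuous_on A f" "continuous_on A g"
  shows "continuous_on A (\<lambda>x. odd_kernel \<psi> (f x) (g x))" "continuous_on A (\<lambda>x. even_kernel \<psi> (f x) (g x))"
    "continuous_on A (\<lambda>x. odd_kernel \<psi>' (f x) (g x))" "continuous_on A (\<lambda>x. even_kernel \<psi>' (f x) (g x))"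
  unfolding odd_kernel_def even_kernel_def
  by (intro continuous_intros continuous_on_compose2[OF continuous[of UNIV]]
      continuous_on_compose2[OF continuous_deriv] assms; simp)+

text \<open>As \<psi> need not be monotone on the half line, the odd kernel may change sign; it is
  dominated by the even one, which has mass one.\<close>

lemma odd_average_bound:
  assumes R: "0 \<le> R" "R + \<delta> < M"
    and f: "((\<lambda>S. odd_kernel \<psi> R S * f S) has_integral I) {0..M}"
    and C: "\<And>S. S \<in> {0..M} \<Longrightarrow> \<bar>f S\<bar> \<le> C"
  shows "\<bar>I\<bar> \<le> C"
proof -
  have up: "((\<lambda>S. even_kernel \<psi> R S * C) has_integral 1 * C) {0..M}"
    by (intro has_integral_mult_left even_kernel_integral R)
  have le: "\<bar>odd_kernel \<psi> R S * f S\<bar> \<le> even_kernel \<psi> R S * C" if "S \<in> {0..M}" for S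
    unfolding abs_mult by (intro mult_mono abs_odd_kernel_le C that even_kernel_nonneg) auto
  have "I \<le> 1 * C" by (rule has_integral_le[OF f up]) (use le in \<open>fastforce simp: abs_le_iff\<close>)
  moreover have "- I \<le> 1 * C"
    by (rule has_integral_le[OF has_integral_neg[OF f] up]) (use le in \<open>fastforce simp: abs_le_iff\<close>)
  ultimately show ?thesis by linarith
qed

lemma even_average_le:
  assumes R: "0 \<le> R" "R + \<delta> < M"
    and f: "((\<lambda>S. even_kernel \<psi> R S * f S) has_integral I) {0..M}"
    and C: "\<And>S. S \<in> {0..M} \<Longrightarrow> f S \<le> C"
  shows "I \<le> C"
proof -
  have "((\<lambda>S. even_kernel \<psi> R S * C) has_integral 1 * C) {0..M}"
    by (intro has_integral_mult_left even_kernel_integral R)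
  from has_integral_le[OF f this] show ?thesis using C even_kernel_nonneg by (simp add: mult_left_mono)
qed

text \<open>Beyond \<delta> the reflected term is zero on S \<ge> 0, so both kernels equal \<psi>(R
  - S), a probability density that sees only the S within \<delta> of R.\<close>

lemma local_average_bounds:
  assumes R: "\<delta> < R" "R + \<delta> < M"
    and f: "((\<lambda>S. k R S * f S) has_integral I) {0..M}"
    and k: "k = odd_kernel \<psi> \<or> k = even_kernel \<psi>"
    and C: "\<And>S. S \<in> {0..M} \<Longrightarrow> \<bar>R - S\<bar> \<le> \<delta> \<Longrightarrow> c \<le> f S \<and> f S \<le> C"
  shows "c \<le> I" "I \<le> C"
proof -
  have k: "k R S = \<psi> (R - S)" if "S \<in> {0..M}" for S using k odd_kernel_away R(1) that by auto
  have const: "((\<lambda>S. \<psi> (R - S) * x) has_integral 1 * x) {0..M}" for x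
    by (intro has_integral_mult_left kernel_integral(2) R)
  have 1: "\<psi> (R - S) * c \<le> k R S * f S" "k R S * f S \<le> \<psi> (R - S) * C" if "S \<in> {0..M}" for S
    using C[OF that] nonneg[of "R - S"] support[of "R - S"] k[OF that]
    by (cases "\<bar>R - S\<bar> \<le> \<delta>"; simp add: mult_left_mono)+
  from has_integral_le[OF const[of c] f 1(1)] has_integral_le[OF f const[of C] 1(2)]
  show "c \<le> I" "I \<le> C" by auto
qed

text \<open>By evenness half of the mass of the kernel lies to the right of \<open>R\<close>.\<close>

lemma even_average_ge_half:
  assumes R: "0 \<le> R" "R + \<delta> < M"
    and f: "((\<lambda>S. even_kernel \<psi> R S * f S) has_integral I) {0..M}"
    and C: "\<And>S. S \<in> {0..M} \<Longrightarrow> 0 \<le> f S" "\<And>S. S \<in> {R..M} \<Longrightarrow> c \<le> f S"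
  shows "c / 2 \<le> I"
proof -
  have "((\<lambda>S. \<psi> (R - S) * c) has_integral 1/2 * c) {R..M}"
    by (intro has_integral_mult_left kernel_integral(1) R)
  then have "((\<lambda>S. if S \<in> {R..M} then \<psi> (R - S) * c else 0) has_integral 1/2 * c) {0..M}"
    using R by (subst has_integral_restrict) auto
  then have "1/2 * c \<le> I"
  proof (rule has_integral_le[OF _ f])
    fix S assume S: "S \<in> {0..M}"
    show "(if S \<in> {R..M} then \<psi> (R - S) * c else 0) \<le> even_kernel \<psi> R S * f S"
    proof (cases "S \<in> {R..M}")
      case True
      have "\<psi> (R - S) * c \<le> \<psi> (R - S) * f S" using C(2)[OF True] nonneg by (rule mult_left_mono)
      also have "\<dots> \<le> even_kernel \<psi> R S * f S"
        using C(1)[OF S] nonneg by (intro mult_right_mono) (auto simp: even_kernel_def)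
      finally show ?thesis using True by simp
    qed (use C(1)[OF S] even_kernel_nonneg in auto)
  qed
  then show ?thesis by simp
qed

end

text \<open>Cut off at M to work on a compact interval; nothing is lost as long as R + \<delta> < M.
  With \<psi>' in place of \<psi> it is the derivative of the average in R.\<close>

definition smoothed :: "(real \<Rightarrow> real) \<Rightarrow> real \<Rightarrow> (real \<Rightarrow> real) \<Rightarrow> real \<Rightarrow> real" where
  "smoothed \<psi> M W R = integral {0..M} (\<lambda>S. odd_kernel \<psi> R S * W S)"

text \<open>
  For \<open>w(R,t) = t r(R/t)\<close> one has \<open>t w\<^sub>t = w - R w\<^sub>R\<close>; this is the average of \<open>W - S W'\<close> after
  integration by parts.
\<close>

definition smoothed_rate ::
    "(real \<Rightarrow> real) \<Rightarrow> (real \<Rightarrow> real) \<Rightarrow> real \<Rightarrow> (real \<Rightarrow> real) \<Rightarrow> real \<Rightarrow> real" where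
  "smoothed_rate \<psi> \<psi>' M W R =
     2 * smoothed \<psi> M W R - integral {0..M} (\<lambda>S. even_kernel \<psi>' R S * (S * W S))"

context smoothing_kernel
begin

lemma deriv_smoothed_of_continuous:
  assumes W: "continuous_on {0..M} W"
  shows "(smoothed \<psi> M W has_real_derivative smoothed \<psi>' M W R) (at R)"
proof -
  have "((\<lambda>R. integral (cbox 0 M) (\<lambda>S. odd_kernel \<psi> R S * W S))
      has_real_derivative integral (cbox 0 M) (\<lambda>S. odd_kernel \<psi>' R S * W S)) (at R within UNIV)"
  proof (rule leibniz_rule_field_derivative)
    show "continuous_on (UNIV \<times> cbox 0 M) (\<lambda>(R, S). odd_kernel \<psi>' R S * W S)"
      unfolding split_beta
      by (intro continuous_intros continuous_on_compose2[OF W]) auto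
    show "(\<lambda>S. odd_kernel \<psi> R S * W S) integrable_on cbox 0 M" for R
      unfolding box_real by (intro integrable_continuous_real continuous_intros W)
    show "((\<lambda>R. odd_kernel \<psi> R S * W S) has_real_derivative odd_kernel \<psi>' R S * W S) (at R within UNIV)" for R S
      using DERIV_cmult_right[OF kernel_derivs(1)] by simp
  qed auto
  then show ?thesis by (simp add: smoothed_def[abs_def])
qed

text \<open>The derivative is moved from the kernel to W. The even kernel is 0 at S = M but
  \<open>2 * \<psi> R\<close> at S = 0, so the jump 2 W(0) of the odd extension appears mollified
  beside the average of the classical slope.\<close>

lemma slope_has_integral_of_continuous:
  assumes R: "0 \<le> R" "R + \<delta> < M" and W: "continuous_on {0..M} W" and X: "finite X"
    and W': "\<And>S. S \<in> {0<..<M} - X \<Longrightarrow> (W has_real_derivative D S) (at S)"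
  shows "((\<lambda>S. even_kernel \<psi> R S * D S) has_integral (smoothed \<psi>' M W R - 2 * \<psi> R * W 0)) {0..M}"
proof -
  have "((\<lambda>S. even_kernel \<psi> R S * D S) has_integral
      - even_kernel \<psi> R 0 * W 0 - integral {0..M} (\<lambda>S. - odd_kernel \<psi>' R S * W S)) {0..M}"
  proof (rule integration_by_parts_zero_right[OF X])
    show "continuous_on {0..M} (\<lambda>S. - odd_kernel \<psi>' R S)" by (intro continuous_intros)
  qed (use R \<delta>_pos W W' kernel_derivs(3) kernel_at_ends[OF R] in auto)
  then show ?thesis by (simp add: kernel_at_ends[OF R] smoothed_def)
qed

text \<open>A linear function has no jump at 0, so its average has slope c throughout, and the
  average vanishes at 0. This is why averaging does not change the homogeneous deformation.\<close>

lemma smoothed_linear: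
  assumes R: "0 \<le> R" "R + \<delta> < M"
  shows "smoothed \<psi> M (\<lambda>S. c * S) R = c * R"
proof -
  let ?W = "\<lambda>S. c * S"
  have W: "continuous_on {0..M} ?W" by (intro continuous_intros)
  have "smoothed \<psi>' M ?W x = c" if x: "0 \<le> x" "x \<le> R" for x
  proof -
    have xR: "x + \<delta> < M" using x R by simp
    have "((\<lambda>S. even_kernel \<psi> x S * c) has_integral (smoothed \<psi>' M ?W x - 2 * \<psi> x * (c * 0))) {0..M}"
      by (rule slope_has_integral_of_continuous[OF x(1) xR W, of "{}"]) (auto intro!: derivative_eq_intros)
    moreover have "((\<lambda>S. even_kernel \<psi> x S * c) has_integral 1 * c) {0..M}"
      by (intro has_integral_mult_left even_kernel_integral x(1) xR)
    ultimately have "smoothed \<psi>' M ?W x - 2 * \<psi> x * (c * 0) = 1 * c" by (rule has_integral_unique)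
    then show ?thesis by simp
  qed
  then have "((\<lambda>R. smoothed \<psi> M ?W R - c * R) has_real_derivative 0) (at x)" if "0 \<le> x" "x \<le> R" for x
    using that DERIV_diff[OF deriv_smoothed_of_continuous[OF W, of x] DERIV_cmult[OF DERIV_ident, of c]] by simp
  then have "\<exists>k. \<forall>x\<in>{0..R}. smoothed \<psi> M ?W x - c * x = k"
    by (intro has_field_derivative_zero_constant) (auto intro: has_field_derivative_at_within)
  then have "smoothed \<psi> M ?W R - c * R = smoothed \<psi> M ?W 0 - c * 0"
    using R(1) by (metis atLeastAtMost_iff order_refl)
  then show ?thesis by (simp add: smoothed_def odd_kernel_def even)
qed

end

text \<open>The abstract cavity: W is the profile at a fixed time, D its slope and \<open>a\<close>
  the shock radius. With W between positive constants, the bounds of D by multiples of S^m say that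
  the volume ratio D (W/S)^m stays between positive constants, although W/S is unbounded at the
  origin.\<close>

locale profile =
  fixes W D :: "real \<Rightarrow> real" and a M cl cu wl wu dmax :: real and m :: nat
  assumes continuous_W: "continuous_on {0..M} W"
    and deriv_W: "\<And>S. 0 < S \<Longrightarrow> S < M \<Longrightarrow> S \<noteq> a \<Longrightarrow> (W has_real_derivative D S) (at S)"
    and isCont_D: "\<And>S. 0 < S \<Longrightarrow> S < M \<Longrightarrow> S \<noteq> a \<Longrightarrow> isCont D S"
    and W_bounds: "\<And>S. S \<in> {0..M} \<Longrightarrow> wl \<le> W S \<and> W S \<le> wu"
    and D_bounds: "\<And>S. S \<in> {0..M} \<Longrightarrow> cl * S ^ m \<le> D S \<and> D S \<le> cu * S ^ m \<and> D S \<le> dmax"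
    and constants_pos: "0 < wl" "0 < cl" "0 \<le> cu" "0 \<le> dmax" "0 < M"
begin

lemma wu_pos: "0 < wu"
  using W_bounds[of 0] constants_pos by auto

lemma D_nonneg: "S \<in> {0..M} \<Longrightarrow> 0 \<le> D S"
  using D_bounds[of S] constants_pos by (meson atLeastAtMost_iff less_imp_le mult_nonneg_nonneg order_trans zero_le_power)

lemma isCont_W: "0 < S \<Longrightarrow> S < M \<Longrightarrow> isCont W S"
  using continuous_W by (auto simp: continuous_on_eq_continuous_at[OF open_greaterThanLessThan, symmetric, of 0 M]
      intro: continuous_on_interior)

end

section \<open>Bounds for the averages of a cavity profile\<close>

locale smoothed_profile = smoothing_kernel \<psi> \<psi>' \<delta> + profile W D a M cl cu wl wu dmax m
  for \<psi> \<psi>' \<delta> W D a M cl cu wl wu dmax m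
begin

lemma deriv_smoothed: "(smoothed \<psi> M W has_real_derivative smoothed \<psi>' M W R) (at R)"
  by (rule deriv_smoothed_of_continuous[OF continuous_W])

lemma continuous_smoothed: "continuous_on A (smoothed \<psi> M W)"
  using deriv_smoothed by (auto intro: DERIV_continuous_on DERIV_subset)

lemma continuous_slope: "continuous_on A (smoothed \<psi>' M W)"
proof -
  have "continuous_on A (\<lambda>R. integral (cbox 0 M) (\<lambda>S. odd_kernel \<psi>' R S * W S))"
    by (rule integral_continuous_on_param, unfold split_beta)
       (intro continuous_intros continuous_on_compose2[OF continuous_W]; auto)
  then show ?thesis by (simp add: smoothed_def[abs_def])
qed

lemma continuous_rate: "continuous_on A (smoothed_rate \<psi> \<psi>' M W)"
proof -
  have "continuous_on A (\<lambda>R. integral (cbox 0 M) (\<lambda>S. even_kernel \<psi>' R S * (S * W S)))"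
    by (rule integral_continuous_on_param, unfold split_beta)
       (intro continuous_intros continuous_on_compose2[OF continuous_W]; auto)
  then show ?thesis unfolding smoothed_rate_def by (auto intro!: continuous_intros continuous_smoothed)
qed

lemma smoothed_0: "smoothed \<psi> M W 0 = 0"
  by (simp add: smoothed_def odd_kernel_def even)

lemma smoothed_has_integral: "((\<lambda>S. odd_kernel \<psi> R S * W S) has_integral smoothed \<psi> M W R) {0..M}"
  unfolding smoothed_def
  by (intro integrable_integral integrable_continuous_real continuous_intros continuous_W)

context
  fixes R assumes R: "0 \<le> R" "R + \<delta> < M"
begin

lemma slope_has_integral:
  "((\<lambda>S. even_kernel \<psi> R S * D S) has_integral (smoothed \<psi>' M W R - 2 * \<psi> R * W 0)) {0..M}"
  by (rule slope_has_integral_of_continuous[OF R continuous_W, of "{a}"]) (auto intro: deriv_W)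

text \<open>Since (S W)' = W + S D, the combination 2 W - (S W)' is W - S D. No jump term arises
  here, because the odd kernel and S W both vanish at 0.\<close>

lemma rate_has_integral:
  "((\<lambda>S. odd_kernel \<psi> R S * (W S - S * D S)) has_integral smoothed_rate \<psi> \<psi>' M W R) {0..M}"
proof -
  have "((\<lambda>S. odd_kernel \<psi> R S * (W S + S * D S)) has_integral
      - odd_kernel \<psi> R 0 * (0 * W 0) - integral {0..M} (\<lambda>S. - even_kernel \<psi>' R S * (S * W S))) {0..M}"
  proof (rule integration_by_parts_zero_right[of "{a}"])
    show "continuous_on {0..M} (\<lambda>S. - even_kernel \<psi>' R S)" by (intro continuous_intros)
    show "continuous_on {0..M} (\<lambda>S. S * W S)" by (intro continuous_intros continuous_W)
    show "((\<lambda>S. S * W S) has_real_derivative W S + S * D S) (at S)" if "S \<in> {0<..<M} - {a}" for S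
      using that deriv_W[of S] by (auto intro!: derivative_eq_intros)
  qed (use constants_pos kernel_derivs(2) kernel_at_ends[OF R] in auto)
  from has_integral_diff[OF has_integral_mult_right[OF smoothed_has_integral[of R], of 2] this]
  show ?thesis by (simp add: smoothed_rate_def algebra_simps)
qed

lemma abs_smoothed_le: "\<bar>smoothed \<psi> M W R\<bar> \<le> wu"
  by (rule odd_average_bound[OF R smoothed_has_integral]) (use W_bounds constants_pos in force)

lemma abs_rate_le: "\<bar>smoothed_rate \<psi> \<psi>' M W R\<bar> \<le> wu + M * dmax"
proof (rule odd_average_bound[OF R rate_has_integral])
  fix S assume S: "S \<in> {0..M}"
  have "0 \<le> S * D S" "S * D S \<le> M * dmax"
    using S D_nonneg[OF S] D_bounds[OF S] by (auto intro!: mult_mono)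
  then show "\<bar>W S - S * D S\<bar> \<le> wu + M * dmax"
    using W_bounds[OF S] constants_pos by auto
qed

lemma slope_le: "smoothed \<psi>' M W R \<le> 2 * \<psi> R * wu + dmax"
proof -
  have "smoothed \<psi>' M W R - 2 * \<psi> R * W 0 \<le> dmax"
    by (rule even_average_le[OF R slope_has_integral]) (use D_bounds in auto)
  moreover have "2 * \<psi> R * W 0 \<le> 2 * \<psi> R * wu"
    using W_bounds[of 0] constants_pos nonneg by (intro mult_left_mono) auto
  ultimately show ?thesis by linarith
qed

text \<open>The two summands complement each other: the jump term may be 0 away from the origin, and
  R^m degenerates at the origin. The factor 1/2 is the mass of the kernel to the right of R, where
  S^m \<ge> R^m.\<close>

lemma slope_ge: "2 * \<psi> R * wl + cl * R ^ m / 2 \<le> smoothed \<psi>' M W R"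
proof -
  have "cl * R ^ m / 2 \<le> smoothed \<psi>' M W R - 2 * \<psi> R * W 0"
  proof (rule even_average_ge_half[OF R slope_has_integral D_nonneg])
    fix S assume S: "S \<in> {R..M}"
    have "cl * R ^ m \<le> cl * S ^ m" using S R constants_pos by (intro mult_left_mono power_mono) auto
    also have "\<dots> \<le> D S" using D_bounds[of S] S R by auto
    finally show "cl * R ^ m \<le> D S" .
  qed auto
  moreover have "2 * \<psi> R * wl \<le> 2 * \<psi> R * W 0"
    using W_bounds[of 0] constants_pos nonneg by (intro mult_left_mono) auto
  ultimately show ?thesis by linarith
qed

text \<open>Beyond \<delta> the jump term is gone, and every S in the window satisfies S \<le> R +
  \<delta> \<le> 2 R, whence the factor 2.\<close>

lemma slope_le_away: "\<delta> < R \<Longrightarrow> smoothed \<psi>' M W R \<le> cu * (2 * R) ^ m"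
proof -
  assume \<delta>: "\<delta> < R"
  have "smoothed \<psi>' M W R - 2 * \<psi> R * W 0 \<le> cu * (2 * R) ^ m"
  proof (rule local_average_bounds(2)[where k = "even_kernel \<psi>" and f = D and c = 0, OF \<delta> R(2) slope_has_integral])
    fix S assume S: "S \<in> {0..M}" "\<bar>R - S\<bar> \<le> \<delta>"
    have "D S \<le> cu * S ^ m" using D_bounds[OF S(1)] by simp
    also have "\<dots> \<le> cu * (2 * R) ^ m"
      using S \<delta> constants_pos by (intro mult_left_mono power_mono) auto
    finally show "0 \<le> D S \<and> D S \<le> cu * (2 * R) ^ m" using D_nonneg[OF S(1)] by simp
  qed simp
  then show ?thesis using support[of R] \<delta> \<delta>_pos by simp
qed

end

lemma slope_nonneg:
  assumes "0 \<le> R" "R + \<delta> < M"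
  shows "0 \<le> smoothed \<psi>' M W R"
proof -
  have "0 \<le> 2 * \<psi> R * wl + cl * R ^ m / 2" using nonneg[of R] constants_pos assms by auto
  with slope_ge[OF assms] show ?thesis by linarith
qed

lemma smoothed_increment:
  assumes "0 \<le> R" "R \<le> R'" "R' + \<delta> < M"
    and "\<And>x. R \<le> x \<Longrightarrow> x \<le> R' \<Longrightarrow> k \<le> smoothed \<psi>' M W x"
  shows "k * (R' - R) \<le> smoothed \<psi> M W R' - smoothed \<psi> M W R"
proof -
  have "smoothed \<psi> M W R - k * R \<le> smoothed \<psi> M W R' - k * R'"
  proof (rule DERIV_nonneg_imp_nondecreasing[OF assms(2)])
    fix x assume x: "R \<le> x" "x \<le> R'"
    have "((\<lambda>R. smoothed \<psi> M W R - k * R) has_real_derivative smoothed \<psi>' M W x - k) (at x)"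
      by (auto intro!: derivative_eq_intros deriv_smoothed)
    then show "\<exists>y. ((\<lambda>R. smoothed \<psi> M W R - k * R) has_real_derivative y) (at x) \<and> 0 \<le> y"
      using assms(4)[OF x] by auto
  qed
  then show ?thesis by (simp add: algebra_simps)
qed

lemma smoothed_mono:
  "0 \<le> R \<Longrightarrow> R \<le> R' \<Longrightarrow> R' + \<delta> < M \<Longrightarrow> smoothed \<psi> M W R \<le> smoothed \<psi> M W R'"
  using smoothed_increment[of R R' 0] slope_nonneg by force

context
  fixes kmax kmin \<eta>
  assumes k: "\<And>x. \<psi> x \<le> kmax" "\<And>x. \<bar>x\<bar> \<le> \<eta> \<Longrightarrow> kmin \<le> \<psi> x" "0 < \<eta>" "0 < kmin"
begin

lemma slope_le_const: "0 \<le> R \<Longrightarrow> R + \<delta> < M \<Longrightarrow> smoothed \<psi>' M W R \<le> 2 * kmax * wu + dmax"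
proof -
  assume "0 \<le> R" "R + \<delta> < M"
  moreover have "2 * \<psi> R * wu \<le> 2 * kmax * wu"
    using k(1)[of R] wu_pos by (intro mult_right_mono mult_left_mono) auto
  ultimately show ?thesis using slope_le[of R] by linarith
qed

lemma smoothed_le:
  assumes "0 \<le> R" "R + \<delta> < M"
  shows "smoothed \<psi> M W R \<le> (2 * kmax * wu + dmax) * R"
proof -
  have "smoothed \<psi> M W R - (2 * kmax * wu + dmax) * R \<le> smoothed \<psi> M W 0 - (2 * kmax * wu + dmax) * 0"
  proof (rule DERIV_nonpos_imp_nonincreasing[OF assms(1)])
    fix x assume x: "0 \<le> x" "x \<le> R"
    have "((\<lambda>R. smoothed \<psi> M W R - (2 * kmax * wu + dmax) * R) has_real_derivative
        smoothed \<psi>' M W x - (2 * kmax * wu + dmax)) (at x)"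
      by (auto intro!: derivative_eq_intros deriv_smoothed)
    then show "\<exists>y. ((\<lambda>R. smoothed \<psi> M W R - (2 * kmax * wu + dmax) * R) has_real_derivative y) (at x) \<and> y \<le> 0"
      using slope_le_const[of x] x assms by auto
  qed
  then show ?thesis by (simp add: smoothed_0)
qed

lemma slope_ge_near:
  assumes "0 \<le> R" "R + \<delta> < M" "R \<le> \<eta>"
  shows "2 * kmin * wl \<le> smoothed \<psi>' M W R"
proof -
  have "2 * kmin * wl \<le> 2 * \<psi> R * wl" using k(2)[of R] constants_pos assms by auto
  also have "\<dots> \<le> 2 * \<psi> R * wl + cl * R ^ m / 2" using constants_pos assms by simp
  finally show ?thesis using slope_ge[of R] assms by simp
qed

text \<open>The jump drives the growth up to \<eta>; from there monotonicity preserves what was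
  gained. For the scaled mollifier kmin is of order n and \<eta> of order 1/n, so the value reached
  at \<eta> does not depend on n.\<close>

lemma smoothed_ge:
  assumes "0 \<le> R" "R + \<delta> < M"
  shows "2 * kmin * wl * min R \<eta> \<le> smoothed \<psi> M W R"
proof -
  have "2 * kmin * wl * (min R \<eta> - 0) \<le> smoothed \<psi> M W (min R \<eta>) - smoothed \<psi> M W 0"
    by (rule smoothed_increment) (use assms k slope_ge_near in auto)
  also have "smoothed \<psi> M W (min R \<eta>) \<le> smoothed \<psi> M W R"
    by (rule smoothed_mono) (use assms k in auto)
  finally show ?thesis by (simp add: smoothed_0)
qed

lemma smoothed_pos: "0 < R \<Longrightarrow> R + \<delta> < M \<Longrightarrow> 0 < smoothed \<psi> M W R"
  by (rule less_le_trans[OF _ smoothed_ge]) (use k constants_pos in auto)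

text \<open>
  Near the origin the jump \<open>2 W(0)\<close> of the odd extension makes the slope at least of order \<open>kmin\<close>;
  elsewhere \<open>D S \<ge> cl S\<^sup>m\<close> compensates the factor \<open>R\<^sup>-\<^sup>m\<close>.
\<close>

lemma smoothed_volume_ge:
  assumes "0 < R" "R + \<delta> < M"
  shows "min ((2 * kmin * wl) ^ Suc m) (cl / 2 * (2 * kmin * wl * \<eta>) ^ m)
    \<le> smoothed \<psi>' M W R * (smoothed \<psi> M W R / R) ^ m"
proof (cases "R \<le> \<eta>")
  case True
  have "(2 * kmin * wl) * (2 * kmin * wl) ^ m \<le> smoothed \<psi>' M W R * (smoothed \<psi> M W R / R) ^ m"
  proof (intro mult_mono power_mono)
    show "2 * kmin * wl \<le> smoothed \<psi> M W R / R"
      using smoothed_ge[of R] assms True by (simp add: min_def pos_le_divide_eq)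
  qed (use slope_ge_near slope_nonneg assms True k constants_pos smoothed_pos in auto)
  then show ?thesis by simp
next
  case False
  have "cl / 2 * (2 * kmin * wl * \<eta>) ^ m = (cl * R ^ m / 2) * (2 * kmin * wl * \<eta> / R) ^ m"
    using assms by (simp add: power_divide)
  also have "\<dots> \<le> smoothed \<psi>' M W R * (smoothed \<psi> M W R / R) ^ m"
  proof (intro mult_mono power_mono divide_right_mono)
    show "2 * kmin * wl * \<eta> \<le> smoothed \<psi> M W R" using smoothed_ge[of R] assms False by simp
    have "0 \<le> 2 * \<psi> R * wl" using nonneg[of R] constants_pos by simp
    then show "cl * R ^ m / 2 \<le> smoothed \<psi>' M W R" using slope_ge[of R] assms by linarith
  qed (use slope_nonneg assms k constants_pos in auto)
  finally show ?thesis by simp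
qed

text \<open>The first bound reaches down to the origin but grows with the height of the kernel. The
  second is independent of the kernel: beyond \<delta> the factor R^m of the slope cancels the R^m
  in the denominator.\<close>

lemma smoothed_volume_le:
  assumes "0 < R" "R + \<delta> < M"
  shows "smoothed \<psi>' M W R * (smoothed \<psi> M W R / R) ^ m \<le> (2 * kmax * wu + dmax) ^ Suc m"
    and "\<delta> < R \<Longrightarrow> smoothed \<psi>' M W R * (smoothed \<psi> M W R / R) ^ m \<le> cu * 2 ^ m * wu ^ m"
proof -
  have pos: "0 \<le> smoothed \<psi> M W R / R" using smoothed_pos[OF assms] assms by simp
  have "smoothed \<psi>' M W R * (smoothed \<psi> M W R / R) ^ m \<le> (2 * kmax * wu + dmax) * (2 * kmax * wu + dmax) ^ m"
    using slope_le_const[of R] slope_nonneg[of R] smoothed_le[of R] assms pos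
    by (intro mult_mono power_mono) (auto simp: pos_divide_le_eq intro: order.trans)
  then show "smoothed \<psi>' M W R * (smoothed \<psi> M W R / R) ^ m \<le> (2 * kmax * wu + dmax) ^ Suc m" by simp
  assume "\<delta> < R"
  then have "smoothed \<psi>' M W R * (smoothed \<psi> M W R / R) ^ m \<le> (cu * (2 * R) ^ m) * (wu / R) ^ m"
    using slope_le_away[of R] slope_nonneg[of R] abs_smoothed_le[of R] assms pos constants_pos
    by (intro mult_mono power_mono divide_right_mono) auto
  then show "smoothed \<psi>' M W R * (smoothed \<psi> M W R / R) ^ m \<le> cu * 2 ^ m * wu ^ m"
    using assms by (simp add: power_mult_distrib power_divide)
qed

end

lemma smoothed_approximates:
  assumes R: "\<delta> < R" "R + \<delta> < M"
    and e: "\<And>S. S \<in> {0..M} \<Longrightarrow> \<bar>R - S\<bar> \<le> \<delta> \<Longrightarrow> \<bar>W S - W R\<bar> \<le> e \<and> \<bar>D S - D R\<bar> \<le> e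
      \<and> \<bar>(W S - S * D S) - (W R - R * D R)\<bar> \<le> e"
  shows "\<bar>smoothed \<psi> M W R - W R\<bar> \<le> e" "\<bar>smoothed \<psi>' M W R - D R\<bar> \<le> e"
    "\<bar>smoothed_rate \<psi> \<psi>' M W R - (W R - R * D R)\<bar> \<le> e"
proof -
  have R0: "0 \<le> R" using R \<delta>_pos by simp
  have b: "c - e \<le> I \<and> I \<le> c + e"
    if "((\<lambda>S. k R S * f S) has_integral I) {0..M}" "k = odd_kernel \<psi> \<or> k = even_kernel \<psi>"
      "\<And>S. S \<in> {0..M} \<Longrightarrow> \<bar>R - S\<bar> \<le> \<delta> \<Longrightarrow> \<bar>f S - c\<bar> \<le> e" for f k I c
    using local_average_bounds[where k = k and f = f and c = "c - e" and C = "c + e", OF R that(1,2)] that(3)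
    by (force simp: abs_le_iff)
  have "\<psi> R = 0" using support[of R] R \<delta>_pos by simp
  then show "\<bar>smoothed \<psi> M W R - W R\<bar> \<le> e" "\<bar>smoothed \<psi>' M W R - D R\<bar> \<le> e"
    "\<bar>smoothed_rate \<psi> \<psi>' M W R - (W R - R * D R)\<bar> \<le> e"
    using b[where k = "odd_kernel \<psi>" and f = W and c = "W R", OF smoothed_has_integral]
      b[where k = "even_kernel \<psi>" and f = D and c = "D R", OF slope_has_integral[OF R0 R(2)]]
      b[where k = "odd_kernel \<psi>" and f = "\<lambda>S. W S - S * D S" and c = "W R - R * D R", OF rate_has_integral[OF R0 R(2)]] e by (auto simp: abs_le_iff algebra_simps)
qed

end

section \<open>Energy balance of the self-similar solution\<close>

text \<open>The arguments are the radial velocity q, the radial stretch p = w_R and the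
  circumferential stretch z = w/R, which has multiplicity d - 1.\<close>

definition radial_density :: "nat \<Rightarrow> (real \<Rightarrow> real) \<Rightarrow> real \<Rightarrow> real \<Rightarrow> real \<Rightarrow> real" where
  "radial_density d h q p z = 1/2 * q\<^sup>2 + 1/2 * (p\<^sup>2 + (real d - 1) * z\<^sup>2) + h (p * z ^ (d - 1))"

lemma volumetric_energy_derivs:
  assumes "volumetric_energy h" "0 < v"
  shows "(h has_real_derivative deriv h v) (at v)" "isCont (deriv h) v"
proof -
  have "h differentiable (at v)" "deriv h differentiable (at v)"
    using assms unfolding volumetric_energy_def by blast+
  then show "(h has_real_derivative deriv h v) (at v)" "isCont (deriv h) v"
    by (simp_all add: DERIV_deriv_iff_real_differentiable differentiable_imp_continuous_within)
qed

context
  fixes d :: nat and h r :: "real \<Rightarrow> real" and H lam \<sigma> :: real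
  assumes d: "3 \<le> d" and h: "volumetric_energy h" and H: "0 < H" "deriv h H = 0" and lam: "0 < lam"
    and sol: "cavitating_solution d h H lam \<sigma> r"
    and props: "cavitating_solution_properties d H lam \<sigma> r"
begin

lemma \<sigma>_pos: "0 < \<sigma>"
  using sol by (simp add: cavitating_solution_def)

text \<open>Found from the energy equation: for e depending on s = R/t only it reads - s^d e' =
  (s^(d-1) P_1 q)' with q = w_t = r - s r'. Adding (s^d e)' = d s^(d-1) e + s^d e' shows which
  quantity has the derivative d s^(d-1) e.\<close>

definition energy_flux where
  "energy_flux s = s ^ d * radial_density d h (r s - s * deriv r s) (deriv r s) (r s / s)
     + s ^ (d - 1) * stress1 d h r s * (r s - s * deriv r s)"

lemma specific_volume_pos: "s \<in> {0<..<\<sigma>} \<Longrightarrow> 0 < specific_volume d r s"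
  using props H(1) less_le_trans unfolding cavitating_solution_properties_def by blast

text \<open>
  For self-similar solutions the energy equation \<open>e\<^sub>t = R\<^sup>1\<^sup>-\<^sup>d (R\<^sup>d\<^sup>-\<^sup>1 P\<^sub>1 w\<^sub>t)\<^sub>R\<close> makes \<open>d s\<^sup>d\<^sup>-\<^sup>1 e(s)\<close> an
  exact derivative.
\<close>

lemma energy_flux_deriv:
  assumes s: "s \<in> {0<..<\<sigma>}"
  shows "(energy_flux has_real_derivative
    real d * s ^ (d - 1) * radial_density d h (r s - s * deriv r s) (deriv r s) (r s / s)) (at s)"
proof -
  define k where "k = d - 3"
  have k: "d = Suc (Suc (Suc k))" using d by (simp add: k_def)
  have s0: "s \<noteq> 0" using s by simp
  have dr: "(r has_real_derivative deriv r s) (at s)"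
    and ddr: "(deriv r has_real_derivative deriv (deriv r) s) (at s)"
    and dP: "(stress1 d h r has_real_derivative deriv (stress1 d h r) s) (at s)"
    and ode: "s\<^sup>2 * deriv (deriv r) s =
          deriv (stress1 d h r) s + (real d - 1) / s * (stress1 d h r s - stress2 d h r s)"
    using sol s unfolding cavitating_solution_def by (auto simp: DERIV_deriv_iff_real_differentiable)
  define p pp z P1 P2 h' where defs: "p = deriv r s" "pp = deriv (deriv r) s" "z = r s / s"
    "P1 = stress1 d h r s" "P2 = stress2 d h r s" "h' = deriv h (specific_volume d r s)"
  have dh: "(h has_real_derivative h') (at (deriv r s * (r s / s) ^ Suc (Suc k)))"
    using volumetric_energy_derivs(1)[OF h specific_volume_pos[OF s]]
    by (simp add: defs(6) specific_volume_def k)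
  have dz: "((\<lambda>s. r s / s) has_real_derivative (p - z) / s) (at s)"
    by (rule DERIV_cong, rule DERIV_divide[OF dr DERIV_ident s0])
      (use s0 in \<open>simp add: defs(1-3) field_simps\<close>)
  have P1: "P1 = p + z ^ Suc (Suc k) * h'" and P2: "P2 = z + p * z ^ Suc k * h'"
    unfolding defs stress1_def stress2_def k by simp_all
  have dv: "((\<lambda>s. deriv r s * (r s / s) ^ Suc (Suc k)) has_real_derivative
      pp * z ^ Suc (Suc k) + p * (real (Suc (Suc k)) * z ^ Suc k * ((p - z) / s))) (at s)"
    by (rule DERIV_cong, rule DERIV_mult[OF ddr DERIV_power[OF dz]])
      (simp add: defs(1-3)[symmetric] algebra_simps add_divide_distrib diff_divide_distrib)
  have dhv: "((\<lambda>s. h (deriv r s * (r s / s) ^ Suc (Suc k))) has_real_derivative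
      h' * (pp * z ^ Suc (Suc k) + p * (real (Suc (Suc k)) * z ^ Suc k * ((p - z) / s)))) (at s)"
    by (rule DERIV_chain2[OF dh dv])
  have dq: "((\<lambda>s. r s - s * deriv r s) has_real_derivative - s * pp) (at s)"
    by (auto intro!: derivative_eq_intros dr ddr simp: defs)
  \<comment> \<open>Apart from the kinetic part, the density has partial derivative P_1 in p and (d
    - 1) P_2 in z; the kinetic part contributes q q' with q' = - s r''.\<close>
  have dE: "((\<lambda>s. radial_density d h (r s - s * deriv r s) (deriv r s) (r s / s)) has_real_derivative
      - (r s - s * p) * s * pp + pp * P1 + real (Suc (Suc k)) * ((p - z) / s) * P2) (at s)"
    unfolding radial_density_def k diff_Suc_1
    by (rule DERIV_cong, rule DERIV_add[OF DERIV_add[OF DERIV_cmult[OF DERIV_power[OF dq]]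
        DERIV_cmult[OF DERIV_add[OF DERIV_power[OF ddr] DERIV_cmult[OF DERIV_power[OF dz]]]]] dhv])
      (simp add: P1 P2 defs(1-3)[symmetric] algebra_simps add_divide_distrib diff_divide_distrib)
  have "(energy_flux has_real_derivative
      real d * s ^ (d - 1) * radial_density d h (r s - s * deriv r s) (deriv r s) (r s / s)
      + s ^ d * (- (r s - s * p) * s * pp + pp * P1 + real (Suc (Suc k)) * ((p - z) / s) * P2)
      + (real (d - 1) * s ^ (d - 2) * P1 + s ^ (d - 1) * deriv (stress1 d h r) s) * (r s - s * p)
      + s ^ (d - 1) * P1 * (- s * pp)) (at s)" (is "(_ has_real_derivative ?A + ?B + ?C + ?D) _")
    unfolding energy_flux_def[abs_def]
    by (rule DERIV_cong, rule DERIV_add[OF DERIV_mult[OF DERIV_pow dE] DERIV_mult[OF DERIV_mult[OF DERIV_pow dP] dq]])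
      (simp only: defs(1,4)[symmetric], simp add: k algebra_simps)
  moreover have "?B + ?C + ?D = 0"
  proof -
    have P1': "deriv (stress1 d h r) s = s\<^sup>2 * pp - real (Suc (Suc k)) / s * (P1 - P2)"
      using ode by (simp add: defs k)
    have rs: "r s = z * s" using s0 by (simp add: defs)
    \<comment> \<open>Naming the two quotients by s turns the cancellation into a polynomial
      identity modulo the relations for s u and s x.\<close>
    define u x where ux: "u = (p - z) / s" "x = real (Suc (Suc k)) / s * (P1 - P2)"
    have "s * u = p - z" "s * x = real (Suc (Suc k)) * (P1 - P2)" using s0 by (simp_all add: ux)
    moreover have "s ^ d = s ^ Suc k * s * s" "s ^ (d - 1) = s ^ Suc k * s" "s ^ (d - 2) = s ^ Suc k"
      "real (d - 1) = real (Suc (Suc k))"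
      by (simp_all add: k)
    moreover have "T * s * s * (- (z * s - s * p) * s * pp + pp * P1 + N * u * P2)
      + (N * T * P1 + T * s * (s\<^sup>2 * pp - x)) * (z * s - s * p) + T * s * P1 * (- s * pp) = 0"
      if su: "s * u = p - z" and sx: "s * x = N * (P1 - P2)" for T N
    proof -
      have "T * s * s * (- (z * s - s * p) * s * pp + pp * P1 + N * u * P2)
        + (N * T * P1 + T * s * (s\<^sup>2 * pp - x)) * (z * s - s * p) + T * s * P1 * (- s * pp)
        = T * s * N * P2 * (s * u) + N * T * P1 * s * (z - p) - T * s * (s * x) * (z - p)"
        by (simp add: algebra_simps power2_eq_square)
      also have "\<dots> = 0" unfolding su sx by (simp add: algebra_simps)
      finally show ?thesis .
    qed
    ultimately show ?thesis unfolding P1' rs ux[symmetric] by metis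
  qed
  then have "?A + ?B + ?C + ?D = ?A" by (simp only: add.assoc add_0_right)
  ultimately show ?thesis by (rule DERIV_cong)
qed

text \<open>Identifies the two limits that are only asserted to exist in
  \<open>cavitating_solution\<close>: the first by uniqueness of limits, the second by continuity of
  h' at the limit volume. The jump condition thereby becomes a relation between p and lam.\<close>

lemma deriv_r_left_limit:
  assumes "p = Lim (at_left \<sigma>) (deriv r)"
  shows "(deriv r \<longlongrightarrow> p) (at_left \<sigma>)" "0 < p"
    "\<sigma>\<^sup>2 * (lam - p) = lam + lam ^ (d - 1) * deriv h (lam ^ d)
       - (p + lam ^ (d - 1) * deriv h (p * lam ^ (d - 1)))"
    "(specific_volume d r \<longlongrightarrow> p * lam ^ (d - 1)) (at_left \<sigma>)"
    "(r \<longlongrightarrow> lam * \<sigma>) (at_left \<sigma>)"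
proof -
  obtain p' q where p: "(deriv r \<longlongrightarrow> p') (at_left \<sigma>)" and q: "(stress1 d h r \<longlongrightarrow> q) (at_left \<sigma>)"
    and RH: "\<sigma>\<^sup>2 * (lam - p') = lam + lam ^ (d - 1) * deriv h (lam ^ d) - q"
    using sol unfolding cavitating_solution_def by blast
  have "p = p'" unfolding assms by (rule tendsto_Lim[OF _ p]) simp
  note p = p[folded this] and RH = RH[folded this]
  \<comment> \<open>Any point of the fan would do: the slope there is nonnegative and strictly below
    its limit p. Positivity of p keeps the limit volume in the domain of h.\<close>
  have "0 \<le> deriv r (\<sigma>/2)" "deriv r (\<sigma>/2) < p" "p < lam"
    using props \<sigma>_pos unfolding cavitating_solution_properties_def assms by auto
  then have p0: "0 < p" "p < lam" by linarith+
  have r: "(r \<longlongrightarrow> lam * \<sigma>) (at_left \<sigma>)"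
  proof -
    have "continuous_on {0..} r" "r \<sigma> = lam * \<sigma>" using sol by (auto simp: cavitating_solution_def)
    then have "(r \<longlongrightarrow> lam * \<sigma>) (at \<sigma> within {0..})"
      using \<sigma>_pos unfolding continuous_on by (metis atLeast_iff less_imp_le)
    then have "(r \<longlongrightarrow> lam * \<sigma>) (at \<sigma>)"
      using \<sigma>_pos at_within_interior[of \<sigma> "{0..}"] by simp
    then show ?thesis by (rule filterlim_mono) (auto simp: at_le)
  qed
  have z: "((\<lambda>s. r s / s) \<longlongrightarrow> lam) (at_left \<sigma>)"
    using tendsto_divide[OF r tendsto_ident_at] \<sigma>_pos by simp
  have v: "(specific_volume d r \<longlongrightarrow> p * lam ^ (d - 1)) (at_left \<sigma>)"
    unfolding specific_volume_def[abs_def] by (intro tendsto_intros p z)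
  have "0 < p * lam ^ (d - 1)" using p0 lam by simp
  then have "((\<lambda>s. deriv h (specific_volume d r s)) \<longlongrightarrow> deriv h (p * lam ^ (d - 1))) (at_left \<sigma>)"
    using volumetric_energy_derivs(2)[OF h] by (intro isCont_tendsto_compose[OF _ v]) auto
  then have "(stress1 d h r \<longlongrightarrow> p + lam ^ (d - 1) * deriv h (p * lam ^ (d - 1))) (at_left \<sigma>)"
    unfolding stress1_def[abs_def] by (intro tendsto_intros p z)
  then have "q = p + lam ^ (d - 1) * deriv h (p * lam ^ (d - 1))"
    using tendsto_unique[OF _ q] by simp
  with RH show "\<sigma>\<^sup>2 * (lam - p) = lam + lam ^ (d - 1) * deriv h (lam ^ d)
       - (p + lam ^ (d - 1) * deriv h (p * lam ^ (d - 1)))" by simp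
  show "(deriv r \<longlongrightarrow> p) (at_left \<sigma>)" "0 < p" "(specific_volume d r \<longlongrightarrow> p * lam ^ (d - 1)) (at_left \<sigma>)"
    "(r \<longlongrightarrow> lam * \<sigma>) (at_left \<sigma>)" by (fact p p0 v r)+
qed

lemma energy_flux_tendsto_left:
  assumes p: "p = Lim (at_left \<sigma>) (deriv r)"
  shows "(energy_flux \<longlongrightarrow> \<sigma> ^ d * (shock_dissipation d h lam p + (real d / 2 * lam\<^sup>2 + h (lam ^ d)))) (at_left \<sigma>)"
proof -
  have lims: "(deriv r \<longlongrightarrow> p) (at_left \<sigma>)" "0 < p"
    and RH: "\<sigma>\<^sup>2 * (lam - p) = lam + lam ^ (d - 1) * deriv h (lam ^ d)
       - (p + lam ^ (d - 1) * deriv h (p * lam ^ (d - 1)))"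
    and v: "(specific_volume d r \<longlongrightarrow> p * lam ^ (d - 1)) (at_left \<sigma>)"
    and r: "(r \<longlongrightarrow> lam * \<sigma>) (at_left \<sigma>)"
    by (fact deriv_r_left_limit[OF p])+
  have v0: "0 < p * lam ^ (d - 1)" using lims lam by simp
  have z: "((\<lambda>s. r s / s) \<longlongrightarrow> lam) (at_left \<sigma>)"
    using tendsto_divide[OF r tendsto_ident_at] \<sigma>_pos by simp
  have h': "((\<lambda>s. deriv h (specific_volume d r s)) \<longlongrightarrow> deriv h (p * lam ^ (d - 1))) (at_left \<sigma>)"
    using volumetric_energy_derivs(2)[OF h v0] by (rule isCont_tendsto_compose[OF _ v])
  have hv: "((\<lambda>s. h (specific_volume d r s)) \<longlongrightarrow> h (p * lam ^ (d - 1))) (at_left \<sigma>)"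
    using DERIV_isCont[OF volumetric_energy_derivs(1)[OF h v0]] by (rule isCont_tendsto_compose[OF _ v])
  have "(energy_flux \<longlongrightarrow> \<sigma> ^ d * (1/2 * (lam * \<sigma> - \<sigma> * p)\<^sup>2 + 1/2 * (p\<^sup>2 + (real d - 1) * lam\<^sup>2)
        + h (p * lam ^ (d - 1)))
      + \<sigma> ^ (d - 1) * (p + lam ^ (d - 1) * deriv h (p * lam ^ (d - 1))) * (lam * \<sigma> - \<sigma> * p)) (at_left \<sigma>)"
    (is "(_ \<longlongrightarrow> ?G) _")
    unfolding energy_flux_def[abs_def] stress1_def radial_density_def
    unfolding specific_volume_def[symmetric]
    by (intro tendsto_intros lims z r hv h')
  moreover have "?G = \<sigma> ^ d * (shock_dissipation d h lam p + (real d / 2 * lam\<^sup>2 + h (lam ^ d)))"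
  proof -
    obtain k where k: "d = Suc k" using d by (cases d) auto
    have dk: "d - 1 = k" "real d = real k + 1" by (simp_all add: k)
    define hl hp where "hl = deriv h (lam ^ d)" "hp = deriv h (p * lam ^ k)"
    have RH': "\<sigma>\<^sup>2 * (lam - p) = lam + lam ^ k * hl - (p + lam ^ k * hp)"
      using RH unfolding hl_hp_def dk(1) .
    \<comment> \<open>The kinetic term is \<sigma>^2 (lam - p)^2 / 2. The jump condition replaces it
      by half the stress difference times lam - p, which turns the one-sided stress in the flux into
      the mean of the stresses on both sides of the shock.\<close>
    have "1/2 * (lam * \<sigma> - \<sigma> * p)\<^sup>2 = 1/2 * (\<sigma>\<^sup>2 * (lam - p)) * (lam - p)"
      by (simp add: power2_eq_square field_simps)
    also have "\<dots> = 1/2 * (lam + lam ^ k * hl - (p + lam ^ k * hp)) * (lam - p)"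
      unfolding RH' ..
    finally have sq: "1/2 * (lam * \<sigma> - \<sigma> * p)\<^sup>2 = 1/2 * (lam + lam ^ k * hl - (p + lam ^ k * hp)) * (lam - p)" .
    have *: "\<sigma> ^ (d - 1) * x * (lam * \<sigma> - \<sigma> * p) = \<sigma> ^ d * (x * (lam - p))" for x
      by (simp add: k algebra_simps)
    have "?G = \<sigma> ^ d * ((1/2 * (lam * \<sigma> - \<sigma> * p)\<^sup>2 + 1/2 * (p\<^sup>2 + (real d - 1) * lam\<^sup>2)
        + h (p * lam ^ (d - 1))) + (p + lam ^ (d - 1) * deriv h (p * lam ^ (d - 1))) * (lam - p))"
      unfolding * by (simp only: distrib_left[of "\<sigma> ^ d"])
    also have "\<dots> = \<sigma> ^ d * (shock_dissipation d h lam p + (real d / 2 * lam\<^sup>2 + h (lam ^ d)))"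
      unfolding sq shock_dissipation_def
      by (rule arg_cong[of _ _ "\<lambda>x. \<sigma> ^ d * x"])
         (simp add: dk[unfolded One_nat_def] hl_hp_def[symmetric] algebra_simps power2_eq_square)
    finally show ?thesis .
  qed
  ultimately show ?thesis by simp
qed

lemma r_tendsto_0: "(r \<longlongrightarrow> r 0) (at_right 0)" "0 < r 0"
proof -
  have "continuous_on {0..} r" using sol by (simp add: cavitating_solution_def)
  then have "(r \<longlongrightarrow> r 0) (at 0 within {0..})" by (auto simp: continuous_on)
  then show "(r \<longlongrightarrow> r 0) (at_right 0)" by (rule filterlim_mono) (auto intro: at_le)
  show "0 < r 0" using sol by (simp add: cavitating_solution_def)
qed

text \<open>After multiplying out, the only term without a positive power of s is r^d h'(v), and
  h'(v) tends to h'(H) = 0. The circumferential energy is of size s^(d-2) r^2 and vanishes as d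
  \<ge> 3.\<close>

lemma energy_flux_tendsto_right: "(energy_flux \<longlongrightarrow> 0) (at_right 0)"
proof -
  define k where "k = d - 3"
  have k: "d = Suc (Suc (Suc k))" using d by (simp add: k_def)
  have v: "(specific_volume d r \<longlongrightarrow> H) (at_right 0)"
    using sol by (simp add: cavitating_solution_def)
  have s: "((\<lambda>s::real. s) \<longlongrightarrow> 0) (at_right 0)" by (rule tendsto_ident_at)
  have h': "((\<lambda>s. deriv h (specific_volume d r s)) \<longlongrightarrow> 0) (at_right 0)"
    using isCont_tendsto_compose[OF volumetric_energy_derivs(2)[OF h H(1)] v] H(2) by simp
  have hv: "((\<lambda>s. h (specific_volume d r s)) \<longlongrightarrow> h H) (at_right 0)"
    using DERIV_isCont[OF volumetric_energy_derivs(1)[OF h H(1)]] by (rule isCont_tendsto_compose[OF _ v])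
  have ev: "\<forall>\<^sub>F s in at_right 0. s \<in> {0<..<\<sigma>}"
    using \<sigma>_pos by (simp add: eventually_at_right_field) (intro exI[of _ \<sigma>], auto)
  \<comment> \<open>The limit of r' at the cavity is not given; it is recovered from the limits of v
    and r by solving the definition of v for r'.\<close>
  have "((\<lambda>s. specific_volume d r s * s ^ (d - 1) / r s ^ (d - 1)) \<longlongrightarrow> H * 0 ^ (d - 1) / r 0 ^ (d - 1)) (at_right 0)"
    using r_tendsto_0 by (intro tendsto_intros v s) auto
  then have p: "(deriv r \<longlongrightarrow> 0) (at_right 0)"
  proof (rule Lim_transform_eventually[THEN tendsto_eq_rhs])
    show "\<forall>\<^sub>F s in at_right 0. specific_volume d r s * s ^ (d - 1) / r s ^ (d - 1) = deriv r s"
      using ev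
    proof eventually_elim
      case (elim s)
      then have "0 < r s" using sol by (auto simp: cavitating_solution_def)
      with elim show ?case by (simp add: specific_volume_def power_divide)
    qed
  qed (simp add: k)
  have "((\<lambda>s. 1/2 * (s ^ d * (r s - s * deriv r s)\<^sup>2) + 1/2 * (s ^ d * (deriv r s)\<^sup>2 + (real d - 1) * (s ^ (d - 2) * (r s)\<^sup>2))
       + s ^ d * h (specific_volume d r s)
       + (s ^ (d - 1) * deriv r s + r s ^ (d - 1) * deriv h (specific_volume d r s)) * (r s - s * deriv r s))
     \<longlongrightarrow> 1/2 * (0 ^ d * (r 0 - 0 * 0)\<^sup>2) + 1/2 * (0 ^ d * 0\<^sup>2 + (real d - 1) * (0 ^ (d - 2) * (r 0)\<^sup>2))
       + 0 ^ d * h H + (0 ^ (d - 1) * 0 + r 0 ^ (d - 1) * 0) * (r 0 - 0 * 0)) (at_right 0)"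
    by (intro tendsto_intros s p r_tendsto_0 hv h')
  then show ?thesis
  proof (rule Lim_transform_eventually[THEN tendsto_eq_rhs])
    show "\<forall>\<^sub>F s in at_right 0. 1/2 * (s ^ d * (r s - s * deriv r s)\<^sup>2) + 1/2 * (s ^ d * (deriv r s)\<^sup>2 + (real d - 1) * (s ^ (d - 2) * (r s)\<^sup>2))
       + s ^ d * h (specific_volume d r s)
       + (s ^ (d - 1) * deriv r s + r s ^ (d - 1) * deriv h (specific_volume d r s)) * (r s - s * deriv r s)
       = energy_flux s"
      using ev
    proof eventually_elim
      case (elim s)
      then have s: "s \<noteq> 0" by simp
      have a: "s ^ d * (r s / s)\<^sup>2 = s ^ (d - 2) * (r s)\<^sup>2" "s ^ (d - 1) * (r s / s) ^ (d - 1) = r s ^ (d - 1)"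
        using s by (simp_all add: k power_divide power2_eq_square)
      have "energy_flux s = 1/2 * (s ^ d * (r s - s * deriv r s)\<^sup>2) + 1/2 * (s ^ d * (deriv r s)\<^sup>2 + (real d - 1) * (s ^ d * (r s / s)\<^sup>2))
       + s ^ d * h (specific_volume d r s)
       + (s ^ (d - 1) * deriv r s + (s ^ (d - 1) * (r s / s) ^ (d - 1)) * deriv h (specific_volume d r s)) * (r s - s * deriv r s)"
        unfolding energy_flux_def radial_density_def stress1_def specific_volume_def by (simp add: algebra_simps)
      then show ?case unfolding a by simp
    qed
  qed (simp add: k)
qed

lemma similarity_energy_integral:
  assumes p: "p = Lim (at_left \<sigma>) (deriv r)"
  shows "((\<lambda>s. real d * s ^ (d - 1) * radial_density d h (r s - s * deriv r s) (deriv r s) (r s / s)) has_integral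
    \<sigma> ^ d * (shock_dissipation d h lam p + (real d / 2 * lam\<^sup>2 + h (lam ^ d)))) {0..\<sigma>}"
    (is "(?f has_integral ?G) _")
proof -
  \<comment> \<open>At \<sigma> the profile has a corner, so the value of \<open>deriv r\<close> and
    of the flux there means nothing. G takes the one-sided limits as its values at the ends.\<close>
  define G where "G s = (if s \<le> 0 then 0 else if s \<ge> \<sigma> then ?G else energy_flux s)" for s
  have "(?f has_integral G \<sigma> - G 0) {0..\<sigma>}"
  proof (rule fundamental_theorem_of_calculus_interior)
    show "(G has_vector_derivative ?f s) (at s)" if "s \<in> {0<..<\<sigma>}" for s
      unfolding has_real_derivative_iff_has_vector_derivative[symmetric]
      by (rule has_field_derivative_transform_within_open[OF energy_flux_deriv[OF that], of "{0<..<\<sigma>}"])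
         (use that in \<open>auto simp: G_def\<close>)
    show "continuous_on {0..\<sigma>} G"
    proof (rule continuous_on_IccI[OF _ _ _ \<sigma>_pos])
      have ends: "G 0 = 0" "G \<sigma> = ?G" using \<sigma>_pos by (simp_all add: G_def)
      have "\<forall>\<^sub>F s in at_right 0. energy_flux s = G s"
        using \<sigma>_pos unfolding eventually_at_right_field by (intro exI[of _ \<sigma>]) (auto simp: G_def)
      from Lim_transform_eventually[OF energy_flux_tendsto_right this]
      show "(G \<longlongrightarrow> G 0) (at_right 0)" unfolding ends .
      have "\<forall>\<^sub>F s in at_left \<sigma>. energy_flux s = G s"
        using \<sigma>_pos unfolding eventually_at_left_field by (intro exI[of _ 0]) (auto simp: G_def)
      from Lim_transform_eventually[OF energy_flux_tendsto_left[OF p] this]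
      show "(G \<longlongrightarrow> G \<sigma>) (at_left \<sigma>)" unfolding ends .
      show "G \<midarrow>s\<rightarrow> G s" if "0 < s" "s < \<sigma>" for s
      proof -
        have "(G has_real_derivative ?f s) (at s)"
          by (rule has_field_derivative_transform_within_open[OF energy_flux_deriv, of _ "{0<..<\<sigma>}"])
             (use that in \<open>auto simp: G_def\<close>)
        then show ?thesis using DERIV_isCont isCont_def by blast
      qed
    qed
  qed (use \<sigma>_pos in simp)
  then show ?thesis using \<sigma>_pos by (simp add: G_def)
qed

end

section \<open>The limit of the averaged radial energies\<close>

definition scaled_mollifier_deriv :: "(real \<Rightarrow> real) \<Rightarrow> nat \<Rightarrow> real \<Rightarrow> real" where
  "scaled_mollifier_deriv \<phi> n x = real n * (real n * deriv \<phi> (real n * x))"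

lemma mollifierD:
  assumes "mollifier \<phi>"
  shows "(\<phi> has_real_derivative deriv \<phi> x) (at x)" "isCont (deriv \<phi>) x" "isCont \<phi> x"
    "0 \<le> \<phi> x" "\<phi> (- x) = \<phi> x" "(\<phi> has_integral 1) UNIV" "0 < \<phi> 0" "1 < \<bar>x\<bar> \<Longrightarrow> \<phi> x = 0"
proof -
  have *: "(deriv ^^ k) \<phi> differentiable (at x)" for k using assms by (simp add: mollifier_def)
  from *[of 0] *[of 1]
  show "(\<phi> has_real_derivative deriv \<phi> x) (at x)" "isCont (deriv \<phi>) x" "isCont \<phi> x"
    by (simp_all add: DERIV_deriv_iff_real_differentiable differentiable_imp_continuous_within)
  show "0 \<le> \<phi> x" "\<phi> (- x) = \<phi> x" "(\<phi> has_integral 1) UNIV" "0 < \<phi> 0"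
    using assms by (auto simp: mollifier_def)
  assume "1 < \<bar>x\<bar>"
  then have "x \<notin> {-1..1}" by auto
  then show "\<phi> x = 0" using assms closure_subset[of "{x. \<phi> x \<noteq> 0}"] unfolding mollifier_def by blast
qed

lemma mollifier_bounds:
  assumes "mollifier \<phi>"
  obtains \<Phi> \<eta> where "0 < \<Phi>" "\<And>x. \<phi> x \<le> \<Phi>" "0 < \<eta>" "\<And>x. \<bar>x\<bar> \<le> \<eta> \<Longrightarrow> \<phi> 0 / 2 \<le> \<phi> x"
proof -
  have "continuous_on {-1..1} \<phi>"
    using mollifierD(3)[OF assms] by (simp add: continuous_at_imp_continuous_on)
  then have "bounded (\<phi> ` {-1..1})" by (intro compact_imp_bounded compact_continuous_image) auto
  then obtain C where C: "0 < C" "\<And>x. x \<in> {-1..1} \<Longrightarrow> norm (\<phi> x) \<le> C"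
    unfolding bounded_pos by auto
  have "\<phi> x \<le> C" for x
    using C(1) C(2)[of x] mollifierD(8)[OF assms, of x] by (cases "x \<in> {-1..1}") auto
  moreover obtain e where e: "0 < e" "\<And>x. dist x 0 < e \<Longrightarrow> dist (\<phi> x) (\<phi> 0) < \<phi> 0 / 2"
    using mollifierD(3)[OF assms, of 0] half_gt_zero[OF mollifierD(7)[OF assms]]
    unfolding continuous_at_eps_delta by blast
  have "\<phi> 0 / 2 \<le> \<phi> x" if "\<bar>x\<bar> \<le> e / 2" for x
    using e(1) e(2)[of x] that unfolding dist_real_def by linarith
  ultimately show thesis using that[of C "e / 2"] C(1) e(1) by auto
qed

lemma smoothing_kernel_scaled_mollifier:
  assumes \<phi>: "mollifier \<phi>" and n: "0 < n"
  shows "smoothing_kernel (scaled_mollifier \<phi> n) (scaled_mollifier_deriv \<phi> n) (1 / real n)"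
proof
  let ?n = "real n"
  fix x
  have *: "((\<lambda>x. \<phi> (?n * x)) has_real_derivative deriv \<phi> (?n * x) * (?n * 1)) (at x)"
    by (rule DERIV_chain2[OF mollifierD(1)[OF \<phi>]]) (rule DERIV_cmult[OF DERIV_ident])
  from DERIV_cmult[OF *, of ?n]
  show "(scaled_mollifier \<phi> n has_real_derivative scaled_mollifier_deriv \<phi> n x) (at x)"
    by (simp add: scaled_mollifier_def[abs_def] scaled_mollifier_deriv_def mult_ac)
  have cd: "continuous_on UNIV (deriv \<phi>)"
    using mollifierD(2)[OF \<phi>] by (simp add: continuous_at_imp_continuous_on)
  show "continuous_on UNIV (scaled_mollifier_deriv \<phi> n)"
    unfolding scaled_mollifier_deriv_def[abs_def]
    by (intro continuous_on_mult continuous_on_const continuous_on_id continuous_on_compose2[OF cd]) auto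
  show "scaled_mollifier \<phi> n (- x) = scaled_mollifier \<phi> n x" "0 \<le> scaled_mollifier \<phi> n x"
    using mollifierD(4,5)[OF \<phi>, of "?n * x"] by (simp_all add: scaled_mollifier_def)
  show "scaled_mollifier \<phi> n x = 0" if "1 / ?n < \<bar>x\<bar>"
  proof -
    have "1 < \<bar>?n * x\<bar>" using that n by (simp add: abs_mult pos_divide_less_eq mult.commute)
    then show ?thesis using mollifierD(8)[OF \<phi>] by (simp add: scaled_mollifier_def)
  qed
  show "0 < 1 / ?n" using n by simp
  have "(\<lambda>x. if x \<in> {-1..1} then \<phi> x else 0) = \<phi>"
    using mollifierD(8)[OF \<phi>] by (auto simp: fun_eq_iff)
  then have "(\<phi> has_integral 1) {-1..1}"
    using mollifierD(6)[OF \<phi>] has_integral_restrict_UNIV[of "{-1..1}" \<phi> 1] by simp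
  from has_integral_mult_right[OF has_integral_stretch_real[OF this], of ?n ?n]
  have "(scaled_mollifier \<phi> n has_integral 1) ((\<lambda>x. x / ?n) ` {-1..1})"
    using n by (simp add: scaled_mollifier_def[abs_def])
  then show "(scaled_mollifier \<phi> n has_integral 1) UNIV"
  proof (rule has_integral_on_superset)
    fix x assume x: "x \<notin> (\<lambda>x. x / ?n) ` {-1..1}"
    have "?n * x \<notin> {-1..1}"
    proof
      assume "?n * x \<in> {-1..1}"
      then have "?n * x / ?n \<in> (\<lambda>x. x / ?n) ` {-1..1}" by (rule imageI)
      with x n show False by simp
    qed
    then show "scaled_mollifier \<phi> n x = 0"
      using mollifierD(8)[OF \<phi>, of "?n * x"] by (auto simp: scaled_mollifier_def)
  qed simp
qed

text \<open>The limit controls large v and compactness the rest. The cutoff c > 0 matters because k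
  may blow up at 0.\<close>

lemma sublinear_bound:
  fixes k :: "real \<Rightarrow> real"
  assumes cont: "continuous_on {0<..} k" and lim: "((\<lambda>v. k v / v) \<longlongrightarrow> 0) at_top"
    and "0 < c" "0 < \<epsilon>"
  obtains C where "0 \<le> C" "\<And>v. c \<le> v \<Longrightarrow> \<bar>k v\<bar> \<le> \<epsilon> * v + C"
proof -
  obtain V where V: "\<And>v. V \<le> v \<Longrightarrow> \<bar>k v / v\<bar> < \<epsilon>"
    using tendstoD[OF lim \<open>0 < \<epsilon>\<close>] by (auto simp: eventually_at_top_linorder dist_real_def)
  have "bounded (k ` {c..max c V})"
    using \<open>0 < c\<close> by (intro compact_imp_bounded compact_continuous_image continuous_on_subset[OF cont]) auto
  then obtain C where C: "0 < C" "\<And>v. v \<in> {c..max c V} \<Longrightarrow> norm (k v) \<le> C"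
    unfolding bounded_pos by auto
  have "\<bar>k v\<bar> \<le> \<epsilon> * v + C" if v: "c \<le> v" for v
  proof (cases "v \<le> max c V")
    case True
    then have "\<bar>k v\<bar> \<le> C" using C(2)[of v] v by simp
    also have "\<dots> \<le> \<epsilon> * v + C" using v assms by simp
    finally show ?thesis .
  next
    case False
    then have "\<bar>k v\<bar> / v < \<epsilon>" using V[of v] v assms by simp
    then have "\<bar>k v\<bar> \<le> \<epsilon> * v" using v assms by (simp add: pos_divide_less_eq)
    then show ?thesis using C(1) by simp
  qed
  with that[of C] C(1) show thesis by simp
qed

lemma abs_radial_density_le:
  assumes "\<bar>q\<bar> \<le> q0" "0 \<le> p" "p \<le> p0" "0 \<le> z" "z \<le> z0" "\<bar>h (p * z ^ (d - 1))\<bar> \<le> b" "1 \<le> d"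
  shows "\<bar>radial_density d h q p z\<bar> \<le> 1/2 * q0\<^sup>2 + 1/2 * (p0\<^sup>2 + (real d - 1) * z0\<^sup>2) + b"
proof -
  have "q\<^sup>2 \<le> q0\<^sup>2" using assms(1) by (metis abs_ge_zero power2_abs power_mono)
  moreover have "p\<^sup>2 \<le> p0\<^sup>2" "z\<^sup>2 \<le> z0\<^sup>2" using assms by (auto intro: power_mono)
  moreover have "(real d - 1) * z\<^sup>2 \<le> (real d - 1) * z0\<^sup>2"
    using assms(7) calculation(3) by (intro mult_left_mono) auto
  moreover have "0 \<le> (real d - 1) * z\<^sup>2" using assms(7) by simp
  moreover have "0 \<le> p\<^sup>2" "0 \<le> q\<^sup>2" by simp_all
  moreover have "h (p * z ^ (d - 1)) \<le> b" "- b \<le> h (p * z ^ (d - 1))" using assms(6) by linarith+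
  moreover have "\<bar>1/2 * A + 1/2 * (B + C) + D\<bar> \<le> 1/2 * A' + 1/2 * (B' + C') + b"
    if "A \<le> A'" "B \<le> B'" "C \<le> C'" "0 \<le> A" "0 \<le> B" "0 \<le> C" "D \<le> b" "- b \<le> D" for A B C D A' B' C' :: real
    using that by (simp add: field_simps abs_le_iff)
  ultimately show ?thesis unfolding radial_density_def by blast
qed

lemma radial_density_split:
  "radial_density d h q p z = radial_density d (\<lambda>v. h v - L * v) q p z + L * (p * z ^ (d - 1))"
  by (simp add: radial_density_def)

definition averaged_density ::
  "(real \<Rightarrow> real) \<Rightarrow> (real \<Rightarrow> real) \<Rightarrow> nat \<Rightarrow> real \<Rightarrow> real \<Rightarrow> (real \<Rightarrow> real) \<Rightarrow> nat \<Rightarrow> real \<Rightarrow> real" where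
  "averaged_density \<phi> h d t M W n R = radial_density d h
     (smoothed_rate (scaled_mollifier \<phi> n) (scaled_mollifier_deriv \<phi> n) M W R / t)
     (smoothed (scaled_mollifier_deriv \<phi> n) M W R)
     (smoothed (scaled_mollifier \<phi> n) M W R / R)"

definition limit_density ::
  "(real \<Rightarrow> real) \<Rightarrow> nat \<Rightarrow> real \<Rightarrow> (real \<Rightarrow> real) \<Rightarrow> (real \<Rightarrow> real) \<Rightarrow> real \<Rightarrow> real" where
  "limit_density h d t W D R = radial_density d h ((W R - R * D R) / t) (D R) (W R / R)"

text \<open>The margin in \<open>Rb + 1 < M\<close> covers the support radii 1/n of all n \<ge> 1 at
  once. The condition 2 \<le> m is the dimension condition d \<ge> 3.\<close>

locale mollified_profile = profile W D a M cl cu wl wu dmax m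
  for W D a M cl cu wl wu dmax m +
  fixes \<phi> :: "real \<Rightarrow> real" and t Rb :: real
  assumes \<phi>: "mollifier \<phi>" and m2: "2 \<le> m" and t: "0 < t" and Rb: "0 < Rb" "Rb + 1 < M"
begin

abbreviation "wn n \<equiv> smoothed (scaled_mollifier \<phi> n) M W"
abbreviation "pn n \<equiv> smoothed (scaled_mollifier_deriv \<phi> n) M W"
abbreviation "qn n \<equiv> smoothed_rate (scaled_mollifier \<phi> n) (scaled_mollifier_deriv \<phi> n) M W"

lemma smoothed_profile_scaled: "0 < n \<Longrightarrow>
  smoothed_profile (scaled_mollifier \<phi> n) (scaled_mollifier_deriv \<phi> n) (1 / real n) W D a M cl cu wl wu dmax m"
  using smoothing_kernel_scaled_mollifier[OF \<phi>] profile_axioms by (intro smoothed_profile.intro)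

lemma radius_in_range: "0 < n \<Longrightarrow> R \<le> Rb \<Longrightarrow> R + 1 / real n < M"
proof -
  assume "0 < n" "R \<le> Rb"
  moreover have "1 / real n \<le> 1" using \<open>0 < n\<close> by simp
  ultimately show ?thesis using Rb by linarith
qed

lemma averages_converge:
  assumes R: "0 < R" "R \<le> Rb" "R \<noteq> a"
  shows "(\<lambda>n. wn n R) \<longlonglongrightarrow> W R" "(\<lambda>n. pn n R) \<longlonglongrightarrow> D R" "(\<lambda>n. qn n R) \<longlonglongrightarrow> W R - R * D R"
proof -
  have "\<forall>\<^sub>F n in sequentially. \<bar>wn n R - W R\<bar> \<le> e \<and> \<bar>pn n R - D R\<bar> \<le> e \<and> \<bar>qn n R - (W R - R * D R)\<bar> \<le> e"
    if e: "0 < e" for e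
  proof -
    have RM: "R < M" using R Rb by simp
    have W: "isCont W R" and D: "isCont D R" using isCont_W isCont_D R RM by auto
    then have lims: "(W \<longlongrightarrow> W R) (nhds R)" "(D \<longlongrightarrow> D R) (nhds R)"
      unfolding continuous_at tendsto_at_iff_tendsto_nhds by auto
    moreover have "((\<lambda>S. W S - S * D S) \<longlongrightarrow> W R - R * D R) (nhds R)"
      by (intro tendsto_diff tendsto_mult lims filterlim_ident)
    ultimately have "\<forall>\<^sub>F S in nhds R. dist (W S) (W R) < e \<and> dist (D S) (D R) < e
        \<and> dist (W S - S * D S) (W R - R * D R) < e"
      by (intro eventually_conj tendstoD[OF _ e])
    then obtain \<delta> where \<delta>: "0 < \<delta>" "\<And>S. dist S R < \<delta> \<Longrightarrow> dist (W S) (W R) < e \<and> dist (D S) (D R) < e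
        \<and> dist (W S - S * D S) (W R - R * D R) < e"
      unfolding eventually_nhds_metric by blast
    have "\<forall>\<^sub>F n in sequentially. 1 / real n < min \<delta> R"
      using lim_1_over_n[THEN order_tendstoD(2), of "min \<delta> R"] \<delta> R by simp
    moreover have "\<forall>\<^sub>F n in sequentially. 0 < n" by (rule eventually_gt_at_top)
    ultimately show ?thesis
    proof eventually_elim
      case (elim n)
      interpret S: smoothed_profile "scaled_mollifier \<phi> n" "scaled_mollifier_deriv \<phi> n" "1 / real n" W D a M cl cu wl wu dmax m
        using smoothed_profile_scaled elim by simp
      have "\<bar>W S - W R\<bar> \<le> e \<and> \<bar>D S - D R\<bar> \<le> e \<and> \<bar>(W S - S * D S) - (W R - R * D R)\<bar> \<le> e"
        if "\<bar>R - S\<bar> \<le> 1 / real n" for S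
        using \<delta>(2)[of S] that elim unfolding dist_real_def by (auto simp: abs_minus_commute)
      then show ?case
        using S.smoothed_approximates[of R e] radius_in_range[of n R] elim R by auto
    qed
  qed
  then have *: "\<forall>\<^sub>F n in sequentially. \<bar>wn n R - W R\<bar> \<le> e / 2 \<and> \<bar>pn n R - D R\<bar> \<le> e / 2
      \<and> \<bar>qn n R - (W R - R * D R)\<bar> \<le> e / 2" if "0 < e" for e
    using that by (simp only: half_gt_zero)
  have "\<forall>\<^sub>F n in sequentially. dist (wn n R) (W R) < e" "\<forall>\<^sub>F n in sequentially. dist (pn n R) (D R) < e"
    "\<forall>\<^sub>F n in sequentially. dist (qn n R) (W R - R * D R) < e" if "0 < e" for e
    using that by (auto simp: dist_real_def intro: eventually_mono[OF *[OF that]])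
  then show "(\<lambda>n. wn n R) \<longlonglongrightarrow> W R" "(\<lambda>n. pn n R) \<longlonglongrightarrow> D R" "(\<lambda>n. qn n R) \<longlonglongrightarrow> W R - R * D R"
    by (blast intro: tendstoI)+
qed

text \<open>Makes the dependence on n explicit with constants independent of n and R: slope and w/R
  are O(n) and v is O(n^(m+1)) everywhere, while beyond 1/n slope and volume are bounded. The lower
  bound c of the volume is uniform on the whole range.\<close>

lemma average_bounds:
  obtains c C1 C2 P Q where "0 < c" "0 < C1" "0 \<le> C2" "0 \<le> P" "0 \<le> Q"
    and "\<And>n R. 0 < n \<Longrightarrow> 0 < R \<Longrightarrow> R \<le> Rb \<Longrightarrow>
      0 \<le> pn n R \<and> 0 < wn n R \<and> wn n R \<le> wu \<and> \<bar>qn n R / t\<bar> \<le> Q \<and>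
      c \<le> pn n R * (wn n R / R) ^ m \<and> pn n R * (wn n R / R) ^ m \<le> (real n * C1) ^ Suc m \<and>
      pn n R \<le> real n * C1 \<and> wn n R / R \<le> real n * C1"
    and "\<And>n R. 0 < n \<Longrightarrow> 1 / real n < R \<Longrightarrow> R \<le> Rb \<Longrightarrow>
      pn n R * (wn n R / R) ^ m \<le> C2 \<and> pn n R \<le> P"
proof -
  obtain \<Phi> \<eta> where \<Phi>: "0 < \<Phi>" "\<And>x. \<phi> x \<le> \<Phi>" "0 < \<eta>" "\<And>x. \<bar>x\<bar> \<le> \<eta> \<Longrightarrow> \<phi> 0 / 2 \<le> \<phi> x"
    using mollifier_bounds[OF \<phi>] by blast
  have \<phi>0: "0 < \<phi> 0" using mollifierD(7)[OF \<phi>] .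
  \<comment> \<open>From \<open>smoothed_volume_ge\<close> with kmin = n \<phi>(0)/2 and \<eta>/n
    for \<eta>: n cancels in the second entry and is estimated by n \<ge> 1 in the first.\<close>
  define c where "c = min ((\<phi> 0 * wl) ^ Suc m) (cl / 2 * (\<phi> 0 * wl * \<eta>) ^ m)"
  define C1 where "C1 = 2 * \<Phi> * wu + dmax"
  define Q where "Q = (wu + M * dmax) / t"
  have pos: "0 < c" "0 < C1" "0 \<le> cu * 2 ^ m * wu ^ m" "0 \<le> cu * (2 * Rb) ^ m" "0 \<le> Q"
    using \<Phi> \<phi>0 constants_pos wu_pos t Rb by (auto simp: c_def C1_def Q_def intro!: add_pos_nonneg add_nonneg_nonneg)
  show thesis
  proof (rule that[OF pos])
    fix n :: nat and R assume n: "0 < n" and RRb: "R \<le> Rb"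
    interpret S: smoothed_profile "scaled_mollifier \<phi> n" "scaled_mollifier_deriv \<phi> n" "1 / real n" W D a M cl cu wl wu dmax m
      using smoothed_profile_scaled n by simp
    have k: "scaled_mollifier \<phi> n x \<le> real n * \<Phi>"
      "\<bar>x\<bar> \<le> \<eta> / real n \<Longrightarrow> real n * \<phi> 0 / 2 \<le> scaled_mollifier \<phi> n x" "0 < \<eta> / real n" "0 < real n * \<phi> 0 / 2" for x
    proof -
      assume "\<bar>x\<bar> \<le> \<eta> / real n"
      then have "\<bar>real n * x\<bar> \<le> \<eta>" using n by (simp add: abs_mult field_simps)
      from \<Phi>(4)[OF this] show "real n * \<phi> 0 / 2 \<le> scaled_mollifier \<phi> n x"
        using n by (simp add: scaled_mollifier_def mult_left_mono)
    qed (use n \<Phi> \<phi>0 in \<open>auto simp: scaled_mollifier_def\<close>)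
    note rr = radius_in_range[OF n RRb]
    have C1n: "2 * (real n * \<Phi>) * wu + dmax \<le> real n * C1"
    proof -
      have "dmax \<le> real n * dmax" using n constants_pos by (simp add: mult_le_cancel_right1)
      then show ?thesis by (simp add: C1_def algebra_simps)
    qed
    show "0 \<le> pn n R \<and> 0 < wn n R \<and> wn n R \<le> wu \<and> \<bar>qn n R / t\<bar> \<le> Q \<and>
      c \<le> pn n R * (wn n R / R) ^ m \<and> pn n R * (wn n R / R) ^ m \<le> (real n * C1) ^ Suc m \<and>
      pn n R \<le> real n * C1 \<and> wn n R / R \<le> real n * C1" if R: "0 < R"
    proof (intro conjI)
      show "0 \<le> pn n R" using S.slope_nonneg rr R by simp
      show "0 < wn n R" using S.smoothed_pos[OF k] rr R by blast
      show "wn n R \<le> wu" using S.abs_smoothed_le[of R] rr R by auto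
      show "\<bar>qn n R / t\<bar> \<le> Q" using S.abs_rate_le[of R] rr R t by (simp add: Q_def divide_right_mono)
      have "c \<le> min ((2 * (real n * \<phi> 0 / 2) * wl) ^ Suc m) (cl / 2 * (2 * (real n * \<phi> 0 / 2) * wl * (\<eta> / real n)) ^ m)"
        unfolding c_def
      proof (rule min.mono)
        have "\<phi> 0 * wl \<le> 2 * (real n * \<phi> 0 / 2) * wl"
          using n \<phi>0 constants_pos by simp
        then show "(\<phi> 0 * wl) ^ Suc m \<le> (2 * (real n * \<phi> 0 / 2) * wl) ^ Suc m"
          using \<phi>0 constants_pos by (intro power_mono) auto
      qed (use n in \<open>simp add: algebra_simps\<close>)
      also have "\<dots> \<le> pn n R * (wn n R / R) ^ m" using S.smoothed_volume_ge[OF k R rr] .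
      finally show "c \<le> pn n R * (wn n R / R) ^ m" .
      have "pn n R * (wn n R / R) ^ m \<le> (2 * (real n * \<Phi>) * wu + dmax) ^ Suc m"
        using S.smoothed_volume_le(1)[OF k R rr] .
      also have "\<dots> \<le> (real n * C1) ^ Suc m"
        using C1n \<Phi> constants_pos wu_pos by (intro power_mono) auto
      finally show "pn n R * (wn n R / R) ^ m \<le> (real n * C1) ^ Suc m" .
      show "pn n R \<le> real n * C1" using S.slope_le_const[OF k less_imp_le[OF R] rr] C1n by linarith
      have "wn n R / R \<le> 2 * (real n * \<Phi>) * wu + dmax"
        using S.smoothed_le[OF k less_imp_le[OF R] rr] R by (simp add: pos_divide_le_eq)
      with C1n show "wn n R / R \<le> real n * C1" by linarith
    qed
    show "pn n R * (wn n R / R) ^ m \<le> cu * 2 ^ m * wu ^ m \<and> pn n R \<le> cu * (2 * Rb) ^ m" if R: "1 / real n < R"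
    proof
      have R0: "0 < R" using R by (smt (verit) divide_nonneg_nonneg of_nat_0_le_iff)
      show "pn n R * (wn n R / R) ^ m \<le> cu * 2 ^ m * wu ^ m"
        using S.smoothed_volume_le(2)[OF k R0 rr R] .
      have "pn n R \<le> cu * (2 * R) ^ m" using S.slope_le_away[OF less_imp_le[OF R0] rr R] .
      also have "\<dots> \<le> cu * (2 * Rb) ^ m"
        using R0 RRb constants_pos by (intro mult_left_mono power_mono) auto
      finally show "pn n R \<le> cu * (2 * Rb) ^ m" .
    qed
  qed
qed

end

section \<open>Domination and convergence of the averaged densities\<close>

context mollified_profile
begin

lemma continuous_averaged_density:
  assumes h: "continuous_on {0<..} h" and n: "0 < n"
  shows "continuous_on {0<..<Rb} (\<lambda>R. R ^ m * averaged_density \<phi> h (Suc m) t M W n R)"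
proof -
  interpret S: smoothed_profile "scaled_mollifier \<phi> n" "scaled_mollifier_deriv \<phi> n" "1 / real n" W D a M cl cu wl wu dmax m
    using smoothed_profile_scaled n by simp
  obtain c where c: "0 < c" "\<And>R. 0 < R \<Longrightarrow> R \<le> Rb \<Longrightarrow> c \<le> pn n R * (wn n R / R) ^ m"
    using average_bounds n by metis
  have z: "continuous_on {0<..<Rb} (\<lambda>R. wn n R / R)"
    by (intro continuous_on_divide S.continuous_smoothed continuous_on_id) auto
  have v: "continuous_on {0<..<Rb} (\<lambda>R. pn n R * (wn n R / R) ^ m)"
    by (intro continuous_on_mult continuous_on_power S.continuous_slope z)
  have "continuous_on {0<..<Rb} (\<lambda>R. h (pn n R * (wn n R / R) ^ m))"
    by (rule continuous_on_compose2[OF h v]) (use c in force)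
  then show ?thesis
    unfolding averaged_density_def radial_density_def diff_Suc_1
    by (intro continuous_on_add continuous_on_mult continuous_on_power continuous_on_const continuous_on_id
        continuous_on_divide S.continuous_rate S.continuous_slope z) (use t in auto)
qed

text \<open>On an interval of length 1/n this bound integrates to \<epsilon> + K/n. The kinetic and
  stretch energies are O(n^2) and are absorbed into K by R^m \<le> n^(-m), as m \<ge> 2.\<close>

lemma density_bound_near:
  assumes k: "continuous_on {0<..} k" "((\<lambda>v. k v / v) \<longlongrightarrow> 0) at_top" and \<epsilon>: "0 < \<epsilon>"
  obtains K where "0 \<le> K"
    "\<And>n R. 0 < n \<Longrightarrow> 0 < R \<Longrightarrow> R \<le> Rb \<Longrightarrow> R \<le> 1 / real n \<Longrightarrow>
      \<bar>R ^ m * averaged_density \<phi> k (Suc m) t M W n R\<bar> \<le> \<epsilon> * real n + K"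
proof -
  obtain c C1 C2 P Q where c: "0 < c" "0 < C1" "0 \<le> Q"
    and b: "\<And>n R. 0 < n \<Longrightarrow> 0 < R \<Longrightarrow> R \<le> Rb \<Longrightarrow>
      0 \<le> pn n R \<and> 0 < wn n R \<and> wn n R \<le> wu \<and> \<bar>qn n R / t\<bar> \<le> Q \<and>
      c \<le> pn n R * (wn n R / R) ^ m \<and> pn n R * (wn n R / R) ^ m \<le> (real n * C1) ^ Suc m \<and>
      pn n R \<le> real n * C1 \<and> wn n R / R \<le> real n * C1"
    by (rule average_bounds) blast
  \<comment> \<open>Chosen so that n^(-m) times \<epsilon>' (n C1)^(m+1) is exactly \<epsilon>
    n.\<close>
  define \<epsilon>' where "\<epsilon>' = \<epsilon> / C1 ^ Suc m"
  have \<epsilon>': "0 < \<epsilon>'" using \<epsilon> c by (simp add: \<epsilon>'_def)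
  obtain C where C: "0 \<le> C" "\<And>v. c \<le> v \<Longrightarrow> \<bar>k v\<bar> \<le> \<epsilon>' * v + C"
    using sublinear_bound[OF k c(1) \<epsilon>'] by blast
  define K where "K = 1/2 * Q\<^sup>2 + C + 1/2 * (1 + real m) * C1\<^sup>2"
  show thesis
  proof (rule that[of K])
    show "0 \<le> K" using C(1) by (simp add: K_def)
    fix n R assume n: "0 < n" and R: "0 < R" "R \<le> Rb" "R \<le> 1 / real n"
    let ?v = "pn n R * (wn n R / R) ^ m" and ?n = "real n"
    note b = b[OF n R(1,2)]
    have "\<bar>k ?v\<bar> \<le> \<epsilon>' * (?n * C1) ^ Suc m + C"
      using C(2)[of ?v] b mult_left_mono[of ?v "(?n * C1) ^ Suc m" \<epsilon>'] \<epsilon>' by linarith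
    then have "\<bar>averaged_density \<phi> k (Suc m) t M W n R\<bar>
        \<le> 1/2 * Q\<^sup>2 + 1/2 * ((?n * C1)\<^sup>2 + (real (Suc m) - 1) * (?n * C1)\<^sup>2) + (\<epsilon>' * (?n * C1) ^ Suc m + C)"
      unfolding averaged_density_def using b R by (intro abs_radial_density_le) auto
    then have "R ^ m * \<bar>averaged_density \<phi> k (Suc m) t M W n R\<bar>
        \<le> (1 / ?n) ^ m * (1/2 * Q\<^sup>2 + 1/2 * ((?n * C1)\<^sup>2 + (real (Suc m) - 1) * (?n * C1)\<^sup>2) + (\<epsilon>' * (?n * C1) ^ Suc m + C))"
      using R by (intro mult_mono power_mono) auto
    also have "\<dots> = (1 / ?n) ^ m * (1/2 * Q\<^sup>2 + C) + ((1 / ?n) ^ m * ?n\<^sup>2) * (1/2 * (1 + real m) * C1\<^sup>2)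
        + ((1 / ?n) ^ m * ?n ^ Suc m) * (\<epsilon>' * C1 ^ Suc m)"
      by (simp add: power_mult_distrib algebra_simps del: power_Suc power_divide)
    also have "(1 / ?n) ^ m * ?n ^ Suc m = ?n" using n by (simp add: power_divide)
    also have "\<epsilon>' * C1 ^ Suc m = \<epsilon>" using c by (simp add: \<epsilon>'_def)
    also have "(1 / ?n) ^ m * (1/2 * Q\<^sup>2 + C) + ((1 / ?n) ^ m * ?n\<^sup>2) * (1/2 * (1 + real m) * C1\<^sup>2) + ?n * \<epsilon>
        \<le> 1 * (1/2 * Q\<^sup>2 + C) + 1 * (1/2 * (1 + real m) * C1\<^sup>2) + ?n * \<epsilon>"
    proof (intro add_mono mult_right_mono order_refl)
      show "(1 / ?n) ^ m \<le> 1" using n by (intro power_le_one) auto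
      have "?n\<^sup>2 \<le> ?n ^ m" using n m2 by (intro power_increasing) auto
      then show "(1 / ?n) ^ m * ?n\<^sup>2 \<le> 1" using n by (simp add: power_divide)
    qed (use C(1) \<epsilon> in auto)
    finally show "\<bar>R ^ m * averaged_density \<phi> k (Suc m) t M W n R\<bar> \<le> \<epsilon> * ?n + K"
      using R by (simp add: abs_mult K_def mult.commute)
  qed
qed

text \<open>As the volumes are bounded here, the growth rate 1 is good enough. The circumferential
  term R^m (wu/R)^2 stays bounded because m \<ge> 2.\<close>

lemma density_bound_far:
  assumes k: "continuous_on {0<..} k" "((\<lambda>v. k v / v) \<longlongrightarrow> 0) at_top"
  obtains K where "0 \<le> K"
    "\<And>n R. 0 < n \<Longrightarrow> 1 / real n < R \<Longrightarrow> R \<le> Rb \<Longrightarrow>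
      \<bar>R ^ m * averaged_density \<phi> k (Suc m) t M W n R\<bar> \<le> K"
proof -
  obtain c C1 C2 P Q where c: "0 < c" "0 \<le> C2"
    and b: "\<And>n R. 0 < n \<Longrightarrow> 0 < R \<Longrightarrow> R \<le> Rb \<Longrightarrow>
      0 \<le> pn n R \<and> 0 < wn n R \<and> wn n R \<le> wu \<and> \<bar>qn n R / t\<bar> \<le> Q \<and>
      c \<le> pn n R * (wn n R / R) ^ m \<and> pn n R * (wn n R / R) ^ m \<le> (real n * C1) ^ Suc m \<and>
      pn n R \<le> real n * C1 \<and> wn n R / R \<le> real n * C1"
    and b': "\<And>n R. 0 < n \<Longrightarrow> 1 / real n < R \<Longrightarrow> R \<le> Rb \<Longrightarrow>
      pn n R * (wn n R / R) ^ m \<le> C2 \<and> pn n R \<le> P"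
    by (rule average_bounds) blast
  obtain C where C: "0 \<le> C" "\<And>v. c \<le> v \<Longrightarrow> \<bar>k v\<bar> \<le> 1 * v + C"
    using sublinear_bound[OF k c(1) zero_less_one] by blast
  define K where "K = Rb ^ m * (1/2 * Q\<^sup>2 + 1/2 * P\<^sup>2 + (C2 + C)) + Rb ^ (m - 2) * (1/2 * real m * wu\<^sup>2)"
  show thesis
  proof (rule that[of K])
    show "0 \<le> K" using C(1) c Rb by (simp add: K_def)
    fix n R assume n: "0 < n" and R: "1 / real n < R" "R \<le> Rb"
    have R0: "0 < R" using R(1) n by (meson less_trans of_nat_0_less_iff zero_less_divide_1_iff)
    let ?v = "pn n R * (wn n R / R) ^ m"
    note b = b[OF n R0 R(2)] b'[OF n R]
    have "\<bar>k ?v\<bar> \<le> C2 + C" using C(2)[of ?v] b by linarith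
    then have "\<bar>averaged_density \<phi> k (Suc m) t M W n R\<bar>
        \<le> 1/2 * Q\<^sup>2 + 1/2 * (P\<^sup>2 + (real (Suc m) - 1) * (wu / R)\<^sup>2) + (C2 + C)"
      unfolding averaged_density_def using b R0
      by (intro abs_radial_density_le) (auto intro: divide_right_mono)
    then have "R ^ m * \<bar>averaged_density \<phi> k (Suc m) t M W n R\<bar>
        \<le> R ^ m * (1/2 * Q\<^sup>2 + 1/2 * (P\<^sup>2 + (real (Suc m) - 1) * (wu / R)\<^sup>2) + (C2 + C))"
      using R0 by (intro mult_left_mono) auto
    also have "\<dots> = R ^ m * (1/2 * Q\<^sup>2 + 1/2 * P\<^sup>2 + (C2 + C)) + (R ^ m / R\<^sup>2) * (1/2 * real m * wu\<^sup>2)"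
      by (simp add: algebra_simps power_divide)
    also have "R ^ m / R\<^sup>2 = R ^ (m - 2)" using R0 m2 by (simp add: power_diff)
    also have "R ^ m * (1/2 * Q\<^sup>2 + 1/2 * P\<^sup>2 + (C2 + C)) + R ^ (m - 2) * (1/2 * real m * wu\<^sup>2) \<le> K"
      unfolding K_def using R R0 C(1) c by (intro add_mono mult_right_mono power_mono) auto
    finally show "\<bar>R ^ m * averaged_density \<phi> k (Suc m) t M W n R\<bar> \<le> K" using R0 by (simp add: abs_mult)
  qed
qed

lemma density_converges:
  assumes h: "continuous_on {0<..} h" and R: "0 < R" "R \<le> Rb" "R \<noteq> a"
  shows "(\<lambda>n. averaged_density \<phi> h (Suc m) t M W n R) \<longlonglongrightarrow> limit_density h (Suc m) t W D R"
proof -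
  have "R \<in> {0..M}" using R Rb by auto
  then have "0 < W R" "0 < D R"
    using W_bounds[of R] D_bounds[of R] constants_pos R by (smt (verit) mult_pos_pos zero_less_power)+
  then have "0 < D R * (W R / R) ^ m" using R by simp
  then have "isCont h (D R * (W R / R) ^ m)"
    using h by (simp add: continuous_on_eq_continuous_at)
  moreover have "(\<lambda>n. pn n R * (wn n R / R) ^ m) \<longlonglongrightarrow> D R * (W R / R) ^ m"
    using R by (intro tendsto_intros averages_converge) auto
  ultimately have "(\<lambda>n. h (pn n R * (wn n R / R) ^ m)) \<longlonglongrightarrow> h (D R * (W R / R) ^ m)"
    by (rule isCont_tendsto_compose)
  then show ?thesis
    unfolding averaged_density_def limit_density_def radial_density_def diff_Suc_1
    using R t by (intro tendsto_intros averages_converge) auto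
qed

lemma continuous_limit_density:
  assumes h: "continuous_on {0<..} h"
  shows "continuous_on ({0<..<Rb} - {a}) (\<lambda>R. R ^ m * limit_density h (Suc m) t W D R)"
proof -
  have "isCont (\<lambda>R. R ^ m * limit_density h (Suc m) t W D R) R" if R: "0 < R" "R < Rb" "R \<noteq> a" for R
  proof -
    have "R \<in> {0..M}" using R Rb by auto
    then have "0 < W R" "0 < D R"
      using W_bounds[of R] D_bounds[of R] constants_pos R by (smt (verit) mult_pos_pos zero_less_power)+
    then have "0 < D R * (W R / R) ^ m" using R by simp
    then have h': "isCont h (D R * (W R / R) ^ m)"
      using h by (simp add: continuous_on_eq_continuous_at)
    have WD: "isCont W R" "isCont D R" using isCont_W isCont_D R Rb by auto
    have z: "isCont (\<lambda>R. W R / R) R" by (rule isCont_divide[OF WD(1) continuous_ident]) (use R in auto)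
    have "isCont (\<lambda>R. D R * (W R / R) ^ m) R" by (intro isCont_mult isCont_power z WD)
    then have "isCont (\<lambda>R. h (D R * (W R / R) ^ m)) R"
      by (rule isCont_o2[where g = h]) (rule h')
    then show ?thesis
      unfolding limit_density_def radial_density_def diff_Suc_1
      using t by (intro isCont_add isCont_mult isCont_power isCont_diff isCont_divide continuous_ident continuous_const z WD) auto
  qed
  then show ?thesis by (intro continuous_at_imp_continuous_on) auto
qed


lemma sublinear_density_limit:
  assumes k: "continuous_on {0<..} k" "((\<lambda>v. k v / v) \<longlongrightarrow> 0) at_top"
  defines "f \<equiv> \<lambda>n R. R ^ m * averaged_density \<phi> k (Suc m) t M W n R"
    and "g \<equiv> \<lambda>R. R ^ m * limit_density k (Suc m) t W D R"
  shows "0 < n \<Longrightarrow> set_integrable lborel {0<..<Rb} (f n)"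
    and "set_integrable lborel ({0<..<Rb} - {a}) g"
    and "(\<lambda>n. LINT R:{0<..<Rb}|lborel. f n R) \<longlonglongrightarrow> (LINT R:{0<..<Rb} - {a}|lborel. g R)"
proof -
  obtain K where K: "0 \<le> K" "\<And>n R. 0 < n \<Longrightarrow> 1 / real n < R \<Longrightarrow> R \<le> Rb \<Longrightarrow> \<bar>f n R\<bar> \<le> K"
    using density_bound_far[OF k] unfolding f_def by blast
  have meas: "(\<lambda>R. indicator {0<..<Rb} R * f n R) \<in> borel_measurable borel" if "0 < n" for n
    using borel_measurable_continuous_on_indicator[OF _ continuous_averaged_density[OF k(1) that]]
    by (simp add: f_def)
  have measg: "(\<lambda>R. indicator ({0<..<Rb} - {a}) R * g R) \<in> borel_measurable borel"
    using borel_measurable_continuous_on_indicator[OF _ continuous_limit_density[OF k(1)]]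
    by (simp add: g_def)
  have const: "integrable lborel (\<lambda>R. indicator {0<..<Rb} R * c)" for c :: real
    using Rb by (intro integrable_mult_left integrable_real_indicator) auto
  show int: "set_integrable lborel {0<..<Rb} (f n)" if n: "0 < n" for n
  proof -
    obtain K1 where K1: "0 \<le> K1" "\<And>R. 0 < R \<Longrightarrow> R \<le> Rb \<Longrightarrow> R \<le> 1 / real n \<Longrightarrow> \<bar>f n R\<bar> \<le> 1 * real n + K1"
      using density_bound_near[OF k zero_less_one] n unfolding f_def by metis
    show ?thesis
      unfolding set_integrable_def real_scaleR_def
    proof (rule Bochner_Integration.integrable_bound[OF const[of "K + (1 * real n + K1)"]])
      show "AE R in lborel. norm (indicator {0<..<Rb} R * f n R) \<le> norm (indicator {0<..<Rb} R * (K + (1 * real n + K1)))"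
      proof (rule AE_I2)
        fix R
        show "norm (indicator {0<..<Rb} R * f n R) \<le> norm (indicator {0<..<Rb} R * (K + (1 * real n + K1)))"
          using K(1) K(2)[OF n, of R] K1(1) K1(2)[of R]
          by (cases "R \<le> 1 / real n") (auto simp: indicator_def abs_mult)
      qed
    qed (use meas[OF n] in simp)
  qed
  \<comment> \<open>The cut at 1/n: a fixed R > 0 eventually belongs to \<open>A\<close>, so
    \<open>A\<close> carries the pointwise limit under a constant bound, and \<open>B\<close>
    carries the concentration at the origin.\<close>
  define A where "A = (\<lambda>n R. indicator {1 / real n<..} R * (indicator {0<..<Rb} R * f n R))"
  define B where "B = (\<lambda>n R. indicator {..1 / real n} R * (indicator {0<..<Rb} R * f n R))"
  \<comment> \<open>The index is shifted because the kernel scaled by n = 0 is identically zero and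
    the estimates start at n = 1.\<close>
  have measA: "A (Suc n) \<in> borel_measurable lborel" for n
    unfolding A_def using meas[of "Suc n"] by measurable
  have AB: "A n R + B n R = indicator {0<..<Rb} R * f n R" for n R
    by (auto simp: A_def B_def indicator_def)
  have bound: "AE R in lborel. norm (A (Suc n) R) \<le> indicator {0<..<Rb} R * K" for n
    using K by (intro AE_I2) (auto simp: A_def indicator_def)
  have conv: "AE R in lborel. (\<lambda>n. A (Suc n) R) \<longlonglongrightarrow> indicator ({0<..<Rb} - {a}) R * g R"
    using AE_lborel_singleton[of a]
  proof eventually_elim
    case (elim R)
    show ?case
    proof (cases "R \<in> {0<..<Rb}")
      case True
      then have "(\<lambda>n. f n R) \<longlonglongrightarrow> g R"
        unfolding f_def g_def using elim by (intro tendsto_intros density_converges[OF k(1)]) auto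
      moreover have "\<forall>\<^sub>F n in sequentially. f n R = A n R"
        using order_tendstoD(2)[OF lim_1_over_n, of R] True
        by (auto elim!: eventually_mono simp: A_def)
      ultimately have "(\<lambda>n. A n R) \<longlonglongrightarrow> g R" by (rule Lim_transform_eventually)
      then show ?thesis using True elim LIMSEQ_Suc by simp
    qed (auto simp: A_def indicator_def)
  qed
  have "integrable lborel (\<lambda>R. indicator ({0<..<Rb} - {a}) R * g R)"
    by (rule integrable_dominated_convergence[where s = "\<lambda>n. A (Suc n)" and w = "\<lambda>R. indicator {0<..<Rb} R * K"])
       (use measg measA const[of K] conv bound in auto)
  then show "set_integrable lborel ({0<..<Rb} - {a}) g" by (simp add: set_integrable_def)
  have limA: "(\<lambda>n. LINT R|lborel. A (Suc n) R) \<longlonglongrightarrow> (LINT R|lborel. indicator ({0<..<Rb} - {a}) R * g R)"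
    by (rule integral_dominated_convergence[where w = "\<lambda>R. indicator {0<..<Rb} R * K"])
       (use measg measA const[of K] conv bound in auto)
  have intA: "integrable lborel (A (Suc n))" for n
    by (rule integrable_dominated_convergence2[where s = "\<lambda>n. A (Suc n)" and w = "\<lambda>R. indicator {0<..<Rb} R * K"])
       (use measg measA const[of K] conv bound in auto)
  have intB: "integrable lborel (B (Suc n))" for n
  proof -
    have "integrable lborel (\<lambda>R. indicator {0<..<Rb} R * f (Suc n) R - A (Suc n) R)"
      using int[of "Suc n"] intA[of n] unfolding set_integrable_def by auto
    moreover have "(\<lambda>R. indicator {0<..<Rb} R * f (Suc n) R - A (Suc n) R) = B (Suc n)"
      using AB by (simp add: fun_eq_iff algebra_simps)
    ultimately show ?thesis by simp
  qed
  have limB: "(\<lambda>n. LINT R|lborel. B (Suc n) R) \<longlonglongrightarrow> 0"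
  proof (rule LIMSEQ_I)
    fix e :: real assume e: "0 < e"
    then have "0 < e / 2" by simp
    \<comment> \<open>K1 depends on the growth rate e/2 but not on n, so the part K1/n of the
      integrated bound can be made small afterwards.\<close>
    then obtain K1 where K1: "0 \<le> K1" "\<And>n R. 0 < n \<Longrightarrow> 0 < R \<Longrightarrow> R \<le> Rb \<Longrightarrow> R \<le> 1 / real n \<Longrightarrow>
        \<bar>f n R\<bar> \<le> e / 2 * real n + K1"
      using density_bound_near[OF k] unfolding f_def by metis
    have B: "\<bar>LINT R|lborel. B (Suc n) R\<bar> \<le> e / 2 + K1 / real (Suc n)" for n
    proof -
      let ?n = "real (Suc n)"
      have *: "integrable lborel (\<lambda>R. indicator {0..1 / ?n} R * (e / 2 * ?n + K1))"
        by (intro integrable_mult_left integrable_real_indicator) auto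
      have "\<bar>LINT R|lborel. B (Suc n) R\<bar> \<le> (LINT R|lborel. \<bar>B (Suc n) R\<bar>)"
        by (rule integral_abs_bound)
      also have "\<dots> \<le> (LINT R|lborel. indicator {0..1 / ?n} R * (e / 2 * ?n + K1))"
      proof (rule integral_mono[OF _ *])
        show "\<bar>B (Suc n) R\<bar> \<le> indicator {0..1 / ?n} R * (e / 2 * ?n + K1)" for R
          using K1(1) K1(2)[of "Suc n" R] e by (auto simp: B_def indicator_def)
      qed (use intB in simp)
      also have "\<dots> = 1 / ?n * (e / 2 * ?n + K1)" by simp
      also have "\<dots> = e / 2 + K1 / ?n" by (simp add: distrib_left del: of_nat_Suc)
      finally show ?thesis .
    qed
    obtain N where N: "2 * K1 / e < real N" using reals_Archimedean2 by blast
    have "norm ((LINT R|lborel. B (Suc n) R) - 0) < e" if "N \<le> n" for n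
    proof -
      have "2 * K1 / e < real (Suc n)" using N that by simp
      then have "K1 / real (Suc n) < e / 2" using e by (simp add: field_simps)
      with B[of n] have "\<bar>LINT R|lborel. B (Suc n) R\<bar> < e" by linarith
      then show ?thesis by simp
    qed
    then show "\<exists>no. \<forall>n\<ge>no. norm ((LINT R|lborel. B (Suc n) R) - 0) < e" by blast
  qed
  have "(LINT R:{0<..<Rb}|lborel. f (Suc n) R) = (LINT R|lborel. A (Suc n) R) + (LINT R|lborel. B (Suc n) R)" for n
    unfolding Bochner_Integration.integral_add[OF intA intB, symmetric] AB by (simp add: set_lebesgue_integral_def)
  then have "(\<lambda>n. LINT R:{0<..<Rb}|lborel. f (Suc n) R) \<longlonglongrightarrow> (LINT R:{0<..<Rb} - {a}|lborel. g R)"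
    using tendsto_add[OF limA limB] by (simp add: set_lebesgue_integral_def)
  then show "(\<lambda>n. LINT R:{0<..<Rb}|lborel. f n R) \<longlonglongrightarrow> (LINT R:{0<..<Rb} - {a}|lborel. g R)"
    by (rule LIMSEQ_imp_Suc)
qed

text \<open>
  The linear part \<open>L v\<close> of the energy is a null Lagrangian: \<open>R\<^sup>m v = (w\<^sup>m\<^sup>+\<^sup>1)\<^sub>R / (m + 1)\<close>. The averages
  vanish at the origin while the limit does not, which produces the surface term.
\<close>

lemma averaged_density_limit:
  assumes h: "continuous_on {0<..} h" "((\<lambda>v. h v / v) \<longlongrightarrow> L) at_top"
  shows "0 < n \<Longrightarrow> set_integrable lborel {0<..<Rb} (\<lambda>R. R ^ m * averaged_density \<phi> h (Suc m) t M W n R)"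
    and "((\<lambda>R. R ^ m * limit_density h (Suc m) t W D R) has_integral I) {0..Rb} \<Longrightarrow> Rb \<noteq> a \<Longrightarrow>
      (\<lambda>n. LINT R:{0<..<Rb}|lborel. R ^ m * averaged_density \<phi> h (Suc m) t M W n R)
        \<longlonglongrightarrow> I + L * W 0 ^ Suc m / real (Suc m)"
proof -
  define k where "k v = h v - L * v" for v
  have kc: "continuous_on {0<..} k" unfolding k_def by (intro continuous_intros h)
  have "((\<lambda>v. h v / v - L) \<longlongrightarrow> L - L) at_top" by (intro tendsto_intros h)
  moreover have "\<forall>\<^sub>F v in at_top. h v / v - L = k v / v"
    using eventually_gt_at_top[of 0] by eventually_elim (simp add: k_def field_simps)
  ultimately have kl: "((\<lambda>v. k v / v) \<longlongrightarrow> 0) at_top"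
    using Lim_transform_eventually by fastforce
  note k = sublinear_density_limit[OF kc kl]
  have split: "R ^ m * averaged_density \<phi> h (Suc m) t M W n R
      = R ^ m * averaged_density \<phi> k (Suc m) t M W n R + L * (pn n R * wn n R ^ m)" if "0 < R" for R n
    unfolding averaged_density_def radial_density_split[of "Suc m" h _ _ _ L] k_def[symmetric] using that
    by (simp add: power_divide algebra_simps)
  have FTC:
    "((\<lambda>R. L * (pn n R * wn n R ^ m)) has_integral L * wn n Rb ^ Suc m / real (Suc m)) {0..Rb}" if n: "0 < n" for n
  proof -
    interpret S: smoothed_profile "scaled_mollifier \<phi> n" "scaled_mollifier_deriv \<phi> n" "1 / real n" W D a M cl cu wl wu dmax m
      using smoothed_profile_scaled n by simp
    have "((\<lambda>R. L * (pn n R * wn n R ^ m)) has_integral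
        L * wn n Rb ^ Suc m / real (Suc m) - L * wn n 0 ^ Suc m / real (Suc m)) {0..Rb}"
    proof (rule fundamental_theorem_of_calculus)
      show "((\<lambda>R. L * wn n R ^ Suc m / real (Suc m)) has_vector_derivative L * (pn n R * wn n R ^ m)) (at R within {0..Rb})" for R
        unfolding has_real_derivative_iff_has_vector_derivative[symmetric]
        by (rule has_field_derivative_at_within, rule DERIV_cong,
            rule DERIV_cdivide[OF DERIV_cmult[OF DERIV_power[OF S.deriv_smoothed]]]) (simp del: of_nat_Suc)
    qed (use Rb in simp)
    then show "((\<lambda>R. L * (pn n R * wn n R ^ m)) has_integral L * wn n Rb ^ Suc m / real (Suc m)) {0..Rb}"
      by (simp add: S.smoothed_0)
  qed
  have sub: "set_integrable lborel {0<..<Rb} (\<lambda>R. L * (pn n R * wn n R ^ m))"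
    "(LINT R:{0<..<Rb}|lborel. L * (pn n R * wn n R ^ m)) = L * wn n Rb ^ Suc m / real (Suc m)" if n: "0 < n" for n
  proof -
    interpret S: smoothed_profile "scaled_mollifier \<phi> n" "scaled_mollifier_deriv \<phi> n" "1 / real n" W D a M cl cu wl wu dmax m
      using smoothed_profile_scaled n by simp
    have "set_integrable lborel {0..Rb} (\<lambda>R. L * (pn n R * wn n R ^ m))"
      by (intro borel_integrable_atLeastAtMost' continuous_intros S.continuous_slope S.continuous_smoothed)
    then show int: "set_integrable lborel {0<..<Rb} (\<lambda>R. L * (pn n R * wn n R ^ m))"
      by (rule set_integrable_subset) auto
    have "((\<lambda>R. L * (pn n R * wn n R ^ m)) has_integral L * wn n Rb ^ Suc m / real (Suc m)) {0<..<Rb}"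
      using FTC[OF n] by (simp add: has_integral_Icc_iff_Ioo)
    then show "(LINT R:{0<..<Rb}|lborel. L * (pn n R * wn n R ^ m)) = L * wn n Rb ^ Suc m / real (Suc m)"
      unfolding set_borel_integral_eq_integral(2)[OF int] by (rule integral_unique)
  qed
  show int: "set_integrable lborel {0<..<Rb} (\<lambda>R. R ^ m * averaged_density \<phi> h (Suc m) t M W n R)" if n: "0 < n" for n
    using set_integral_add(1)[OF k(1)[OF n] sub(1)[OF n]]
    by (rule set_integrable_cong[THEN iffD1, rotated -1]) (auto simp: split)
  assume I: "((\<lambda>R. R ^ m * limit_density h (Suc m) t W D R) has_integral I) {0..Rb}" and Rba: "Rb \<noteq> a"
  have "(LINT R:{0<..<Rb}|lborel. R ^ m * averaged_density \<phi> h (Suc m) t M W n R)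
      = (LINT R:{0<..<Rb}|lborel. R ^ m * averaged_density \<phi> k (Suc m) t M W n R) + L * wn n Rb ^ Suc m / real (Suc m)"
    if n: "0 < n" for n
  proof -
    have "(LINT R:{0<..<Rb}|lborel. R ^ m * averaged_density \<phi> h (Suc m) t M W n R)
      = (LINT R:{0<..<Rb}|lborel. R ^ m * averaged_density \<phi> k (Suc m) t M W n R + L * (pn n R * wn n R ^ m))"
      by (rule set_lebesgue_integral_cong) (auto simp: split)
    then show ?thesis using set_integral_add(2)[OF k(1)[OF n] sub(1)[OF n]] sub(2)[OF n] by simp
  qed
  then have ev: "\<forall>\<^sub>F n in sequentially.
      (LINT R:{0<..<Rb}|lborel. R ^ m * averaged_density \<phi> k (Suc m) t M W n R) + L * wn n Rb ^ Suc m / real (Suc m)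
      = (LINT R:{0<..<Rb}|lborel. R ^ m * averaged_density \<phi> h (Suc m) t M W n R)"
    by (intro eventually_mono[OF eventually_gt_at_top[of 0]]) (rule sym)
  \<comment> \<open>The same primitive for the limit profile, which is only continuous at the shock;
    now the value at 0 does not vanish.\<close>
  have "((\<lambda>R. L * (D R * W R ^ m)) has_integral L * W Rb ^ Suc m / real (Suc m) - L * W 0 ^ Suc m / real (Suc m)) {0..Rb}"
  proof (rule fundamental_theorem_of_calculus_interior_strong[of "{a}"])
    show "((\<lambda>R. L * W R ^ Suc m / real (Suc m)) has_vector_derivative L * (D R * W R ^ m)) (at R)"
      if "R \<in> {0<..<Rb} - {a}" for R
      unfolding has_real_derivative_iff_has_vector_derivative[symmetric] using that Rb
      by (intro DERIV_cong[OF DERIV_cdivide[OF DERIV_cmult[OF DERIV_power[OF deriv_W]]]]) (auto simp del: of_nat_Suc)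
    show "continuous_on {0..Rb} (\<lambda>R. L * W R ^ Suc m / real (Suc m))"
      using Rb by (intro continuous_intros continuous_on_subset[OF continuous_W]) auto
  qed (use Rb in auto)
  from has_integral_diff[OF I this]
  have "((\<lambda>R. R ^ m * limit_density k (Suc m) t W D R) has_integral
      I - (L * W Rb ^ Suc m / real (Suc m) - L * W 0 ^ Suc m / real (Suc m))) {0..Rb}"
  proof (rule has_integral_spike_finite[of "{0}", rotated 2])
    fix R assume "R \<in> {0..Rb} - {0}"
    then show "R ^ m * limit_density k (Suc m) t W D R
        = R ^ m * limit_density h (Suc m) t W D R - L * (D R * W R ^ m)"
      unfolding limit_density_def radial_density_split[of "Suc m" h _ _ _ L] k_def[symmetric]
      by (simp add: power_divide algebra_simps)
  qed simp
  then have "((\<lambda>R. R ^ m * limit_density k (Suc m) t W D R) has_integral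
      I - (L * W Rb ^ Suc m / real (Suc m) - L * W 0 ^ Suc m / real (Suc m))) ({0<..<Rb} - {a})"
    by (rule has_integral_spike_set_eq[THEN iffD1, rotated 2]) (rule negligible_subset[of "{0, a, Rb}"]; auto)+
  then have "(LINT R:{0<..<Rb} - {a}|lborel. R ^ m * limit_density k (Suc m) t W D R)
      = I - (L * W Rb ^ Suc m / real (Suc m) - L * W 0 ^ Suc m / real (Suc m))"
    using set_borel_integral_eq_integral(2)[OF k(2)] by (simp add: integral_unique)
  note lim = k(3)[unfolded this]
  \<comment> \<open>The boundary terms at the outer radius cancel in the limit. This takes pointwise
    convergence at Rb, which is where \<open>Rb \<noteq> a\<close> enters.\<close>
  have "(\<lambda>n. L * wn n Rb ^ Suc m / real (Suc m)) \<longlonglongrightarrow> L * W Rb ^ Suc m / real (Suc m)"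
    by (intro tendsto_intros averages_converge) (use Rb Rba in auto)
  from tendsto_add[OF lim this] ev
  have "(\<lambda>n. LINT R:{0<..<Rb}|lborel. R ^ m * averaged_density \<phi> h (Suc m) t M W n R) \<longlonglongrightarrow>
     I - (L * W Rb ^ Suc m / real (Suc m) - L * W 0 ^ Suc m / real (Suc m)) + L * W Rb ^ Suc m / real (Suc m)"
    by (rule Lim_transform_eventually)
  then show "(\<lambda>n. LINT R:{0<..<Rb}|lborel. R ^ m * averaged_density \<phi> h (Suc m) t M W n R)
        \<longlonglongrightarrow> I + L * W 0 ^ Suc m / real (Suc m)"
    by (simp add: algebra_simps)
qed

end

section \<open>Energy of radial deformations\<close>

lemma jacobian_radial_deformation:
  fixes x :: "real^'n"
  assumes x: "x \<noteq> 0" and w: "((\<lambda>R. w R t) has_real_derivative p) (at (norm x))"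
  shows "jacobian (\<lambda>z. radial_deformation w z t) (at x) = radial_gradient p (w (norm x) t / norm x) (x /\<^sub>R norm x)"
proof -
  let ?u = "x /\<^sub>R norm x" and ?b = "w (norm x) t / norm x"
  have n: "norm x \<noteq> 0" using x by simp
  have nd: "(norm has_derivative (\<lambda>\<xi>. \<xi> \<bullet> sgn x)) (at x)" by (rule has_derivative_norm[OF x])
  have "((\<lambda>R. w R t / R) has_real_derivative (p - ?b) / norm x) (at (norm x))"
    using n by (intro DERIV_cong[OF DERIV_divide[OF w DERIV_ident n]]) (simp add: field_simps)
  then have "((\<lambda>R. w R t / R) has_derivative (\<lambda>s. (p - ?b) / norm x * s)) (at (norm x))"
    by (simp only: has_field_derivative_def)
  from has_derivative_compose[OF nd this]
  have "((\<lambda>z. (w (norm z) t / norm z) *\<^sub>R z) has_derivative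
      (\<lambda>\<xi>. ?b *\<^sub>R \<xi> + ((p - ?b) / norm x * (\<xi> \<bullet> sgn x)) *\<^sub>R x)) (at x)"
    by (rule has_derivative_scaleR) (rule has_derivative_ident)
  moreover have "(\<lambda>\<xi>. ?b *\<^sub>R \<xi> + ((p - ?b) / norm x * (\<xi> \<bullet> sgn x)) *\<^sub>R x) = (\<lambda>\<xi>. radial_gradient p ?b ?u *v \<xi>)"
    unfolding radial_gradient_mult_vec sgn_div_norm by (simp add: fun_eq_iff inner_commute field_simps)
  moreover have "(\<lambda>z :: real^'n. (w (norm z) t / norm z) *\<^sub>R z) = (\<lambda>z. radial_deformation w z t)"
    by (simp add: fun_eq_iff radial_deformation_def divide_inverse)
  ultimately have "((\<lambda>z. radial_deformation w z t) has_derivative (\<lambda>\<xi>. radial_gradient p ?b ?u *v \<xi>)) (at x)"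
    by (simp only:)
  from frechet_derivative_at[OF this, symmetric] show ?thesis by (simp add: jacobian_def)
qed

lemma energy_density_radial_deformation:
  fixes x :: "real^'n"
  assumes x: "x \<noteq> 0"
    and w: "((\<lambda>R. w R t) has_real_derivative p) (at (norm x))" "(w (norm x) has_real_derivative q) (at t)"
    and pos: "0 < p" "0 < w (norm x) t"
  shows "energy_density h (radial_deformation w) t x = radial_density CARD('n) h q p (w (norm x) t / norm x)"
proof -
  let ?u = "x /\<^sub>R norm x"
  have u: "norm ?u = 1" using x by simp
  have "((\<lambda>\<tau>. radial_deformation w x \<tau>) has_vector_derivative q *\<^sub>R ?u) (at t)"
    unfolding radial_deformation_def
    using has_vector_derivative_scaleR[OF w(2) has_vector_derivative_const[of ?u]] by simp
  then have "vector_derivative (\<lambda>\<tau>. radial_deformation w x \<tau>) (at t) = q *\<^sub>R ?u"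
    by (rule vector_derivative_at)
  then have "norm (vector_derivative (\<lambda>\<tau>. radial_deformation w x \<tau>) (at t)) = \<bar>q\<bar>"
    using u by (simp only: norm_scaleR mult_1_right)
  then have "(norm (vector_derivative (\<lambda>\<tau>. radial_deformation w x \<tau>) (at t)))\<^sup>2 = q\<^sup>2" by simp
  moreover have "0 < w (norm x) t / norm x" using pos x by simp
  ultimately show ?thesis
    unfolding energy_density_def jacobian_radial_deformation[where p = p and w = w, OF x w(1)]
      stored_energy_radial_gradient[OF u pos(1) \<open>0 < w (norm x) t / norm x\<close>]
    by (simp add: radial_density_def)
qed

lemma ball_integral_of_radial:
  fixes g :: "real^'n \<Rightarrow> real"
  assumes f: "continuous_on {0<..<b} f"
    and int: "set_integrable lborel {0<..<b} (\<lambda>R. R ^ (CARD('n) - 1) * f R)"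
    and g: "\<And>x. x \<noteq> 0 \<Longrightarrow> norm x < b \<Longrightarrow> g x = f (norm x)"
  shows "g absolutely_integrable_on ball 0 b"
    and "integral (ball 0 b) g = real CARD('n) * unit_ball_vol (real CARD('n)) * (LINT R:{0<..<b}|lborel. R ^ (CARD('n) - 1) * f R)"
proof -
  have meas: "set_borel_measurable borel {0<..<b} f"
    using borel_measurable_continuous_on_indicator[OF _ f] by (simp add: set_borel_measurable_def)
  have cong: "\<And>x. x \<in> ball 0 b - {0} \<Longrightarrow> g x = f (norm x)" using g by simp
  have "set_integrable lborel (ball 0 b - {0}) (\<lambda>x :: real^'n. f (norm x))"
    by (rule radial_integrable[OF meas int])
  then have 1: "set_integrable lborel (ball 0 b - {0}) g"
    by (subst set_integrable_cong[OF refl refl cong]) auto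
  then have "g absolutely_integrable_on (ball 0 b - {0})"
    unfolding set_integrable_def by (rule integrable_completion[THEN iffD2, rotated])
       (use 1 in \<open>auto simp: set_integrable_def dest: borel_measurable_integrable\<close>)
  then show "g absolutely_integrable_on ball 0 b"
    by (rule absolutely_integrable_spike_set) (rule negligible_subset[of "{0}"]; auto)+
  have "integral (ball 0 b) g = integral (ball 0 b - {0}) g"
    by (rule integral_spike_set) (rule negligible_subset[of "{0}"]; auto)+
  also have "\<dots> = (LINT x:ball 0 b - {0}|lborel. g x)"
    using set_borel_integral_eq_integral(2)[OF 1] by simp
  also have "\<dots> = (LINT x:ball 0 b - {0}|lborel. f (norm (x :: real^'n)))"
    unfolding set_lebesgue_integral_def
    by (intro Bochner_Integration.integral_cong) (use cong in \<open>auto simp: indicator_def\<close>)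
  also have "\<dots> = real CARD('n) * unit_ball_vol (real CARD('n)) * (LINT R:{0<..<b}|lborel. R ^ (CARD('n) - 1) * f R)"
    by (rule radial_integral[OF meas])
  finally show "integral (ball 0 b) g = real CARD('n) * unit_ball_vol (real CARD('n)) * (LINT R:{0<..<b}|lborel. R ^ (CARD('n) - 1) * f R)" .
qed

text \<open>The profile is an arbitrary choice by \<open>SOME\<close>; comparing two representations
  along the ray of one unit vector shows that the choice is irrelevant at positive radii.\<close>

lemma radial_profile_radial_deformation:
  assumes R: "0 < R"
  shows "radial_profile (radial_deformation w :: real^'n \<Rightarrow> real \<Rightarrow> real^'n) R t = w R t"
proof -
  let ?w = "radial_profile (radial_deformation w :: real^'n \<Rightarrow> real \<Rightarrow> real^'n)"
  let ?u = "axis undefined 1 :: real^'n"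
  have "radial_deformation w = (radial_deformation ?w :: real^'n \<Rightarrow> real \<Rightarrow> real^'n)"
    unfolding radial_profile_def by (rule someI[of _ w]) (rule refl)
  then have "radial_deformation w (R *\<^sub>R ?u) t = radial_deformation ?w (R *\<^sub>R ?u) t" by simp
  then have "w R t *\<^sub>R ?u = ?w R t *\<^sub>R ?u" using R by (simp add: radial_deformation_def)
  then show ?thesis by simp
qed

lemma averaged_deformation_radial_deformation:
  "averaged_deformation \<phi> n (radial_deformation w :: real^'n \<Rightarrow> real \<Rightarrow> real^'n)
    = radial_deformation (averaged_profile \<phi> n w)"
proof -
  have "averaged_profile \<phi> n (radial_profile (radial_deformation w :: real^'n \<Rightarrow> real \<Rightarrow> real^'n)) = averaged_profile \<phi> n w"
    unfolding averaged_profile_def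
    by (intro ext integral_spike[of "{0}"]) (auto simp: radial_profile_radial_deformation)
  then show ?thesis by (simp add: averaged_deformation_def)
qed

lemma averaged_profile_eq_smoothed:
  assumes \<phi>: "mollifier \<phi>" and n: "0 < n" and R: "0 \<le> R" "R + 1 / real n < M"
    and w: "\<And>S. 0 < S \<Longrightarrow> w S t = W S"
  shows "averaged_profile \<phi> n w R t = smoothed (scaled_mollifier \<phi> n) M W R"
proof -
  interpret smoothing_kernel "scaled_mollifier \<phi> n" "scaled_mollifier_deriv \<phi> n" "1 / real n"
    by (rule smoothing_kernel_scaled_mollifier[OF \<phi> n])
  have "odd_kernel (scaled_mollifier \<phi> n) R S = 0" if "S \<ge> M" for S
    using support[of "R - S"] support[of "R + S"] R \<delta>_pos that by (simp add: odd_kernel_def)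
  then have "integral {0..} (\<lambda>S. odd_kernel (scaled_mollifier \<phi> n) R S * w S t)
      = integral {0..M} (\<lambda>S. odd_kernel (scaled_mollifier \<phi> n) R S * w S t)"
    by (intro integral_spike_set empty_imp_negligible) auto
  also have "\<dots> = integral {0..M} (\<lambda>S. odd_kernel (scaled_mollifier \<phi> n) R S * W S)"
    by (rule integral_spike[of "{0}"]) (auto simp: w)
  finally show ?thesis by (simp add: averaged_profile_def smoothed_def odd_kernel_def)
qed

lemma integral_scale:
  fixes f :: "real \<Rightarrow> real"
  assumes "continuous_on {0..\<tau> * N} f" "0 < \<tau>"
  shows "integral {0..\<tau> * N} f = \<tau> * integral {0..N} (\<lambda>s. f (\<tau> * s))"
proof (cases "0 \<le> N")
  case True
  have "(f has_integral integral {0..\<tau> * N} f) {0..\<tau> * N}"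
    by (intro integrable_integral integrable_continuous_real assms)
  from has_integral_stretch_real[OF this, of \<tau>]
  have "((\<lambda>s. f (\<tau> * s)) has_integral 1 / \<tau> * integral {0..\<tau> * N} f) {0..N}"
    using assms True by (simp add: image_divide_atLeastAtMost)
  then show ?thesis using assms by (simp add: integral_unique)
next
  case False
  then have "\<tau> * N < 0" using assms by (simp add: mult_pos_neg)
  then show ?thesis using False by simp
qed

text \<open>With S = \<tau> s the average becomes \<tau>^2 times an integral over a fixed interval
  in which \<tau> occurs only inside the kernel. Differentiating under the integral then uses
  nothing but continuity of r.\<close>

lemma averaged_profile_time_derivative:
  assumes \<phi>: "mollifier \<phi>" and n: "0 < n" and R: "0 \<le> R" "R + 1 / real n < M" and t: "0 < t"
    and r: "continuous_on {0..} r" and W: "\<And>S. W S = t * r (S / t)"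
    and w: "\<And>S \<tau>. 0 < \<tau> \<Longrightarrow> w S \<tau> = \<tau> * r (S / \<tau>)"
  shows "((\<lambda>\<tau>. averaged_profile \<phi> n w R \<tau>) has_real_derivative
    smoothed_rate (scaled_mollifier \<phi> n) (scaled_mollifier_deriv \<phi> n) M W R / t) (at t)"
proof -
  let ?\<psi> = "scaled_mollifier \<phi> n" and ?\<psi>' = "scaled_mollifier_deriv \<phi> n"
  interpret smoothing_kernel ?\<psi> ?\<psi>' "1 / real n"
    by (rule smoothing_kernel_scaled_mollifier[OF \<phi> n])
  \<comment> \<open>The cutoff in the variable s. At times \<tau> near t the cutoff in S is \<tau>
    N, and the strict inequality R + 1/n < \<tau> N persists in a neighborhood of t.\<close>
  define N where "N = M / t"
  have M: "M = t * N" "0 < M" using t R(1) R(2) \<delta>_pos by (simp add: N_def, linarith)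
  have N: "0 < N" using M t by (simp add: N_def)
  define F where "F \<tau> = integral {0..N} (\<lambda>s. odd_kernel ?\<psi> R (\<tau> * s) * r s)" for \<tau>
  define F' where "F' = integral {0..N} (\<lambda>s. (- even_kernel ?\<psi>' R (t * s) * s) * r s)"
  have rN: "continuous_on {0..N} r" by (rule continuous_on_subset[OF r]) auto
  have r\<tau>: "continuous_on {0..\<tau> * N} (\<lambda>S. r (S / \<tau>))" if "0 < \<tau>" for \<tau>
    by (rule continuous_on_compose2[OF r]) (use that in \<open>auto intro!: continuous_intros\<close>)
  have scale: "averaged_profile \<phi> n w R \<tau> = \<tau>\<^sup>2 * F \<tau>" if \<tau>: "0 < \<tau>" "R + 1 / real n < \<tau> * N" for \<tau>
  proof -
    have "averaged_profile \<phi> n w R \<tau> = smoothed ?\<psi> (\<tau> * N) (\<lambda>S. \<tau> * r (S / \<tau>)) R"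
      by (rule averaged_profile_eq_smoothed[OF \<phi> n R(1) \<tau>(2)]) (simp add: w \<tau>)
    also have "\<dots> = \<tau> * integral {0..N} (\<lambda>s. odd_kernel ?\<psi> R (\<tau> * s) * (\<tau> * r (\<tau> * s / \<tau>)))"
      unfolding smoothed_def by (intro integral_scale continuous_intros r\<tau> \<tau>)
    also have "\<dots> = \<tau>\<^sup>2 * F \<tau>"
    proof -
      have "(\<lambda>s. odd_kernel ?\<psi> R (\<tau> * s) * (\<tau> * r (\<tau> * s / \<tau>))) = (\<lambda>s. \<tau> * (odd_kernel ?\<psi> R (\<tau> * s) * r s))"
        using \<tau> by (simp add: fun_eq_iff)
      then show ?thesis by (simp add: F_def power2_eq_square)
    qed
    finally show ?thesis .
  qed
  have "((\<lambda>\<tau>. integral (cbox 0 N) (\<lambda>s. odd_kernel ?\<psi> R (\<tau> * s) * r s)) has_real_derivative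
      integral (cbox 0 N) (\<lambda>s. (- even_kernel ?\<psi>' R (t * s) * s) * r s)) (at t within UNIV)"
  proof (rule leibniz_rule_field_derivative)
    show "continuous_on (UNIV \<times> cbox 0 N) (\<lambda>(\<tau>, s). (- even_kernel ?\<psi>' R (\<tau> * s) * s) * r s)"
      unfolding split_beta by (intro continuous_intros continuous_on_compose2[OF rN]) auto
    show "(\<lambda>s. odd_kernel ?\<psi> R (\<tau> * s) * r s) integrable_on cbox 0 N" for \<tau>
      unfolding box_real by (intro integrable_continuous_real continuous_intros rN)
    show "((\<lambda>\<tau>. odd_kernel ?\<psi> R (\<tau> * s) * r s) has_real_derivative (- even_kernel ?\<psi>' R (\<tau> * s) * s) * r s) (at \<tau> within UNIV)" for \<tau> s
    proof -
      have "((\<lambda>\<tau>. odd_kernel ?\<psi> R (\<tau> * s)) has_real_derivative - even_kernel ?\<psi>' R (\<tau> * s) * (1 * s)) (at \<tau>)"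
        by (rule DERIV_chain2[OF kernel_derivs(2)]) (rule DERIV_cmult_right[OF DERIV_ident])
      from DERIV_cmult_right[OF this] show ?thesis by simp
    qed
  qed auto
  then have dF: "(F has_real_derivative F') (at t)" by (simp add: F_def[abs_def] F'_def)
  have "((\<lambda>\<tau>. \<tau>\<^sup>2 * F \<tau>) has_real_derivative 2 * t * F t + t\<^sup>2 * F') (at t)"
    by (auto intro!: derivative_eq_intros dF)
  moreover have "open {\<tau>. 0 < \<tau> \<and> R + 1 / real n < \<tau> * N}"
    by (intro open_Collect_conj open_Collect_less continuous_intros)
  moreover have "t \<in> {\<tau>. 0 < \<tau> \<and> R + 1 / real n < \<tau> * N}" using t R M by auto
  ultimately have "((\<lambda>\<tau>. averaged_profile \<phi> n w R \<tau>) has_real_derivative 2 * t * F t + t\<^sup>2 * F') (at t)"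
    by (rule has_field_derivative_transform_within_open) (simp add: scale)
  moreover have "2 * t * F t + t\<^sup>2 * F' = smoothed_rate ?\<psi> ?\<psi>' M W R / t"
  proof -
    have Rt: "R + 1 / real n < t * N" using R M by simp
    have "smoothed ?\<psi> M W R = t\<^sup>2 * F t"
      using averaged_profile_eq_smoothed[OF \<phi> n R, of w t W] scale[OF t Rt] w[OF t] W by simp
    moreover have "integral {0..M} (\<lambda>S. even_kernel ?\<psi>' R S * (S * W S)) = - (t ^ 3 * F')"
    proof -
      have "integral {0..t * N} (\<lambda>S. even_kernel ?\<psi>' R S * (S * (t * r (S / t))))
          = t * integral {0..N} (\<lambda>s. even_kernel ?\<psi>' R (t * s) * (t * s * (t * r (t * s / t))))"
        by (intro integral_scale continuous_intros r\<tau> t)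
      also have "(\<lambda>s. even_kernel ?\<psi>' R (t * s) * (t * s * (t * r (t * s / t))))
          = (\<lambda>s. - (t\<^sup>2) * ((- even_kernel ?\<psi>' R (t * s) * s) * r s))"
        using t by (simp add: fun_eq_iff power2_eq_square)
      finally show ?thesis unfolding F'_def W M(1)[symmetric] by (simp add: power3_eq_cube power2_eq_square)
    qed
    ultimately show ?thesis using t by (simp add: smoothed_rate_def field_simps power2_eq_square power3_eq_cube)
  qed
  ultimately show ?thesis by simp
qed


section \<open>The cavitating solution\<close>

context
  fixes d :: nat and h r :: "real \<Rightarrow> real" and H lam \<sigma> :: real
  assumes d: "3 \<le> d" and h: "volumetric_energy h" and H: "0 < H" "deriv h H = 0" and lam: "0 < lam"
    and sol: "cavitating_solution d h H lam \<sigma> r"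
    and props: "cavitating_solution_properties d H lam \<sigma> r"
begin

text \<open>The values at \<open>0\<close> and \<open>\<sigma>\<close> are chosen to preserve the bounds of \<open>r'\<close>.\<close>

definition radial_slope :: "real \<Rightarrow> real" where
  "radial_slope s = (if s \<le> 0 then 0 else if \<sigma> \<le> s then lam else deriv r s)"

lemma shock_speed_pos: "0 < \<sigma>"
  using sol by (simp add: cavitating_solution_def)

lemma radial_slope_deriv:
  assumes "0 < s" "s \<noteq> \<sigma>"
  shows "(r has_real_derivative radial_slope s) (at s)" "isCont radial_slope s"
proof (atomize (full), cases "s < \<sigma>")
  case True
  then have s: "s \<in> {0<..<\<sigma>}" using assms by simp
  have "(r has_real_derivative deriv r s) (at s)" "isCont (deriv r) s"
    using sol s unfolding cavitating_solution_def
    by (auto simp: DERIV_deriv_iff_real_differentiable differentiable_imp_continuous_within)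
  moreover have "\<forall>\<^sub>F x in nhds s. radial_slope x = deriv r x"
    using eventually_nhds_in_open[OF open_greaterThanLessThan s]
    by eventually_elim (simp add: radial_slope_def)
  ultimately show "(r has_real_derivative radial_slope s) (at s) \<and> isCont radial_slope s"
    using True assms by (simp add: isCont_cong) (simp add: radial_slope_def)
next
  case False
  then have s: "s \<in> {\<sigma><..}" using assms by simp
  have "((\<lambda>x. lam * x) has_real_derivative lam) (at s)" by (auto intro!: derivative_eq_intros)
  then have "(r has_real_derivative lam) (at s)"
    by (rule has_field_derivative_transform_within_open[OF _ open_greaterThan s])
       (use sol in \<open>auto simp: cavitating_solution_def\<close>)
  moreover have "\<forall>\<^sub>F x in nhds s. radial_slope x = lam"
    using eventually_nhds_in_open[OF open_greaterThan s]
    by eventually_elim (use shock_speed_pos in \<open>simp add: radial_slope_def\<close>)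
  ultimately show "(r has_real_derivative radial_slope s) (at s) \<and> isCont radial_slope s"
    using False assms by (simp add: isCont_cong) (simp add: radial_slope_def)
qed

lemma radial_slope_bounds: "0 \<le> radial_slope s" "radial_slope s \<le> lam"
proof -
  have "0 \<le> deriv r s \<and> deriv r s \<le> lam" if "s \<in> {0<..<\<sigma>}"
    using props that unfolding cavitating_solution_properties_def by force
  then show "0 \<le> radial_slope s" "radial_slope s \<le> lam"
    using lam by (auto simp: radial_slope_def)
qed

lemma radial_volume_bounds:
  assumes "0 < s"
  shows "H \<le> radial_slope s * (r s / s) ^ (d - 1)" "radial_slope s * (r s / s) ^ (d - 1) \<le> lam ^ d"
proof -
  have in_fan: "H \<le> specific_volume d r s \<and> specific_volume d r s \<le> lam ^ d" if "s \<in> {0<..<\<sigma>}" for s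
    using props that unfolding cavitating_solution_properties_def by blast
  have "H \<le> radial_slope s * (r s / s) ^ (d - 1) \<and> radial_slope s * (r s / s) ^ (d - 1) \<le> lam ^ d"
  proof (cases "s < \<sigma>")
    case True
    then show ?thesis using in_fan[of s] assms by (simp add: radial_slope_def specific_volume_def)
  next
    case False
    then have "r s = lam * s" using sol by (simp add: cavitating_solution_def)
    moreover have "lam * lam ^ (d - 1) = lam ^ d" using d by (cases d) auto
    ultimately have "radial_slope s * (r s / s) ^ (d - 1) = lam ^ d"
      using False assms by (simp add: radial_slope_def)
    \<comment> \<open>Read off at an arbitrary point of the fan, where v lies between the two
      constants.\<close>
    moreover have "H \<le> lam ^ d" using in_fan[of "\<sigma> / 2"] shock_speed_pos by simp
    ultimately show ?thesis by simp
  qed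
  then show "H \<le> radial_slope s * (r s / s) ^ (d - 1)" "radial_slope s * (r s / s) ^ (d - 1) \<le> lam ^ d" by auto
qed

lemma continuous_energy: "continuous_on {0<..} h"
  using volumetric_energy_derivs(1)[OF h] by (auto intro!: continuous_at_imp_continuous_on DERIV_isCont)

text \<open>On the compact interval W has positive extremes wl and wu. Solving H \<le> v \<le> lam^d
  for the slope gives D = v S^(d-1) / W^(d-1), hence cl = H / wu^(d-1) and cu = lam^d /
  wl^(d-1).\<close>

lemma profile_of_cavitating_solution:
  assumes t: "0 < t" and M: "0 < M"
  shows "\<exists>cl cu wl wu. profile (\<lambda>S. t * r (S / t)) (\<lambda>S. radial_slope (S / t)) (\<sigma> * t) M cl cu wl wu lam (d - 1)"
proof -
  let ?W = "\<lambda>S. t * r (S / t)" and ?D = "\<lambda>S. radial_slope (S / t)"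
  have "continuous_on {0..M} (\<lambda>S. r (S / t))"
    by (rule continuous_on_compose2[of "{0..}" r])
       (use sol t in \<open>auto simp: cavitating_solution_def intro!: continuous_intros\<close>)
  then have W: "continuous_on {0..M} ?W" by (intro continuous_intros)
  have ne: "{0..M} \<noteq> {}" using M by simp
  have Wpos: "0 < ?W S" if "S \<in> {0..M}" for S
    using sol t that by (simp add: cavitating_solution_def)
  obtain S0 where S0: "S0 \<in> {0..M}" "\<And>S. S \<in> {0..M} \<Longrightarrow> ?W S0 \<le> ?W S"
    using continuous_attains_inf[OF compact_Icc ne W] by blast
  obtain S1 where S1: "S1 \<in> {0..M}" "\<And>S. S \<in> {0..M} \<Longrightarrow> ?W S \<le> ?W S1"
    using continuous_attains_sup[OF compact_Icc ne W] by blast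
  define wl wu where "wl = ?W S0" and "wu = ?W S1"
  have wb: "wl \<le> ?W S \<and> ?W S \<le> wu" if "S \<in> {0..M}" for S using S0(2) S1(2) that by (simp add: wl_def wu_def)
  have wl: "0 < wl" "0 < wu" using Wpos S0(1) S1(1) by (simp_all add: wl_def wu_def)
  have "profile ?W ?D (\<sigma> * t) M (H / wu ^ (d - 1)) (lam ^ d / wl ^ (d - 1)) wl wu lam (d - 1)"
  proof
    show "continuous_on {0..M} ?W" by (rule W)
    show "0 < wl" "0 < H / wu ^ (d - 1)" "0 \<le> lam ^ d / wl ^ (d - 1)" "0 \<le> lam" "0 < M"
      using wl H lam M by auto
    show "wl \<le> ?W S \<and> ?W S \<le> wu" if "S \<in> {0..M}" for S by (rule wb[OF that])
    fix S
    show "H / wu ^ (d - 1) * S ^ (d - 1) \<le> ?D S \<and> ?D S \<le> lam ^ d / wl ^ (d - 1) * S ^ (d - 1) \<and> ?D S \<le> lam"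
      if S: "S \<in> {0..M}"
    proof (cases "S = 0")
      case True
      have "d - 1 = Suc (d - 2)" using d by simp
      with True show ?thesis using lam by (simp add: radial_slope_def del: Suc_diff_le)
    next
      case False
      then have S0: "0 < S" using S by simp
      note v = radial_volume_bounds[of "S / t"]
      have q: "r (S / t) / (S / t) = ?W S / S" using t by simp
      have pos: "0 < ?W S ^ (d - 1)" using Wpos[OF S] by (rule zero_less_power)
      have r0: "r (S / t) \<noteq> 0" using Wpos[OF S] by auto
      have D: "?D S = (?D S * (?W S / S) ^ (d - 1)) * S ^ (d - 1) / ?W S ^ (d - 1)"
        using S0 t r0 by (simp add: power_divide)
      have v: "H \<le> ?D S * (?W S / S) ^ (d - 1)" "?D S * (?W S / S) ^ (d - 1) \<le> lam ^ d"
        using v S0 t unfolding q by simp_all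
      have "H * S ^ (d - 1) / wu ^ (d - 1) \<le> (?D S * (?W S / S) ^ (d - 1)) * S ^ (d - 1) / ?W S ^ (d - 1)"
        using wb[OF S] wl H S0 v pos by (intro frac_le mult_mono power_mono) auto
      moreover have "(?D S * (?W S / S) ^ (d - 1)) * S ^ (d - 1) / ?W S ^ (d - 1) \<le> lam ^ d * S ^ (d - 1) / wl ^ (d - 1)"
        using wb[OF S] wl lam S0 v pos by (intro frac_le mult_mono power_mono) auto
      ultimately show ?thesis using radial_slope_bounds(2)[of "S / t"] D by simp
    qed
    assume S: "0 < S" "S < M" "S \<noteq> \<sigma> * t"
    then have s: "0 < S / t" "S / t \<noteq> \<sigma>" using t by (auto simp: field_simps)
    have "((\<lambda>S. S / t) has_real_derivative 1 / t) (at S)" by (rule DERIV_cdivide[OF DERIV_ident])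
    from DERIV_cmult[OF DERIV_chain2[OF radial_slope_deriv(1)[OF s] this], of t]
    show "(?W has_real_derivative ?D S) (at S)" using t by simp
    show "isCont ?D S"
      using isCont_o2[where g = radial_slope and f = "\<lambda>S. S / t" and a = S] radial_slope_deriv(2)[OF s] t
      by (auto intro!: continuous_intros)
  qed
  then show ?thesis by blast
qed

text \<open>Inside the fan this is the similarity integral rescaled by R = t s, outside it the
  homogeneous state with density e. The e-part of the flux at the shock fills the missing ball, so e
  is integrated over the whole range.\<close>

lemma limit_density_integral:
  assumes t: "0 < t" and Rb: "\<sigma> * t < Rb" and p: "p = Lim (at_left \<sigma>) (deriv r)"
  defines "e \<equiv> real d / 2 * lam\<^sup>2 + h (lam ^ d)"
  shows "((\<lambda>R. R ^ (d - 1) * limit_density h d t (\<lambda>S. t * r (S / t)) (\<lambda>S. radial_slope (S / t)) R)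
    has_integral (t ^ d * \<sigma> ^ d * shock_dissipation d h lam p + Rb ^ d * e) / real d) {0..Rb}"
    (is "(?f has_integral _) _")
proof -
  obtain m where m: "d = Suc m" using d by (cases d) auto
  have st: "0 < \<sigma> * t" using shock_speed_pos t by simp
  have f: "?f R = R ^ m * radial_density d h (r (R / t) - R / t * radial_slope (R / t)) (radial_slope (R / t)) (r (R / t) / (R / t))" for R
  proof -
    have eqs: "(t * r (R / t) - R * radial_slope (R / t)) / t = r (R / t) - R / t * radial_slope (R / t)"
      "t * r (R / t) / R = r (R / t) / (R / t)"
      using t by (simp_all add: field_simps)
    show ?thesis unfolding limit_density_def eqs by (simp add: m)
  qed
  have "(?f has_integral (t ^ d * \<sigma> ^ d * (shock_dissipation d h lam p + e)) / real d) {0..\<sigma> * t}"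
  proof -
    note E = similarity_energy_integral[OF d h H lam sol props p]
    have image: "(\<lambda>x. x / (1 / t)) ` {0..\<sigma>} = {0..\<sigma> * t}"
      using image_mult_atLeastAtMost[OF t, of 0 \<sigma>] by (simp add: mult.commute)
    have 1: "((\<lambda>R. t ^ m / real d * (real d * (1 / t * R) ^ (d - 1) * radial_density d h
          (r (1 / t * R) - 1 / t * R * deriv r (1 / t * R)) (deriv r (1 / t * R)) (r (1 / t * R) / (1 / t * R))))
        has_integral t ^ m / real d * (1 / \<bar>1 / t\<bar> * (\<sigma> ^ d * (shock_dissipation d h lam p + e)))) {0..\<sigma> * t}"
      unfolding image[symmetric]
      by (intro has_integral_mult_right has_integral_stretch_real[OF E[folded e_def], of "1 / t", unfolded real_scaleR_def])
         (use t in simp)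
    have 2: "t ^ m / real d * (1 / \<bar>1 / t\<bar> * (\<sigma> ^ d * (shock_dissipation d h lam p + e)))
        = (t ^ d * \<sigma> ^ d * (shock_dissipation d h lam p + e)) / real d"
      using t by (simp add: m)
    have 3: "?f R = t ^ m / real d * (real d * (1 / t * R) ^ (d - 1) * radial_density d h
          (r (1 / t * R) - 1 / t * R * deriv r (1 / t * R)) (deriv r (1 / t * R)) (r (1 / t * R) / (1 / t * R)))"
      if R: "R \<in> {0..\<sigma> * t} - {0, \<sigma> * t}" for R
    proof -
      have "radial_slope (R / t) = deriv r (1 / t * R)" "1 / t * R = R / t" "t ^ m * (R / t) ^ m = R ^ m"
        using R t by (auto simp: radial_slope_def field_simps power_divide)
      then show ?thesis unfolding f using d by (simp add: m)
    qed
    have "finite {0, \<sigma> * t}" by simp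
    from has_integral_spike_finite[OF this 3 1] show ?thesis unfolding 2 .
  qed
  moreover have "(?f has_integral (Rb ^ d * e / real d - (\<sigma> * t) ^ d * e / real d)) {\<sigma> * t..Rb}"
  proof -
    have "((\<lambda>R. R ^ m * e) has_integral (Rb ^ d * e / real d - (\<sigma> * t) ^ d * e / real d)) {\<sigma> * t..Rb}"
    proof (rule fundamental_theorem_of_calculus)
      show "((\<lambda>R. R ^ d * e / real d) has_vector_derivative R ^ m * e) (at R within {\<sigma> * t..Rb})" for R
        unfolding has_real_derivative_iff_has_vector_derivative[symmetric] m
        by (rule has_field_derivative_at_within, rule DERIV_cong,
            rule DERIV_cdivide[OF DERIV_cmult_right[OF DERIV_pow]]) (simp del: of_nat_Suc)
    qed (use Rb in simp)
    moreover have "?f R = R ^ m * e" if "R \<in> {\<sigma> * t..Rb}" for R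
    proof -
      define s where "s = R / t"
      have s: "0 < s" "\<sigma> \<le> s" using that t st by (auto simp: s_def field_simps)
      then have "r s = lam * s" "radial_slope s = lam"
        using sol by (auto simp: cavitating_solution_def radial_slope_def)
      moreover have "lam * lam ^ m = lam ^ d" by (simp add: m)
      ultimately show ?thesis unfolding f e_def radial_density_def s_def[symmetric] using s
        by (simp add: m algebra_simps add_divide_distrib)
    qed
    ultimately show ?thesis using has_integral_cong[of "{\<sigma> * t..Rb}" ?f "\<lambda>R. R ^ m * e"] by simp
  qed
  ultimately have "(?f has_integral (t ^ d * \<sigma> ^ d * (shock_dissipation d h lam p + e)) / real d
      + (Rb ^ d * e / real d - (\<sigma> * t) ^ d * e / real d)) {0..Rb}"
    using st Rb by (intro has_integral_combine) auto
  then show ?thesis by (simp add: algebra_simps add_divide_distrib power_mult_distrib)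
qed


lemma averaged_energy_cavitating:
  fixes y :: "real^'n \<Rightarrow> real \<Rightarrow> real^'n"
  defines "y \<equiv> cavitating_deformation lam r" and "e \<equiv> real d / 2 * lam\<^sup>2 + h (lam ^ d)"
  assumes dn: "d = CARD('n)" and \<phi>: "mollifier \<phi>" and L: "((\<lambda>v. h v / v) \<longlongrightarrow> L) at_top"
    and t: "0 < t" and Rb: "\<sigma> * t < Rb" and p: "p = Lim (at_left \<sigma>) (deriv r)"
  shows "\<forall>\<^sub>F n in sequentially. energy_density h (averaged_deformation \<phi> n y) t absolutely_integrable_on ball 0 Rb"
    and "(\<lambda>n. averaged_energy \<phi> h n y (ball 0 Rb) t) \<longlonglongrightarrow> real CARD('n) * unit_ball_vol (real CARD('n)) *
      ((t ^ d * \<sigma> ^ d * shock_dissipation d h lam p + Rb ^ d * e) / real d + L * (t * r 0) ^ d / real d)"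
proof -
  let ?m = "d - 1" and ?W = "\<lambda>S. t * r (S / t)" and ?D = "\<lambda>S. radial_slope (S / t)" and ?M = "Rb + 2"
  let ?w = "cavitating_profile lam r"
  have Rb0: "0 < Rb" using Rb shock_speed_pos t by (smt (verit) mult_pos_pos)
  have Sm: "Suc ?m = d" using d by simp
  obtain cl cu wl wu where "profile ?W ?D (\<sigma> * t) ?M cl cu wl wu lam ?m"
    using profile_of_cavitating_solution[OF t, of ?M] Rb0 by auto
  then interpret P: mollified_profile ?W ?D "\<sigma> * t" ?M cl cu wl wu lam ?m \<phi> t Rb
    by (rule mollified_profile.intro) (unfold_locales, use d \<phi> t Rb0 in auto)
  note limit = P.averaged_density_limit[OF continuous_energy L, unfolded Sm]
  obtain c where c: "0 < c" "\<And>n R. 0 < n \<Longrightarrow> 0 < R \<Longrightarrow> R \<le> Rb \<Longrightarrow>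
      0 \<le> P.pn n R \<and> 0 < P.wn n R \<and> c \<le> P.pn n R * (P.wn n R / R) ^ ?m"
    by (rule P.average_bounds) blast
  have dens: "energy_density h (averaged_deformation \<phi> n y) t x = averaged_density \<phi> h d t ?M ?W n (norm x)"
    if n: "0 < n" and x: "x \<noteq> 0" "norm x < Rb" for n x
  proof -
    interpret S: smoothed_profile "scaled_mollifier \<phi> n" "scaled_mollifier_deriv \<phi> n" "1 / real n" ?W ?D "\<sigma> * t" ?M cl cu wl wu lam ?m
      by (rule P.smoothed_profile_scaled[OF n])
    have eq: "averaged_profile \<phi> n ?w R t = P.wn n R" if "0 \<le> R" "R \<le> Rb" for R
      by (rule averaged_profile_eq_smoothed[OF \<phi> n that(1) P.radius_in_range[OF n that(2)]])
         (simp add: cavitating_profile_def t)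
    have x': "norm x \<in> {0<..<Rb}" using x by simp
    have 1: "((\<lambda>R. averaged_profile \<phi> n ?w R t) has_real_derivative P.pn n (norm x)) (at (norm x))"
      by (rule has_field_derivative_transform_within_open[OF S.deriv_smoothed open_greaterThanLessThan x'])
         (simp add: eq)
    have "continuous_on {0..} r" using sol by (simp add: cavitating_solution_def)
    then have 2: "(averaged_profile \<phi> n ?w (norm x) has_real_derivative P.qn n (norm x) / t) (at t)"
      using x' by (intro averaged_profile_time_derivative[OF \<phi> n _ P.radius_in_range[OF n] t])
        (auto simp: cavitating_profile_def)
    have v: "0 \<le> P.pn n (norm x)" "0 < P.wn n (norm x)" "c \<le> P.pn n (norm x) * (P.wn n (norm x) / norm x) ^ ?m"
      using c(2)[OF n, of "norm x"] x' by auto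
    \<comment> \<open>A nonnegative slope is not enough for the positive stretches of
      \<open>energy_density_radial_deformation\<close>; the volume bound c > 0 excludes the value
      0.\<close>
    have "P.pn n (norm x) \<noteq> 0" using v(3) c(1) by auto
    then have pos: "0 < P.pn n (norm x)" "0 < averaged_profile \<phi> n ?w (norm x) t"
      using v x' eq[of "norm x"] by auto
    show ?thesis
      unfolding y_def cavitating_deformation_def averaged_deformation_radial_deformation
      by (subst energy_density_radial_deformation[OF x(1) 1 2 pos])
         (use eq[of "norm x"] x' in \<open>simp add: averaged_density_def dn\<close>)
  qed
  have cont: "continuous_on {0<..<Rb} (averaged_density \<phi> h d t ?M ?W n)" if n: "0 < n" for n
  proof -
    have "continuous_on {0<..<Rb} (\<lambda>R. (R ^ ?m * averaged_density \<phi> h d t ?M ?W n R) / R ^ ?m)"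
      using P.continuous_averaged_density[OF continuous_energy n, unfolded Sm]
      by (intro continuous_on_divide continuous_on_power continuous_on_id) auto
    then show ?thesis by (rule continuous_on_eq) simp
  qed
  note ball = ball_integral_of_radial[OF cont[unfolded dn] limit(1)[unfolded dn] dens[unfolded dn]]
  show "\<forall>\<^sub>F n in sequentially. energy_density h (averaged_deformation \<phi> n y) t absolutely_integrable_on ball 0 Rb"
    by (rule eventually_mono[OF eventually_gt_at_top[of 0]]) (rule ball(1), assumption+)
  have "(\<lambda>n. real CARD('n) * unit_ball_vol (real CARD('n)) * (LINT R:{0<..<Rb}|lborel. R ^ ?m * averaged_density \<phi> h d t ?M ?W n R))
      \<longlonglongrightarrow> real CARD('n) * unit_ball_vol (real CARD('n)) *
      ((t ^ d * \<sigma> ^ d * shock_dissipation d h lam p + Rb ^ d * e) / real d + L * (t * r 0) ^ d / real d)"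
    using limit(2)[OF limit_density_integral[OF t Rb p]] Rb unfolding e_def
    by (intro tendsto_mult tendsto_const) auto
  then show "(\<lambda>n. averaged_energy \<phi> h n y (ball 0 Rb) t) \<longlonglongrightarrow> real CARD('n) * unit_ball_vol (real CARD('n)) *
      ((t ^ d * \<sigma> ^ d * shock_dissipation d h lam p + Rb ^ d * e) / real d + L * (t * r 0) ^ d / real d)"
  proof (rule Lim_transform_eventually)
    show "\<forall>\<^sub>F n in sequentially. real CARD('n) * unit_ball_vol (real CARD('n)) *
        (LINT R:{0<..<Rb}|lborel. R ^ ?m * averaged_density \<phi> h d t ?M ?W n R) = averaged_energy \<phi> h n y (ball 0 Rb) t"
      unfolding averaged_energy_def dn
      by (rule eventually_mono[OF eventually_gt_at_top[of 0]]) (rule ball(2)[symmetric], assumption+)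
  qed
qed

lemma shock_slope_cavitating_profile:
  assumes t: "0 < t"
  shows "shock_slope (cavitating_profile lam r) \<sigma> t = Lim (at_left \<sigma>) (deriv r)"
proof -
  let ?p = "Lim (at_left \<sigma>) (deriv r)"
  have p: "(deriv r \<longlongrightarrow> ?p) (at_left \<sigma>)"
    by (rule deriv_r_left_limit(1)[OF d h H lam sol props refl])
  have "filterlim (\<lambda>R. R / t) (at_left \<sigma>) (at_left (t * \<sigma>))"
    unfolding filterlim_at
  proof
    show "\<forall>\<^sub>F R in at_left (t * \<sigma>). R / t \<in> {..<\<sigma>} \<and> R / t \<noteq> \<sigma>"
      using t by (auto simp: eventually_at_filter field_simps)
    have "((\<lambda>R. R / t) \<longlongrightarrow> t * \<sigma> / t) (at_left (t * \<sigma>))"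
      using t by (intro tendsto_intros) auto
    then show "((\<lambda>R. R / t) \<longlongrightarrow> \<sigma>) (at_left (t * \<sigma>))" using t by simp
  qed
  from filterlim_compose[OF p this]
  have "((\<lambda>R. deriv r (R / t)) \<longlongrightarrow> ?p) (at_left (t * \<sigma>))" .
  moreover have "\<forall>\<^sub>F R in at_left (t * \<sigma>). deriv r (R / t) = deriv (\<lambda>S. cavitating_profile lam r S t) R"
  proof -
    have "deriv (\<lambda>S. cavitating_profile lam r S t) R = deriv r (R / t)" if R: "0 < R" "R < t * \<sigma>" for R
    proof -
      have s: "0 < R / t" "R / t < \<sigma>" using R t by (auto simp: field_simps)
      then have "(r has_real_derivative deriv r (R / t)) (at (R / t))"
        using radial_slope_deriv(1)[of "R / t"] by (simp add: radial_slope_def)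
      from DERIV_cmult[OF DERIV_chain2[OF this DERIV_cdivide[OF DERIV_ident]], of t]
      have "((\<lambda>S. t * r (S / t)) has_real_derivative deriv r (R / t)) (at R)" using t by simp
      then show ?thesis using t by (simp add: cavitating_profile_def DERIV_imp_deriv)
    qed
    then show ?thesis
      using t shock_speed_pos unfolding eventually_at_left_field
      by (intro exI[of _ 0]) auto
  qed
  ultimately have "((\<lambda>R. deriv (\<lambda>S. cavitating_profile lam r S t) R) \<longlongrightarrow> ?p) (at_left (t * \<sigma>))"
    by (rule Lim_transform_eventually)
  then show ?thesis unfolding shock_slope_def by (intro tendsto_Lim) auto
qed

end

section \<open>The homogeneous deformation and the comparison of the two energies\<close>

lemma averaged_energy_homogeneous:
  fixes h :: "real \<Rightarrow> real"
  assumes d: "d = CARD('n)" and \<phi>: "mollifier \<phi>" and lam: "0 < lam" and b: "0 < b" and n: "0 < n"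
  defines "e \<equiv> real d / 2 * lam\<^sup>2 + h (lam ^ d)"
  shows "energy_density h (averaged_deformation \<phi> n (homogeneous_deformation lam :: real^'n \<Rightarrow> real \<Rightarrow> real^'n)) t
      absolutely_integrable_on ball 0 b"
    and "averaged_energy \<phi> h n (homogeneous_deformation lam :: real^'n \<Rightarrow> real \<Rightarrow> real^'n) (ball 0 b) t
      = real CARD('n) * unit_ball_vol (real CARD('n)) * (b ^ d * e / real d)"
proof -
  let ?w = "\<lambda>(R::real) (\<tau>::real). lam * R"
  interpret smoothing_kernel "scaled_mollifier \<phi> n" "scaled_mollifier_deriv \<phi> n" "1 / real n"
    by (rule smoothing_kernel_scaled_mollifier[OF \<phi> n])
  have hom: "homogeneous_deformation lam = (radial_deformation ?w :: real^'n \<Rightarrow> real \<Rightarrow> real^'n)"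
    by (auto simp: fun_eq_iff homogeneous_deformation_def radial_deformation_def)
  \<comment> \<open>Averaging reproduces the deformation exactly, so the averaged energies do not
    depend on n.\<close>
  have avg: "averaged_profile \<phi> n ?w R \<tau> = lam * R" if "0 \<le> R" for R \<tau>
    using averaged_profile_eq_smoothed[OF \<phi> n that, of "R + 1 / real n + 1" ?w \<tau> "\<lambda>S. lam * S"]
      smoothed_linear[OF that, of "R + 1 / real n + 1" lam] by simp
  have dens: "energy_density h (averaged_deformation \<phi> n (homogeneous_deformation lam :: real^'n \<Rightarrow> real \<Rightarrow> real^'n)) t x = e"
    if x: "x \<noteq> 0" for x
  proof -
    have x': "norm x \<in> {0<..}" using x by simp
    have "((\<lambda>R. lam * R) has_real_derivative lam) (at (norm x))" by (auto intro!: derivative_eq_intros)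
    then have 1: "((\<lambda>R. averaged_profile \<phi> n ?w R t) has_real_derivative lam) (at (norm x))"
      by (rule has_field_derivative_transform_within_open[OF _ open_greaterThan x']) (simp add: avg)
    have "averaged_profile \<phi> n ?w (norm x) = (\<lambda>\<tau>. lam * norm x)" by (simp add: fun_eq_iff avg)
    then have 2: "(averaged_profile \<phi> n ?w (norm x) has_real_derivative 0) (at t)" by simp
    have pos: "0 < averaged_profile \<phi> n ?w (norm x) t" using x lam by (simp add: avg)
    have z: "averaged_profile \<phi> n ?w (norm x) t / norm x = lam" using x by (simp add: avg)
    have "lam * lam ^ (d - 1) = lam ^ d" unfolding d by (simp add: power_eq_if)
    then show ?thesis
      unfolding hom averaged_deformation_radial_deformation energy_density_radial_deformation[OF x 1 2 lam pos] z
      by (simp add: radial_density_def e_def d[symmetric] field_simps)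
  qed
  have I: "((\<lambda>R. R ^ (d - 1) * e) has_integral (b ^ d * e / real d - 0 ^ d * e / real d)) {0..b}"
  proof (rule fundamental_theorem_of_calculus)
    show "((\<lambda>R. R ^ d * e / real d) has_vector_derivative R ^ (d - 1) * e) (at R within {0..b})" for R
      unfolding has_real_derivative_iff_has_vector_derivative[symmetric]
      by (rule has_field_derivative_at_within, rule DERIV_cong,
          rule DERIV_cdivide[OF DERIV_cmult_right[OF DERIV_pow]]) (simp add: d)
  qed (use b in simp)
  have "set_integrable lborel {0..b} (\<lambda>R. R ^ (d - 1) * e)"
    by (intro borel_integrable_atLeastAtMost' continuous_intros)
  then have int: "set_integrable lborel {0<..<b} (\<lambda>R. R ^ (d - 1) * e)"
    by (rule set_integrable_subset) auto
  note ball = ball_integral_of_radial[OF continuous_on_const int[unfolded d] dens]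
  show "energy_density h (averaged_deformation \<phi> n (homogeneous_deformation lam :: real^'n \<Rightarrow> real \<Rightarrow> real^'n)) t
      absolutely_integrable_on ball 0 b"
    by (rule ball(1))
  have "(LINT R:{0<..<b}|lborel. R ^ (d - 1) * e) = b ^ d * e / real d"
    using integral_unique[OF I[unfolded has_integral_Icc_iff_Ioo]]
    unfolding set_borel_integral_eq_integral(2)[OF int] by (simp add: d)
  then show "averaged_energy \<phi> h n (homogeneous_deformation lam :: real^'n \<Rightarrow> real \<Rightarrow> real^'n) (ball 0 b) t
      = real CARD('n) * unit_ball_vol (real CARD('n)) * (b ^ d * e / real d)"
    unfolding averaged_energy_def by (subst ball(2)) (simp_all add: d)
qed

theorem proposition3p10:
  fixes h r \<phi> :: "real \<Rightarrow> real"
    and H lam \<sigma> L t Rbar :: real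
    and y :: "real^'n \<Rightarrow> real \<Rightarrow> real^'n"
    and B :: "(real^'n) set"
  defines "d \<equiv> CARD('n)"
    and "y \<equiv> cavitating_deformation lam r"
    and "B \<equiv> ball 0 Rbar"
    and "p \<equiv> shock_slope (cavitating_profile lam r) \<sigma> t"
    and "\<omega> \<equiv> surface_area (sphere (0 :: real^'n) 1)"
  assumes "d \<ge> 3"
    and "mollifier \<phi>"
    and "volumetric_energy h"
    and "H > 0" and "deriv h H = 0"
    and "lam > 0"
    and "cavitating_solution d h H lam \<sigma> r"
    and "cavitating_solution_properties d H lam \<sigma> r"
    and "((\<lambda>v. h v / v) \<longlongrightarrow> L) at_top"
    and "t > 0" and "Rbar > 0"
    and "\<exists>U. open U \<and> {x. norm x \<le> \<sigma> * t} \<subseteq> U \<and> U \<subseteq> B"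
  shows "energy_exists \<phi> h y B t \<and>
    energy_exists \<phi> h (homogeneous_deformation lam) B t \<and>
    energy \<phi> h y B t =
      energy \<phi> h (homogeneous_deformation lam) B t
      + t ^ d * \<sigma> ^ d * \<omega> / real d * shock_dissipation d h lam p
      + t ^ d * \<omega> / real d * r 0 ^ d * L"
proof -
  let ?V = "real d * unit_ball_vol (real d)" and ?e = "real d / 2 * lam\<^sup>2 + h (lam ^ d)"
  let ?hom = "homogeneous_deformation lam :: real^'n \<Rightarrow> real \<Rightarrow> real^'n"
  have \<sigma>: "0 < \<sigma>" using assms(12) by (simp add: cavitating_solution_def)
  have Rb: "\<sigma> * t < Rbar"
  proof -
    \<comment> \<open>A point on the shock sphere lies in the open ball, which forces the strict
      inequality of the radii.\<close>
    have "norm ((\<sigma> * t) *\<^sub>R (axis undefined 1 :: real^'n)) \<le> \<sigma> * t"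
      using \<sigma> \<open>t > 0\<close> by simp
    then have "(\<sigma> * t) *\<^sub>R (axis undefined 1 :: real^'n) \<in> B" using assms(17) by blast
    then show ?thesis using \<sigma> \<open>t > 0\<close> by (simp add: B_def)
  qed
  have p: "p = Lim (at_left \<sigma>) (deriv r)"
    unfolding p_def by (rule shock_slope_cavitating_profile) fact+
  have y: "\<forall>\<^sub>F n in sequentially. energy_density h (averaged_deformation \<phi> n y) t absolutely_integrable_on B"
    "(\<lambda>n. averaged_energy \<phi> h n y B t) \<longlonglongrightarrow>
      ?V * ((t ^ d * \<sigma> ^ d * shock_dissipation d h lam p + Rbar ^ d * ?e) / real d + L * (t * r 0) ^ d / real d)"
    using averaged_energy_cavitating[where 'n = 'n, OF assms(6,8-13) d_def[THEN meta_eq_to_obj_eq]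
        \<open>mollifier \<phi>\<close> assms(14) \<open>t > 0\<close> Rb p]
    unfolding y_def B_def d_def by blast+
  have hom: "energy_density h (averaged_deformation \<phi> n ?hom) t absolutely_integrable_on B"
    "averaged_energy \<phi> h n ?hom B t = ?V * (Rbar ^ d * ?e / real d)" if "0 < n" for n
    using averaged_energy_homogeneous[where 'n = 'n, OF d_def[THEN meta_eq_to_obj_eq] \<open>mollifier \<phi>\<close>
        \<open>lam > 0\<close> \<open>Rbar > 0\<close> that]
    unfolding B_def d_def by blast+
  have ev: "\<forall>\<^sub>F n in sequentially. (0::nat) < n" by (rule eventually_gt_at_top)
  have lim_hom: "(\<lambda>n. averaged_energy \<phi> h n ?hom B t) \<longlonglongrightarrow> ?V * (Rbar ^ d * ?e / real d)"
    by (rule tendsto_eventually) (use ev in eventually_elim, rule hom(2))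
  have "energy_exists \<phi> h y B t" "energy_exists \<phi> h ?hom B t"
    unfolding energy_exists_def
    by (intro conjI y(1) convergentI[OF y(2)] eventually_mono[OF ev hom(1)] convergentI[OF lim_hom]; assumption)+
  moreover have "energy \<phi> h y B t = energy \<phi> h ?hom B t
      + t ^ d * \<sigma> ^ d * \<omega> / real d * shock_dissipation d h lam p + t ^ d * \<omega> / real d * r 0 ^ d * L"
  proof -
    have "\<omega> = ?V" unfolding \<omega>_def surface_area_unit_sphere d_def ..
    moreover have "V * ((A * J + e) / x + L * (t * r 0) ^ d / x)
        = V * (e / x) + A * V / x * J + t ^ d * V / x * r 0 ^ d * L" for V A J e x :: real
      by (simp add: power_mult_distrib add_divide_distrib algebra_simps)
    ultimately show ?thesis unfolding energy_def limI[OF y(2)] limI[OF lim_hom] by simp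
  qed
  ultimately show ?thesis by blast
qed

end
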